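(* (1) In Case (A) (context), there is a bijection $$H\backslash\mathfrak X\simeq B_H\backslash G/P_G\simeq \coprod_{m=0}^n\ \coprod_{\substack{p,q\ge0\\ p+q\le m}}\ \coprod_{I\in\binom{[n]}{m},\ J\in\binom{[m]}{p+q}} B_{p+q}(\mathbb C)\backslash \mathrm{GL}_{p+q}(\mathbb C)/\mathrm U(p,q).$$ (2) In Case (B) (context), there is a bijection $$H\backslash\mathfrak X\simeq B_H\backslash G/P_G\simeq \coprod_{m=0}^n\ \coprod_{\substack{p,q\ge0\\ p+q\le m}}\ \coprod_{I\in\binom{[n]}{m},\ J\in\binom{[m]}{p+q}} B_{p+q}(\mathbb R)\backslash \mathrm{GL}_{p+q}(\mathbb R)/\mathrm O(p,q).$$
   Context: Case (A): $G=\mathrm U(n,n)=\{g\in\mathrm{GL}_{2n}(\mathbb C):g^*J_ng=J_n\}$ with $J_n=\sqrt{-1}\begin{pmatrix}0&\mathbf 1_n\\-\mathbf 1_n&0\end{pmatrix}$; $P_G$ the stabilizer in $G$ of $\mathbb C^n\oplus0$ (Siegel parabolic); $H=\{\mathrm{diag}(a,(a^* )^{-1}):a\in\mathrm{GL}_n(\mathbb C)\}$; $B_H=\{\mathrm{diag}(b,(b^* )^{-1}): b \text{ upper triangular in }\mathrm{GL}_n(\mathbb C)\}$. Case (B): $G=\mathrm{Sp}_{2n}(\mathbb R)$ preserving $\Sigma_n=\begin{pmatrix}0&\mathbf 1_n\\-\mathbf 1_n&0\end{pmatrix}$; $P_G$ the stabilizer of $\mathbb R^n\oplus0$; $H=\{\mathrm{diag}(a,(a^t)^{-1}):a\in\mathrm{GL}_n(\mathbb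 R)\}$; $B_H$ the same with $a$ real upper triangular. $\mathfrak X=H/B_H\times G/P_G$ with diagonal $H$-action. $[n]=\{1,\dots,n\}$ and $\binom{[n]}{m}$ is the set of $m$-element subsets of $[n]$. $B_k(\mathbb C)$ (resp. $B_k(\mathbb R)$) is the group of invertible upper triangular $k\times k$ complex (resp. real) matrices acting by left multiplication; $\mathrm U(p,q)$ (resp. $\mathrm O(p,q)$) is the subgroup of $\mathrm{GL}_{p+q}(\mathbb C)$ (resp. $\mathrm{GL}_{p+q}(\mathbb R)$) preserving the form $\mathrm{diag}(\mathbf 1_p,-\mathbf 1_q)$, acting by right multiplication. For $p=q=0$ the summand is interpreted as a one-point set. The indices $I,J$ only record multiplicities of identical summands. *)

theory Defs
  imports Complex_Main "Jordan_Normal_Form.Matrix"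
begin

definition GLm :: "nat \<Rightarrow> 'a::field mat set" where
  "GLm k = {A \<in> carrier_mat k k. invertible_mat A}"

definition Bk :: "nat \<Rightarrow> 'a::field mat set" where
  "Bk k = {A \<in> GLm k. upper_triangular A}"

definition adj_c :: "complex mat \<Rightarrow> complex mat" where
  "adj_c A = mat (dim_col A) (dim_row A) (\<lambda>(i,j). cnj (A $$ (j,i)))"

definition form_group :: "('a::field mat \<Rightarrow> 'a mat) \<Rightarrow> 'a mat \<Rightarrow> nat \<Rightarrow> 'a mat set" where
  "form_group st F k = {g \<in> GLm k. st g * F * g = F}"

definition Sigma_n :: "nat \<Rightarrow> 'a::field mat" where
  "Sigma_n n = four_block_mat (0\<^sub>m n n) (1\<^sub>m n) (- 1\<^sub>m n) (0\<^sub>m n n)"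

definition J_n :: "nat \<Rightarrow> complex mat" where
  "J_n n = \<i> \<cdot>\<^sub>m Sigma_n n"

definition I_pq :: "nat \<Rightarrow> nat \<Rightarrow> 'a::field mat" where
  "I_pq p q = four_block_mat (1\<^sub>m p) (0\<^sub>m p q) (0\<^sub>m q p) (- 1\<^sub>m q)"

definition U_nn :: "nat \<Rightarrow> complex mat set" where
  "U_nn n = form_group adj_c (J_n n) (2 * n)"

definition Sp_2n :: "nat \<Rightarrow> real mat set" where
  "Sp_2n n = form_group transpose_mat (Sigma_n n) (2 * n)"

definition U_pq :: "nat \<Rightarrow> nat \<Rightarrow> complex mat set" where
  "U_pq p q = form_group adj_c (I_pq p q) (p + q)"

definition O_pq :: "nat \<Rightarrow> nat \<Rightarrow> real mat set" where
  "O_pq p q = form_group transpose_mat (I_pq p q) (p + q)"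

definition first_half :: "nat \<Rightarrow> 'a::field vec set" where
  "first_half n = {v \<in> carrier_vec (2 * n). \<forall>i \<in> {n..<2 * n}. v $ i = 0}"

definition siegel_parabolic :: "'a::field mat set \<Rightarrow> nat \<Rightarrow> 'a mat set" where
  "siegel_parabolic G n = {g \<in> G. (\<lambda>v. g *\<^sub>v v) ` first_half n = first_half n}"

definition levi :: "('a::field mat \<Rightarrow> 'a mat) \<Rightarrow> nat \<Rightarrow> ('a mat \<Rightarrow> bool) \<Rightarrow> 'a mat set" where
  "levi st n T = {four_block_mat a (0\<^sub>m n n) (0\<^sub>m n n) b | a b.
      a \<in> GLm n \<and> T a \<and> b \<in> carrier_mat n n \<and> b * st a = 1\<^sub>m n}"

definition lmult_set :: "'a::semiring_1 mat \<Rightarrow> 'a mat set \<Rightarrow> 'a mat set" where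
  "lmult_set h C = (\<lambda>c. h * c) ` C"

definition left_cosets :: "'a::semiring_1 mat set \<Rightarrow> 'a mat set \<Rightarrow> 'a mat set set" where
  "left_cosets G K = (\<lambda>g. lmult_set g K) ` G"

definition double_cosets :: "'a::semiring_1 mat set \<Rightarrow> 'a mat set \<Rightarrow> 'a mat set \<Rightarrow> 'a mat set set" where
  "double_cosets B G P = (\<lambda>g. {b * g * p | b p. b \<in> B \<and> p \<in> P}) ` G"

definition diag_orbits :: "'a::semiring_1 mat set \<Rightarrow> 'a mat set set \<Rightarrow> 'a mat set set
    \<Rightarrow> ('a mat set \<times> 'a mat set) set set" where
  "diag_orbits H X Y = (\<lambda>(C, D). (\<lambda>h. (lmult_set h C, lmult_set h D)) ` H) ` (X \<times> Y)"

definition coprod_index :: "nat \<Rightarrow> (nat \<times> nat \<times> nat \<times> nat set \<times> nat set) set" where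
  "coprod_index n = {(m, p, q, I, J). m \<le> n \<and> p + q \<le> m \<and>
      I \<subseteq> {1..n} \<and> card I = m \<and> J \<subseteq> {1..m} \<and> card J = p + q}"

definition HA :: "nat \<Rightarrow> complex mat set" where "HA n = levi adj_c n (\<lambda>_. True)"
definition BHA :: "nat \<Rightarrow> complex mat set" where "BHA n = levi adj_c n upper_triangular"
definition PGA :: "nat \<Rightarrow> complex mat set" where "PGA n = siegel_parabolic (U_nn n) n"

definition HB :: "nat \<Rightarrow> real mat set" where "HB n = levi transpose_mat n (\<lambda>_. True)"
definition BHB :: "nat \<Rightarrow> real mat set" where "BHB n = levi transpose_mat n upper_triangular"
definition PGB :: "nat \<Rightarrow> real mat set" where "PGB n = siegel_parabolic (Sp_2n n) n"

end

theory Submission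
  imports Defs "Jordan_Normal_Form.Determinant" "HOL-Library.Infinite_Set"
begin

text \<open>
  Cosets of the Siegel parabolic are Lagrangian subspaces. A Lagrangian with basis \<open>(A, C)\<close> is the graph of a
  Hermitian form on the column space \<open>W\<close> of \<open>C\<close>, so \<open>B_H\<close>-orbits of Lagrangians are orbits of the
  triangular group on pairs of a subspace and a form on it. The orbits of subspaces are represented by
  coordinate subspaces \<open>I\<close>. On such a subspace, triangular elimination splits off the radical of the form, which
  leaves a non-degenerate form supported on a set \<open>K\<close> of coordinates in \<open>I\<close>; here \<open>K\<close> is the transport of
  \<open>J\<close> along a bijection of \<open>{1..m}\<close> with \<open>I\<close>. Both \<open>I\<close> and \<open>K\<close> are invariants, and so is, by
  Sylvester's law of inertia, the signature \<open>(p, q)\<close>. Non-degenerate forms of signature \<open>(p, q)\<close> are the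
  matrices \<open>h * I_pq p q * h^*\<close>, that is, \<open>GL_{p+q} / U(p, q)\<close>, with the triangular group acting on \<open>h\<close> from the
  left.
\<close>

section \<open>Groups of matrices and their cosets\<close>

text \<open>The last \<open>n\<close> columns of a group element are absorbed by the parabolic, so
  only the pair \<open>(A, C)\<close> up to base change remains. Its two halves are moved by
  different triangular matrices: an element of \<open>B_H\<close> acts on \<open>A\<close> by an
  upper triangular \<open>b\<close> and on \<open>C\<close> by the inverse of \<open>adj b\<close>,
  which is lower triangular. Hence elimination is needed in both directions, lower triangular for
  \<open>C\<close>, which yields \<open>I\<close>, and upper triangular for the form, which yields
  \<open>K\<close>. Elimination stops at the radical: the non-degenerate part keeps its whole
  triangular congruence problem, because that is what the quotient of GL by U(p, q) or O(p, q)
  encodes. Row elimination alone splits off the radical, since a Hermitian matrix whose rows outside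
  \<open>K\<close> vanish has vanishing columns there too. Uniqueness of \<open>I\<close> and of
  \<open>K\<close> rests on one observation about the diagonal of a triangular matrix, applied in
  both directions. Coordinate subspaces are projections of full size \<open>n\<close>, so that a
  size depending on a subset enters only for \<open>K\<close>, through \<open>emb\<close>.\<close>

lemma mat_assoc:
  fixes A :: "'a::semiring_0 mat"
  assumes "dim_col A = dim_row B" "dim_col B = dim_row C"
  shows "(A * B) * C = A * (B * C)"
  by (rule assoc_mult_mat[of A "dim_row A" "dim_row B" B "dim_row C" C "dim_col C"])
    (use assms in \<open>auto intro: carrier_matI\<close>)

lemma mat_distr_left:
  fixes A :: "'a::semiring_0 mat"
  assumes "dim_row A = dim_row B" "dim_col A = dim_col B" "dim_col A = dim_row C"
  shows "(A + B) * C = A * C + B * C"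
  by (rule add_mult_distrib_mat[of A "dim_row A" "dim_row C" B C "dim_col C"])
    (use assms in \<open>auto intro: carrier_matI\<close>)

lemma mat_distr_right:
  fixes A :: "'a::semiring_0 mat"
  assumes "dim_row B = dim_row C" "dim_col B = dim_col C" "dim_col A = dim_row B"
  shows "A * (B + C) = A * B + A * C"
  by (rule mult_add_distrib_mat[of A "dim_row A" "dim_row B" B "dim_col C" C])
    (use assms in \<open>auto intro: carrier_matI\<close>)

lemma mat_one_left: "dim_row A = n \<Longrightarrow> 1\<^sub>m n * A = (A :: 'a::semiring_1 mat)"
  by (rule left_mult_one_mat[of A n "dim_col A"]) auto

lemma mat_one_right: "dim_col A = n \<Longrightarrow> A * 1\<^sub>m n = (A :: 'a::semiring_1 mat)"
  by (rule right_mult_one_mat[of A "dim_row A" n]) auto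

lemmas mat_simps = mat_assoc mat_distr_left mat_distr_right mat_one_left mat_one_right

text \<open>Rewriting with \<open>mat_assoc\<close> nests products to the right, so an inverse pair
  appears as \<open>A * (B * C)\<close>; this rule removes it in that shape.\<close>

lemma mat_cancel:
  fixes A :: "'a::semiring_1 mat"
  assumes "A * B = 1\<^sub>m n" "A \<in> carrier_mat n m" "B \<in> carrier_mat m n" "C \<in> carrier_mat n k"
  shows "A * (B * C) = C"
  using assms assoc_mult_mat[of A n m B n C k] by simp

lemma mult_mat_index:
  "i < dim_row A \<Longrightarrow> j < dim_col B \<Longrightarrow> dim_col A = dim_row B \<Longrightarrow>
    (A * B) $$ (i, j) = (\<Sum>k<dim_row B. A $$ (i, k) * B $$ (k, j))"
  by (simp add: scalar_prod_def lessThan_atLeast0)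

section \<open>Invertible matrices\<close>

lemma GLm_iff:
  "A \<in> GLm k \<longleftrightarrow> A \<in> carrier_mat k k \<and> (\<exists>B\<in>carrier_mat k k. A * B = 1\<^sub>m k \<and> B * A = 1\<^sub>m k)"
proof
  assume "A \<in> GLm k"
  then obtain B where A: "A \<in> carrier_mat k k" and B: "A * B = 1\<^sub>m k" "B * A = 1\<^sub>m (dim_row B)"
    by (auto simp: GLm_def invertible_mat_def inverts_mat_def)
  have "dim_col B = k" using arg_cong[OF B(1), of dim_col] by simp
  moreover have "dim_row B = k" using arg_cong[OF B(2), of dim_col] A by simp
  ultimately have "B \<in> carrier_mat k k" by auto
  then show "A \<in> carrier_mat k k \<and> (\<exists>B\<in>carrier_mat k k. A * B = 1\<^sub>m k \<and> B * A = 1\<^sub>m k)"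
    using A B by auto
next
  assume "A \<in> carrier_mat k k \<and> (\<exists>B\<in>carrier_mat k k. A * B = 1\<^sub>m k \<and> B * A = 1\<^sub>m k)"
  then show "A \<in> GLm k"
    by (force simp: GLm_def invertible_mat_def inverts_mat_def)
qed

lemma GLm_carrier: "A \<in> GLm k \<Longrightarrow> A \<in> carrier_mat k k"
  by (simp add: GLm_def)

lemma GLmE:
  assumes "A \<in> GLm k"
  obtains B where "B \<in> GLm k" "A * B = 1\<^sub>m k" "B * A = 1\<^sub>m k"
  using assms unfolding GLm_iff by blast

lemma GLm_leftI:
  assumes "A \<in> carrier_mat k k" "B \<in> carrier_mat k k" "B * A = 1\<^sub>m k"
  shows "A \<in> GLm k" "A * B = 1\<^sub>m k"
  using assms mat_mult_left_right_inverse[of B k A] unfolding GLm_iff by auto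

lemma GLm_mult:
  assumes "A \<in> GLm k" "B \<in> GLm k"
  shows "A * B \<in> GLm k"
proof -
  obtain A' B' where A': "A' \<in> GLm k" "A' * A = 1\<^sub>m k" and B': "B' \<in> GLm k" "B' * B = 1\<^sub>m k"
    using assms by (metis GLmE)
  note c = assms[THEN GLm_carrier] A'(1)[THEN GLm_carrier] B'(1)[THEN GLm_carrier]
  have "(B' * A') * (A * B) = B' * (A' * (A * B))" using c by (simp add: mat_assoc)
  also have "\<dots> = 1\<^sub>m k" using c A' B' by (simp add: mat_cancel[of _ _ k k _ k])
  finally show ?thesis using c by (intro GLm_leftI[of _ _ "B' * A'"]) auto
qed

lemma GLm_one: "1\<^sub>m k \<in> GLm k"
  by (auto simp: GLm_iff)

section \<open>Triangular matrices\<close>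

lemma upper_triangular_iff:
  "A \<in> carrier_mat k k \<Longrightarrow> upper_triangular A \<longleftrightarrow> (\<forall>i<k. \<forall>j<i. A $$ (i, j) = 0)"
  by (auto simp: upper_triangular_def)

text \<open>The determinant of a triangular matrix is the product of its diagonal entries, so
  invertibility becomes a condition on entries. Explicitly given matrices are recognised as
  triangular and invertible in this form.\<close>

lemma Bk_iff:
  fixes A :: "'a::field mat"
  shows "A \<in> Bk k \<longleftrightarrow> A \<in> carrier_mat k k \<and> (\<forall>i<k. \<forall>j<i. A $$ (i, j) = 0) \<and> (\<forall>i<k. A $$ (i, i) \<noteq> 0)"
proof -
  have det: "det A \<noteq> 0 \<longleftrightarrow> (\<forall>i<k. A $$ (i, i) \<noteq> 0)"
    if "A \<in> carrier_mat k k" "upper_triangular A"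
    using det_upper_triangular[OF that(2,1)] that(1)
    by (auto simp: prod_list_zero_iff diag_mat_def)
  have "A \<in> GLm k \<longleftrightarrow> det A \<noteq> 0" if A: "A \<in> carrier_mat k k"
  proof
    assume "A \<in> GLm k"
    then obtain B where "B \<in> GLm k" "A * B = 1\<^sub>m k" by (rule GLmE)
    then have "det A * det B = 1" using A det_mult[of A k B] by (auto dest: GLm_carrier)
    then show "det A \<noteq> 0" by auto
  next
    assume "det A \<noteq> 0"
    from det_non_zero_imp_unit[OF A this, of undefined] show "A \<in> GLm k"
      using A by (auto simp: Units_def ring_mat_def GLm_iff)
  qed
  then show ?thesis unfolding Bk_def using det upper_triangular_iff[of A k]
    by (auto dest: GLm_carrier)
qed

lemma Bk_GLm: "A \<in> Bk k \<Longrightarrow> A \<in> GLm k"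
  by (simp add: Bk_def)

lemma Bk_carrier: "A \<in> Bk k \<Longrightarrow> A \<in> carrier_mat k k"
  by (simp add: Bk_def GLm_def)

lemma Bk_mult:
  assumes "A \<in> Bk k" "B \<in> Bk k"
  shows "A * B \<in> Bk k"
proof -
  note c = assms[THEN Bk_carrier]
  have "(A * B) $$ (i, j) = 0" if "i < k" "j < i" for i j
  proof -
    have *: "A $$ (i, l) * B $$ (l, j) = 0" if "l < k" for l
      using assms \<open>i < k\<close> \<open>j < i\<close> that unfolding Bk_iff by (cases "l < i") auto
    have "(A * B) $$ (i, j) = (\<Sum>l<k. A $$ (i, l) * B $$ (l, j))"
      using c that by (subst mult_mat_index) auto
    also have "\<dots> = 0" by (intro sum.neutral ballI *) simp
    finally show ?thesis .
  qed
  then show ?thesis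
    using assms c GLm_mult[of A k B] by (auto simp: Bk_def upper_triangular_def)
qed

text \<open>Downward induction on the row. In entry \<open>(i, j)\<close> of \<open>A * B\<close>
  with \<open>j < i\<close>, the terms left of the diagonal of \<open>A\<close> vanish by
  triangularity and those right of it by induction, so only \<open>A $$ (i, i) * B $$ (i, j)\<close>
  survives and must be zero.\<close>

lemma Bk_inverse:
  fixes A :: "'a::field mat"
  assumes A: "A \<in> Bk k" and B: "B \<in> carrier_mat k k" "A * B = 1\<^sub>m k"
  shows "B \<in> Bk k"
proof -
  note c = Bk_carrier[OF A]
  have "\<forall>j<i. B $$ (i, j) = 0" if "i < k" for i
    using that
  proof (induction "k - i" arbitrary: i rule: less_induct)
    case less
    show ?case
    proof (intro allI impI)
      fix j assume j: "j < i"
      have "0 = (A * B) $$ (i, j)" using B less.prems j by auto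
      also have "\<dots> = (\<Sum>l<k. A $$ (i, l) * B $$ (l, j))"
        using c B(1) less.prems j by (subst mult_mat_index) auto
      also have "\<dots> = (\<Sum>l\<in>{i}. A $$ (i, l) * B $$ (l, j))"
      proof (rule sum.mono_neutral_right)
        show "\<forall>l\<in>{..<k} - {i}. A $$ (i, l) * B $$ (l, j) = 0"
        proof
          fix l assume l: "l \<in> {..<k} - {i}"
          show "A $$ (i, l) * B $$ (l, j) = 0"
          proof (cases "l < i")
            case True then show ?thesis using A less.prems unfolding Bk_iff by auto
          next
            case False
            then have "i < l" "l < k" using l by auto
            then have "B $$ (l, j) = 0" using less.hyps[of l] j by auto
            then show ?thesis by simp
          qed
        qed
      qed (use less.prems in auto)
      finally show "B $$ (i, j) = 0" using A less.prems unfolding Bk_iff by auto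
    qed
  qed
  moreover have "B \<in> GLm k" using GLm_leftI[of B k A] c B by simp
  ultimately show ?thesis using B by (auto simp: Bk_def upper_triangular_def)
qed

lemma BkE:
  assumes "A \<in> Bk k"
  obtains B where "B \<in> Bk k" "A * B = 1\<^sub>m k" "B * A = 1\<^sub>m k"
  using assms Bk_inverse by (metis Bk_GLm GLmE GLm_carrier)

lemma Bk_one: "1\<^sub>m k \<in> Bk k"
  by (auto simp: Bk_iff)

text \<open>A common notion for \<open>G\<close>, \<open>H\<close>, \<open>B_H\<close>,
  \<open>P_G\<close>, \<open>Bk\<close> and the unitary or orthogonal groups, so that the facts on
  cosets are proved once for all of them.\<close>

definition mat_group :: "nat \<Rightarrow> 'a::semiring_1 mat set \<Rightarrow> bool" where
  "mat_group N G \<longleftrightarrow> G \<subseteq> carrier_mat N N \<and> 1\<^sub>m N \<in> G \<and> (\<forall>a\<in>G. \<forall>b\<in>G. a * b \<in> G) \<and>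
    (\<forall>a\<in>G. \<exists>b\<in>G. a * b = 1\<^sub>m N \<and> b * a = 1\<^sub>m N)"

lemma mat_group_Bk: "mat_group k (Bk k)"
  unfolding mat_group_def using Bk_carrier Bk_one Bk_mult BkE by (metis subsetI)

lemma mat_groupD:
  assumes "mat_group N G"
  shows "a \<in> G \<Longrightarrow> a \<in> carrier_mat N N" "1\<^sub>m N \<in> G" "a \<in> G \<Longrightarrow> b \<in> G \<Longrightarrow> a * b \<in> G"
  using assms unfolding mat_group_def by auto

lemma mat_groupE:
  assumes "mat_group N G" "a \<in> G"
  obtains b where "b \<in> G" "a * b = 1\<^sub>m N" "b * a = 1\<^sub>m N"
  using assms unfolding mat_group_def by blast

lemma double_coset_eq_iff:
  fixes g g' :: "'a::semiring_1 mat"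
  assumes B: "mat_group N B" and P: "mat_group N P"
    and g: "g \<in> carrier_mat N N" "g' \<in> carrier_mat N N"
  shows "{b * g * p | b p. b \<in> B \<and> p \<in> P} = {b * g' * p | b p. b \<in> B \<and> p \<in> P} \<longleftrightarrow>
    (\<exists>b\<in>B. \<exists>p\<in>P. g' = b * g * p)" (is "?D g = ?D g' \<longleftrightarrow> _")
proof
  have "g' \<in> ?D g'"
    using mat_groupD(2)[OF B] mat_groupD(2)[OF P] g
    by (intro CollectI exI[of _ "1\<^sub>m N"]) auto
  moreover assume "?D g = ?D g'"
  ultimately show "\<exists>b\<in>B. \<exists>p\<in>P. g' = b * g * p" by blast
next
  have sub: "?D (b * g * p) \<subseteq> ?D g"
    if "b \<in> B" "p \<in> P" "g \<in> carrier_mat N N" for b p g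
  proof
    fix x assume "x \<in> ?D (b * g * p)"
    then obtain c q where x: "x = c * (b * g * p) * q" "c \<in> B" "q \<in> P" by blast
    have "x = (c * b) * g * (p * q)"
      using x that mat_groupD(1)[OF B] mat_groupD(1)[OF P]
      by (simp add: mat_assoc carrier_matD[where nr=N and nc=N])
    then show "x \<in> ?D g"
      using x that mat_groupD(3)[OF B] mat_groupD(3)[OF P] by blast
  qed
  assume "\<exists>b\<in>B. \<exists>p\<in>P. g' = b * g * p"
  then obtain b p where bp: "b \<in> B" "p \<in> P" "g' = b * g * p" by blast
  obtain b' p' where b': "b' \<in> B" "b' * b = 1\<^sub>m N" and p': "p' \<in> P" "p * p' = 1\<^sub>m N"
    using mat_groupE[OF B bp(1)] mat_groupE[OF P bp(2)] by metis
  note c = bp(1,2) b'(1) p'(1)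
  have d: "b \<in> carrier_mat N N" "p \<in> carrier_mat N N" "b' \<in> carrier_mat N N" "p' \<in> carrier_mat N N"
    using c mat_groupD(1)[OF B] mat_groupD(1)[OF P] by auto
  have "b' * g' * p' = (b' * b) * g * (p * p')"
    using d g by (simp add: bp(3) mat_assoc)
  also have "\<dots> = g" using b' p' g by simp
  finally have "?D g \<subseteq> ?D g'" using sub[OF b'(1) p'(1) g(2)] by simp
  then show "?D g = ?D g'" using sub[OF bp(1,2) g(1)] bp(3) by auto
qed

lemma left_coset_eq_iff:
  fixes g g' :: "'a::semiring_1 mat"
  assumes P: "mat_group N P" and g: "g \<in> carrier_mat N N" "g' \<in> carrier_mat N N"
  shows "lmult_set g P = lmult_set g' P \<longleftrightarrow> (\<exists>p\<in>P. g' = g * p)"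
proof
  have "g' \<in> lmult_set g' P"
    using mat_groupD(2)[OF P] g by (auto simp: lmult_set_def image_iff intro!: bexI[of _ "1\<^sub>m N"])
  moreover assume "lmult_set g P = lmult_set g' P"
  ultimately show "\<exists>p\<in>P. g' = g * p" by (auto simp: lmult_set_def)
next
  have sub: "lmult_set (g * p) P \<subseteq> lmult_set g P" if "p \<in> P" "g \<in> carrier_mat N N" for p g
  proof
    fix x assume "x \<in> lmult_set (g * p) P"
    then obtain q where x: "x = g * p * q" "q \<in> P" by (auto simp: lmult_set_def)
    have "x = g * (p * q)"
      using x that mat_groupD(1)[OF P] by (simp add: mat_assoc carrier_matD[where nr=N and nc=N])
    then show "x \<in> lmult_set g P" using x that mat_groupD(3)[OF P] by (auto simp: lmult_set_def)
  qed
  assume "\<exists>p\<in>P. g' = g * p"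
  then obtain p where p: "p \<in> P" "g' = g * p" by blast
  obtain p' where p': "p' \<in> P" "p * p' = 1\<^sub>m N" using mat_groupE[OF P p(1)] by metis
  have "p \<in> carrier_mat N N" "p' \<in> carrier_mat N N" using p(1) p'(1) mat_groupD(1)[OF P] by auto
  then have "g' * p' = g" using g p' by (simp add: p(2) mat_assoc mat_one_right)
  then show "lmult_set g P = lmult_set g' P"
    using sub[OF p'(1) g(2)] sub[OF p(1) g(1)] p(2) by auto
qed

lemma lmult_set_mult:
  fixes h :: "'a::semiring_1 mat"
  assumes "mat_group N P" "h \<in> carrier_mat N N" "g \<in> carrier_mat N N"
  shows "lmult_set h (lmult_set g P) = lmult_set (h * g) P"
proof -
  have "h * (g * p) = h * g * p" if "p \<in> P" for p
    using assms mat_groupD(1)[OF assms(1) that] by (simp add: mat_assoc)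
  then show ?thesis by (simp add: lmult_set_def image_image cong: image_cong_simp)
qed

text \<open>Quotients are treated as images of class maps \<open>f\<close> and \<open>g\<close>. A
  map \<open>\<phi>\<close> between representatives that preserves and reflects equality of classes
  and meets every class descends to a bijection; it need not be surjective itself.\<close>

lemma bij_betw_imagesI:
  assumes "\<And>x. x \<in> X \<Longrightarrow> \<phi> x \<in> Y"
    and "\<And>x x'. x \<in> X \<Longrightarrow> x' \<in> X \<Longrightarrow> f x = f x' \<longleftrightarrow> g (\<phi> x) = g (\<phi> x')"
    and "\<And>y. y \<in> Y \<Longrightarrow> \<exists>x\<in>X. g y = g (\<phi> x)"
  shows "\<exists>F. bij_betw F (f ` X) (g ` Y)"
proof -
  define F where "F c = g (\<phi> (SOME x. x \<in> X \<and> f x = c))" for c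
  have F: "F (f x) = g (\<phi> x)" if "x \<in> X" for x
  proof -
    have "(SOME x'. x' \<in> X \<and> f x' = f x) \<in> X \<and> f (SOME x'. x' \<in> X \<and> f x' = f x) = f x"
      by (rule someI[of _ x]) (use that in simp)
    then show ?thesis using assms(2) that unfolding F_def by blast
  qed
  have "inj_on F (f ` X)"
    by (rule inj_onI) (use assms(2) F in force)
  moreover have "F ` f ` X = g ` Y"
    using F assms(1,3) by (force simp: image_iff)
  ultimately show ?thesis by (auto simp: bij_betw_def)
qed

text \<open>Acting by the inverse of \<open>a\<close> moves the pair of cosets of \<open>a\<close>
  and \<open>g\<close> to the base coset and the coset of \<open>invH a * g\<close>. The stabilizer
  of the base coset in \<open>H\<close> is \<open>B\<close>, so the orbit corresponds to the double
  coset of \<open>invH a * g\<close>.\<close>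

lemma diag_orbits_bij:
  fixes G :: "'a::semiring_1 mat set"
  assumes G: "mat_group N G" and H: "mat_group N H" and B: "mat_group N B" and P: "mat_group N P"
    and sub: "H \<subseteq> G" "B \<subseteq> H" "P \<subseteq> G"
  shows "\<exists>f. bij_betw f (diag_orbits H (left_cosets H B) (left_cosets G P)) (double_cosets B G P)"
proof -
  define orb where "orb = (\<lambda>(a, g). (\<lambda>h. (lmult_set h (lmult_set a B), lmult_set h (lmult_set g P))) ` H)"
  define D where "D g = {b * g * p | b p. b \<in> B \<and> p \<in> P}" for g
  define invH where "invH a = (SOME b. b \<in> H \<and> a * b = 1\<^sub>m N \<and> b * a = 1\<^sub>m N)" for a
  have inv: "invH a \<in> H" "a * invH a = 1\<^sub>m N" "invH a * a = 1\<^sub>m N" if "a \<in> H" for a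
  proof -
    have "\<exists>b. b \<in> H \<and> a * b = 1\<^sub>m N \<and> b * a = 1\<^sub>m N" using mat_groupE[OF H that] by metis
    from someI_ex[OF this] show "invH a \<in> H" "a * invH a = 1\<^sub>m N" "invH a * a = 1\<^sub>m N"
      unfolding invH_def by auto
  qed
  note car = mat_groupD(1)[OF G] mat_groupD(1)[OF H] mat_groupD(1)[OF B] mat_groupD(1)[OF P]
  have orb: "orb (a, g) = (\<lambda>h. (lmult_set (h * a) B, lmult_set (h * g) P)) ` H"
    if "a \<in> H" "g \<in> G" for a g
    using that car unfolding orb_def by (auto simp: lmult_set_mult[OF B] lmult_set_mult[OF P] image_iff)
  have sub_orb: "orb (h * a, h * g) \<subseteq> orb (a, g)" if "a \<in> H" "g \<in> G" "h \<in> H" for a g h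
  proof -
    have "(lmult_set (k * (h * a)) B, lmult_set (k * (h * g)) P) \<in> orb (a, g)" if k: "k \<in> H" for k
    proof -
      have "k * (h * a) = (k * h) * a" "k * (h * g) = (k * h) * g"
        using that \<open>a \<in> H\<close> \<open>g \<in> G\<close> \<open>h \<in> H\<close> car by (simp_all add: mat_assoc carrier_matD[where nr=N and nc=N])
      then show ?thesis
        using orb[OF \<open>a \<in> H\<close> \<open>g \<in> G\<close>] mat_groupD(3)[OF H k \<open>h \<in> H\<close>] by auto
    qed
    moreover have "h * a \<in> H" "h * g \<in> G"
      using that sub mat_groupD(3)[OF H] mat_groupD(3)[OF G] by auto
    ultimately show ?thesis using orb[of "h * a" "h * g"] by auto
  qed
  have orb_eq: "orb (a, g) = orb (a', g') \<longleftrightarrow>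
      (\<exists>h\<in>H. lmult_set (h * a) B = lmult_set a' B \<and> lmult_set (h * g) P = lmult_set g' P)"
    if m: "a \<in> H" "g \<in> G" "a' \<in> H" "g' \<in> G" for a g a' g'
  proof
    assume "orb (a, g) = orb (a', g')"
    moreover have "1\<^sub>m N * a' = a'" "1\<^sub>m N * g' = g'" using left_mult_one_mat[OF car(2)[OF m(3)]] left_mult_one_mat[OF car(1)[OF m(4)]] by fast+
    then have "(lmult_set a' B, lmult_set g' P) \<in> orb (a', g')"
      unfolding orb[OF m(3,4)] using mat_groupD(2)[OF H] by (intro image_eqI[of _ _ "1\<^sub>m N"]) auto
    ultimately have "(lmult_set a' B, lmult_set g' P) \<in> orb (a, g)" by simp
    then show "\<exists>h\<in>H. lmult_set (h * a) B = lmult_set a' B \<and> lmult_set (h * g) P = lmult_set g' P"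
      using orb[OF m(1,2)] by auto
  next
    assume "\<exists>h\<in>H. lmult_set (h * a) B = lmult_set a' B \<and> lmult_set (h * g) P = lmult_set g' P"
    then obtain h where h: "h \<in> H" "lmult_set (h * a) B = lmult_set a' B" "lmult_set (h * g) P = lmult_set g' P"
      by blast
    have hm: "h * a \<in> H" "h * g \<in> G"
      using m h(1) sub mat_groupD(3)[OF H] mat_groupD(3)[OF G] by auto
    have eq: "orb (a', g') = orb (h * a, h * g)" using h unfolding orb_def by auto
    have "invH h * (h * a) = a" "invH h * (h * g) = g"
      using inv[OF h(1)] m h(1) car by (auto intro: mat_cancel)
    then have "orb (a, g) \<subseteq> orb (h * a, h * g)"
      using sub_orb[OF hm inv(1)[OF h(1)]] by simp
    then show "orb (a, g) = orb (a', g')" using eq sub_orb[OF m(1,2) h(1)] by auto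
  qed
  have key: "orb (a, g) = orb (a', g') \<longleftrightarrow> D (invH a * g) = D (invH a' * g')"
    if m: "a \<in> H" "g \<in> G" "a' \<in> H" "g' \<in> G" for a g a' g'
  proof -
    note i = inv[OF m(1)] inv[OF m(3)]
    note c = m(1,3)[THEN car(2)] m(2,4)[THEN car(1)] i(1,4)[THEN car(2)]
    have "orb (a, g) = orb (a', g') \<longleftrightarrow> (\<exists>h\<in>H. \<exists>b\<in>B. \<exists>p\<in>P. a' = h * a * b \<and> g' = h * g * p)"
    proof -
      have "lmult_set (h * a) B = lmult_set a' B \<longleftrightarrow> (\<exists>b\<in>B. a' = h * a * b)"
        "lmult_set (h * g) P = lmult_set g' P \<longleftrightarrow> (\<exists>p\<in>P. g' = h * g * p)" if "h \<in> H" for h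
        using c car(2)[OF that] by (simp_all add: left_coset_eq_iff[OF B] left_coset_eq_iff[OF P])
      then show ?thesis unfolding orb_eq[OF m] by (metis (no_types, lifting))
    qed
    also have "\<dots> \<longleftrightarrow> (\<exists>b\<in>B. \<exists>p\<in>P. invH a' * g' = b * (invH a * g) * p)"
    proof
      assume "\<exists>h\<in>H. \<exists>b\<in>B. \<exists>p\<in>P. a' = h * a * b \<and> g' = h * g * p"
      then obtain h b p where h: "h \<in> H" "b \<in> B" "p \<in> P" "a' = h * a * b" "g' = h * g * p" by blast
      obtain b' where b': "b' \<in> B" "b * b' = 1\<^sub>m N" "b' * b = 1\<^sub>m N" using mat_groupE[OF B h(2)] by metis
      note d = h(1)[THEN car(2)] h(2)[THEN car(3)] h(3)[THEN car(4)] b'(1)[THEN car(3)]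
      \<comment> \<open>Since \<open>a' = h * a * b\<close>, the product
        \<open>invH a' * h * a\<close> is the inverse of \<open>b\<close> and therefore lies in
        \<open>B\<close>.\<close>
      have "a' * b' = h * a" using h(4) c d b' by (simp add: mat_assoc mat_one_right)
      then have "invH a' * (h * a) = invH a' * (a' * b')" by simp
      also have "\<dots> = b'" using i c d by (auto intro: mat_cancel)
      finally have e: "invH a' * (h * a) = b'" .
      have "b' * (invH a * g) = invH a' * (h * (a * (invH a * g)))"
        unfolding e[symmetric] using c d by (simp add: mat_assoc)
      also have "a * (invH a * g) = g" using i c by (auto intro: mat_cancel)
      finally have "b' * (invH a * g) = invH a' * (h * g)" .
      then have "invH a' * g' = b' * (invH a * g) * p"
        using h(5) c d by (simp add: mat_assoc)
      then show "\<exists>b\<in>B. \<exists>p\<in>P. invH a' * g' = b * (invH a * g) * p" using b' h by blast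
    next
      assume "\<exists>b\<in>B. \<exists>p\<in>P. invH a' * g' = b * (invH a * g) * p"
      then obtain b p where h: "b \<in> B" "p \<in> P" "invH a' * g' = b * (invH a * g) * p" by blast
      obtain b' where b': "b' \<in> B" "b * b' = 1\<^sub>m N" "b' * b = 1\<^sub>m N" using mat_groupE[OF B h(1)] by metis
      note d = h(1)[THEN car(3)] h(2)[THEN car(4)] b'(1)[THEN car(3)]
      \<comment> \<open>\<open>k\<close> is the solution of \<open>a' = k * a * b'\<close>, where
        \<open>b'\<close> is the inverse of \<open>b\<close>.\<close>
      define k where "k = a' * b * invH a"
      have k: "k \<in> H" unfolding k_def
        by (rule mat_groupD(3)[OF H mat_groupD(3)[OF H m(3) subsetD[OF sub(2) h(1)]] inv(1)[OF m(1)]])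
      have "k * a = a' * b" unfolding k_def using c d i by (simp add: mat_assoc mat_one_right)
      then have "a' = k * a * b'" using c d b' by (simp add: mat_assoc mat_one_right)
      moreover have "g' = a' * (invH a' * g')" using i c by (auto intro: mat_cancel[symmetric])
      then have "g' = k * g * p" unfolding h(3) k_def using c d by (simp add: mat_assoc)
      ultimately show "\<exists>h\<in>H. \<exists>b\<in>B. \<exists>p\<in>P. a' = h * a * b \<and> g' = h * g * p" using k b' h by blast
    qed
    also have "\<dots> \<longleftrightarrow> D (invH a * g) = D (invH a' * g')"
      unfolding D_def using c by (subst double_coset_eq_iff[OF B P]) auto
    finally show ?thesis .
  qed
  have "\<exists>F. bij_betw F (orb ` (H \<times> G)) (D ` G)"
  proof (rule bij_betw_imagesI[where \<phi> = "\<lambda>(a, g). invH a * g"])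
    show "(case x of (a, g) \<Rightarrow> invH a * g) \<in> G" if "x \<in> H \<times> G" for x
      using that subsetD[OF sub(1) inv(1)] mat_groupD(3)[OF G] by auto
    show "\<exists>x\<in>H \<times> G. D y = D (case x of (a, g) \<Rightarrow> invH a * g)" if "y \<in> G" for y
    proof -
      have "invH (1\<^sub>m N) * (1\<^sub>m N * y) = y"
        using inv[OF mat_groupD(2)[OF H]] that car by (intro mat_cancel[where n=N and m=N and k=N]) auto
      then have "invH (1\<^sub>m N) * y = y" using car(1)[OF that] by simp
      then show ?thesis using that mat_groupD(2)[OF H] by (intro bexI[of _ "(1\<^sub>m N, y)"]) auto
    qed
    show "orb x = orb x' \<longleftrightarrow> D (case x of (a, g) \<Rightarrow> invH a * g) = D (case x' of (a, g) \<Rightarrow> invH a * g)"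
      if "x \<in> H \<times> G" "x' \<in> H \<times> G" for x x'
      using that key by (cases x, cases x') simp
  qed
  moreover have "orb ` (H \<times> G) = diag_orbits H (left_cosets H B) (left_cosets G P)"
    unfolding diag_orbits_def left_cosets_def orb_def by (force simp: image_iff)
  moreover have "D ` G = double_cosets B G P"
    unfolding double_cosets_def D_def by simp
  ultimately show ?thesis by simp
qed

section \<open>Adjoints, coordinate projections and elimination\<close>

text \<open>Both cases at once: \<open>cj\<close> is complex conjugation in Case (A) and the identity of the reals in Case (B).\<close>

locale conj_field =
  fixes cj :: "'a::real_field \<Rightarrow> 'a"
  assumes cj_add: "cj (x + y) = cj x + cj y"
    and cj_mult: "cj (x * y) = cj x * cj y"
    and cj_cj [simp]: "cj (cj x) = x"
    and cj_of_real [simp]: "cj (of_real r) = of_real r"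
    and cj_fixed: "cj x = x \<Longrightarrow> x \<in> \<real>"
    and cj_pos: "x \<noteq> 0 \<Longrightarrow> \<exists>r>0. x * cj x = of_real r"
begin

lemma cj_0 [simp]: "cj 0 = 0" and cj_1 [simp]: "cj 1 = 1"
  using cj_of_real[of 0] cj_of_real[of 1] by simp_all

lemma cj_uminus: "cj (- x) = - cj x"
  using cj_add[of x "- x"] by (simp add: eq_neg_iff_add_eq_0 add.commute)

lemma cj_eq_0_iff [simp]: "cj x = 0 \<longleftrightarrow> x = 0"
  by (metis cj_0 cj_cj)

lemma cj_sum: "cj (sum f A) = (\<Sum>x\<in>A. cj (f x))"
  by (induction A rule: infinite_finite_induct) (simp_all add: cj_add)

definition adj :: "'a mat \<Rightarrow> 'a mat" where
  "adj A = mat (dim_col A) (dim_row A) (\<lambda>(i, j). cj (A $$ (j, i)))"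

lemma adj_dim [simp]: "dim_row (adj A) = dim_col A" "dim_col (adj A) = dim_row A"
  by (simp_all add: adj_def)

lemma adj_index: "i < dim_col A \<Longrightarrow> j < dim_row A \<Longrightarrow> adj A $$ (i, j) = cj (A $$ (j, i))"
  by (simp add: adj_def)

lemma adj_carrier [simp]: "A \<in> carrier_mat k l \<Longrightarrow> adj A \<in> carrier_mat l k"
  by (simp add: adj_def)

lemma adj_adj [simp]: "adj (adj A) = A"
  by (rule eq_matI) (auto simp: adj_index)

lemma adj_one [simp]: "adj (1\<^sub>m k) = 1\<^sub>m k"
  by (rule eq_matI) (auto simp: adj_index)

lemma adj_zero [simp]: "adj (0\<^sub>m k l) = 0\<^sub>m l k"
  by (rule eq_matI) (auto simp: adj_index)

lemma adj_uminus: "adj (- A) = - adj A"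
  by (rule eq_matI) (auto simp: adj_index cj_uminus)

lemma adj_add: "dim_row A = dim_row B \<Longrightarrow> dim_col A = dim_col B \<Longrightarrow> adj (A + B) = adj A + adj B"
  by (rule eq_matI) (auto simp: adj_index cj_add)

lemma adj_mult: "dim_col A = dim_row B \<Longrightarrow> adj (A * B) = adj B * adj A"
  by (rule eq_matI) (auto simp: adj_index mult_mat_index cj_sum cj_mult mult.commute simp del: index_mult_mat(1)
    intro!: sum.cong)

lemma adj_four_block:
  assumes "A \<in> carrier_mat k l" "B \<in> carrier_mat k l'" "C \<in> carrier_mat k' l" "D \<in> carrier_mat k' l'"
  shows "adj (four_block_mat A B C D) = four_block_mat (adj A) (adj C) (adj B) (adj D)"
  using assms by (intro eq_matI) (auto simp: adj_index)

lemma adj_GLm: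
  assumes "A \<in> GLm k" shows "adj A \<in> GLm k"
proof -
  obtain B where B: "B \<in> GLm k" "A * B = 1\<^sub>m k" using assms by (rule GLmE)
  then have "adj B * adj A = 1\<^sub>m k"
    using adj_mult[of A B] assms by (auto dest!: GLm_carrier)
  then show ?thesis
    using assms B GLm_leftI[of "adj A" k "adj B"] by (simp add: GLm_carrier)
qed

end

text \<open>Keeping coordinate subspaces as full-size projections replaces block decompositions by
  identities between \<open>diag_proj n I\<close> and \<open>diag_proj n (- I)\<close>, and no
  matrix changes its size.\<close>

definition diag_proj :: "nat \<Rightarrow> nat set \<Rightarrow> 'a::field mat" where
  "diag_proj n I = mat n n (\<lambda>(i, j). if i = j \<and> i \<in> I then 1 else 0)"

lemma diag_proj_dim [simp]: "dim_row (diag_proj n I) = n" "dim_col (diag_proj n I) = n"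
  by (simp_all add: diag_proj_def)

lemma diag_proj_carrier [simp]: "diag_proj n I \<in> carrier_mat n n"
  by auto

lemma diag_proj_index: "i < n \<Longrightarrow> j < n \<Longrightarrow> diag_proj n I $$ (i, j) = (if i = j \<and> i \<in> I then 1 else 0)"
  by (simp add: diag_proj_def)

lemma diag_proj_mult_index:
  assumes "dim_row A = n" "i < n" "j < dim_col A"
  shows "(diag_proj n I * A) $$ (i, j) = (if i \<in> I then A $$ (i, j) else 0)"
proof -
  have "(diag_proj n I * A) $$ (i, j) = (\<Sum>k<n. diag_proj n I $$ (i, k) * A $$ (k, j))"
    using assms by (subst mult_mat_index) auto
  also have "\<dots> = (\<Sum>k<n. (if i = k then if i \<in> I then A $$ (k, j) else 0 else 0))"
    using assms by (intro sum.cong refl) (auto simp: diag_proj_index)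
  also have "\<dots> = (if i \<in> I then A $$ (i, j) else 0)"
    using assms by (subst sum.delta') auto
  finally show ?thesis .
qed

lemma mult_diag_proj_index:
  assumes "dim_col A = n" "j < n" "i < dim_row A"
  shows "(A * diag_proj n I) $$ (i, j) = (if j \<in> I then A $$ (i, j) else 0)"
proof -
  have "(A * diag_proj n I) $$ (i, j) = (\<Sum>k<n. A $$ (i, k) * diag_proj n I $$ (k, j))"
    using assms by (subst mult_mat_index) auto
  also have "\<dots> = (\<Sum>k<n. (if k = j then if j \<in> I then A $$ (i, k) else 0 else 0))"
    using assms by (intro sum.cong refl) (auto simp: diag_proj_index)
  also have "\<dots> = (if j \<in> I then A $$ (i, j) else 0)"
    using assms by (subst sum.delta) auto
  finally show ?thesis .
qed

lemma diag_proj_mult_diag_proj: "diag_proj n I * diag_proj n K = diag_proj n (I \<inter> K)"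
  by (rule eq_matI) (auto simp: diag_proj_mult_index diag_proj_index simp del: index_mult_mat(1))

lemma diag_proj_empty: "diag_proj n {} = 0\<^sub>m n n"
  by (rule eq_matI) (auto simp: diag_proj_index)

lemma diag_proj_compl: "diag_proj n I + diag_proj n (- I) = 1\<^sub>m n"
  by (rule eq_matI) (auto simp: diag_proj_index)

lemma diag_proj_simps:
  "diag_proj n I * diag_proj n I = diag_proj n I"
  "diag_proj n I * diag_proj n (- I) = 0\<^sub>m n n"
  "diag_proj n (- I) * diag_proj n I = 0\<^sub>m n n"
  "diag_proj n (- I) * diag_proj n (- I) = diag_proj n (- I)"
  by (simp_all add: diag_proj_mult_diag_proj diag_proj_empty)

lemma (in conj_field) adj_diag_proj [simp]: "adj (diag_proj n I) = diag_proj n I"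
  by (rule eq_matI) (auto simp: adj_index diag_proj_index)

text \<open>The diagonal entry \<open>(i, i)\<close> of the product on the left cannot vanish for \<open>i \<in> K\<close>,
  while row \<open>i\<close> of the product on the right vanishes for \<open>i \<notin> I\<close>.\<close>

lemma diag_proj_triangular_subset:
  fixes b :: "'a::field mat"
  assumes "b * diag_proj n K = diag_proj n I * x" "b \<in> carrier_mat n n" "x \<in> carrier_mat n n"
    and "\<And>i. i < n \<Longrightarrow> b $$ (i, i) \<noteq> 0" "K \<subseteq> {..<n}"
  shows "K \<subseteq> I"
proof
  fix i assume i: "i \<in> K"
  then have "i < n" using assms by auto
  have "(b * diag_proj n K) $$ (i, i) \<noteq> 0"
    using mult_diag_proj_index[of b n i i K] i \<open>i < n\<close> assms by auto
  moreover have "(diag_proj n I * x) $$ (i, i) = (if i \<in> I then x $$ (i, i) else 0)"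
    using assms \<open>i < n\<close> by (intro diag_proj_mult_index) auto
  ultimately show "i \<in> I" using assms(1) by (auto split: if_splits)
qed

text \<open>\<open>u\<close> replaces the coordinate \<open>k\<close> of a vector by the linear form
  \<open>w\<close>. Solving for that coordinate, which divides by \<open>w k\<close>, inverts it;
  \<open>v\<close> is the solution.\<close>

lemma GLm_update_row:
  fixes w :: "nat \<Rightarrow> 'a::field"
  assumes "w k \<noteq> 0" "k < n"
  defines "u \<equiv> mat n n (\<lambda>(i, j). if i = k then w j else if i = j then 1 else 0)"
  shows "u \<in> GLm n"
proof -
  define v where "v = mat n n (\<lambda>(i, j). if i = k then (if j = k then 1 else - w j) / w k else if i = j then 1 else 0)"
  have c: "u \<in> carrier_mat n n" "v \<in> carrier_mat n n" by (auto simp: u_def v_def)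
  have "v * u = 1\<^sub>m n"
  proof (rule eq_matI)
    fix i j assume ij: "i < dim_row (1\<^sub>m n)" "j < dim_col (1\<^sub>m n)"
    have "(v * u) $$ (i, j) = (\<Sum>l<n. v $$ (i, l) * u $$ (l, j))"
      using c ij by (subst mult_mat_index) auto
    also have "\<dots> = (\<Sum>l<n. (if l = k then v $$ (i, k) * w j else 0) + (if l = j then if j = k then 0 else v $$ (i, j) else 0))"
      using ij assms(2) by (intro sum.cong) (auto simp: u_def)
    also have "\<dots> = v $$ (i, k) * w j + (if j = k then 0 else v $$ (i, j))"
      using ij assms(2) by (simp add: sum.distrib)
    also have "\<dots> = 1\<^sub>m n $$ (i, j)"
      using ij assms by (auto simp: v_def field_simps)
    finally show "(v * u) $$ (i, j) = 1\<^sub>m n $$ (i, j)" .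
  qed (use c in auto)
  then show ?thesis using c GLm_leftI by blast
qed

text \<open>Elimination row by row: the part of the new row supported on the pivots found so far is removed
  by a triangular row operation; what is left, if non-zero, is moved to the unit vector of its row
  by a column operation that fixes the earlier pivots.\<close>

lemma echelon_step:
  fixes D :: "'a::field mat"
  assumes D: "D \<in> carrier_mat n n" and k: "k < n" and K: "K \<subseteq> {..<k}"
    and rows: "\<And>i j. i < k \<Longrightarrow> j < n \<Longrightarrow> D $$ (i, j) = (if i = j \<and> i \<in> K then 1 else 0)"
  shows "\<exists>c x K'. c \<in> carrier_mat n n \<and> (\<forall>i<n. \<forall>j<n. i < j \<longrightarrow> c $$ (i, j) = 0) \<and> (\<forall>i<n. c $$ (i, i) = 1) \<and>
    x \<in> GLm n \<and> K' \<subseteq> {..<Suc k} \<and>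
    (\<forall>i<Suc k. \<forall>j<n. (c * D * x) $$ (i, j) = (if i = j \<and> i \<in> K' then 1 else 0))"
proof -
  \<comment> \<open>The rows in \<open>K\<close> are unit vectors, so subtracting
    \<open>D $$ (k, j)\<close> times row \<open>j\<close> for each \<open>j\<close> in
    \<open>K\<close> clears row \<open>k\<close> at the pivot columns and changes no other entry.
    \<open>w\<close> is what remains of that row.\<close>
  define c where "c = mat n n (\<lambda>(i, j). if i = j then 1 else if i = k \<and> j \<in> K then - D $$ (k, j) else 0)"
  define w where "w j = (if j \<in> K then 0 else D $$ (k, j))" for j
  have c: "c \<in> carrier_mat n n" "\<forall>i<n. \<forall>j<n. i < j \<longrightarrow> c $$ (i, j) = 0" "\<forall>i<n. c $$ (i, i) = 1"
    using K by (auto simp: c_def)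
  define F where "F = c * D"
  have F: "F \<in> carrier_mat n n" using c D by (simp add: F_def)
  have F_index: "F $$ (i, j) = (if i < k then if i = j \<and> i \<in> K then 1 else 0 else w j)" if "i < Suc k" "j < n" for i j
  proof (cases "i < k")
    case True
    have "F $$ (i, j) = (\<Sum>l<n. c $$ (i, l) * D $$ (l, j))"
      unfolding F_def using c D that k by (subst mult_mat_index) auto
    also have "\<dots> = (\<Sum>l<n. if l = i then D $$ (l, j) else 0)"
      using True k by (intro sum.cong) (auto simp: c_def)
    also have "\<dots> = D $$ (i, j)" using True k by simp
    finally show ?thesis using rows True that by simp
  next
    case False
    then have i: "i = k" using that by simp
    have "F $$ (k, j) = (\<Sum>l<n. c $$ (k, l) * D $$ (l, j))"
      unfolding F_def using c D that k by (subst mult_mat_index) auto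
    also have "\<dots> = (\<Sum>l<n. (if l = k then D $$ (l, j) else 0) + (if l = j then if j \<in> K then - D $$ (k, j) else 0 else 0))"
    proof (intro sum.cong refl)
      fix l assume l: "l \<in> {..<n}"
      show "c $$ (k, l) * D $$ (l, j) = (if l = k then D $$ (l, j) else 0) + (if l = j then if j \<in> K then - D $$ (k, j) else 0 else 0)"
        using l k K that rows[of l j] by (cases "l \<in> K") (auto simp: c_def)
    qed
    also have "\<dots> = w j" using k that by (simp add: sum.distrib w_def)
    finally show ?thesis using i by simp
  qed
  show ?thesis
  proof (cases "\<forall>j<n. w j = 0")
    case True
    have "(\<forall>i<Suc k. \<forall>j<n. (c * D * 1\<^sub>m n) $$ (i, j) = (if i = j \<and> i \<in> K then 1 else 0))"
      using F_index True F K k unfolding F_def[symmetric] by auto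
    moreover have "K \<subseteq> {..<Suc k}" using K by auto
    ultimately show ?thesis using c GLm_one[of n]
      by (intro exI[of _ c] exI[of _ "1\<^sub>m n"] exI[of _ K] conjI)
  next
    case False
    then obtain l where l: "l < n" "w l \<noteq> 0" by blast
    \<comment> \<open>\<open>\<tau>\<close> exchanges column \<open>k\<close> with a column where
      the remaining row is non-zero. Both lie outside \<open>K\<close>, so earlier pivots stay in
      place.\<close>
    define \<tau> where "\<tau> i = (if i = l then k else if i = k then l else i)" for i
    have notK: "l \<notin> K" "k \<notin> K" using l(2) K by (auto simp: w_def)
    have \<tau>: "\<tau> (\<tau> i) = i" "i < n \<Longrightarrow> \<tau> i < n" "i \<in> K \<Longrightarrow> \<tau> i = i" for i
    proof -
      show "\<tau> (\<tau> i) = i" by (simp add: \<tau>_def)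
      show "i < n \<Longrightarrow> \<tau> i < n" using l(1) k by (simp add: \<tau>_def)
      show "i \<in> K \<Longrightarrow> \<tau> i = i" using notK by (auto simp: \<tau>_def)
    qed
    define t :: "'a mat" where "t = mat n n (\<lambda>(i, j). if j = \<tau> i then 1 else 0)"
    have t: "t \<in> carrier_mat n n" by (simp add: t_def)
    have t_mult: "(M * t) $$ (i, j) = M $$ (i, \<tau> j)" if "M \<in> carrier_mat n n" "i < n" "j < n" for M i j
    proof -
      have "(M * t) $$ (i, j) = (\<Sum>l<n. M $$ (i, l) * t $$ (l, j))"
        using t that by (subst mult_mat_index) auto
      also have "\<dots> = (\<Sum>l<n. if l = \<tau> j then M $$ (i, l) else 0)"
        using that \<tau> by (intro sum.cong) (auto simp: t_def)
      also have "\<dots> = M $$ (i, \<tau> j)" using \<tau>(2) that by simp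
      finally show ?thesis .
    qed
    have "t * t = 1\<^sub>m n"
    proof (rule eq_matI)
      fix i j assume "i < dim_row (1\<^sub>m n :: 'a mat)" "j < dim_col (1\<^sub>m n :: 'a mat)"
      then have ij: "i < n" "j < n" by auto
      have "(t * t) $$ (i, j) = t $$ (i, \<tau> j)" by (rule t_mult[OF t ij])
      moreover have "\<tau> j = \<tau> i \<longleftrightarrow> i = j" using \<tau>(1) by metis
      ultimately show "(t * t) $$ (i, j) = 1\<^sub>m n $$ (i, j)" using ij \<tau>(2) by (simp add: t_def)
    qed (use t in auto)
    then have tG: "t \<in> GLm n" using GLm_leftI t by blast
    \<comment> \<open>On the first \<open>k + 1\<close> rows, \<open>F * t\<close> equals the
      projection onto \<open>insert k K\<close> times \<open>u\<close>. Multiplying by the inverse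
      of \<open>u\<close> therefore leaves the projection itself.\<close>
    define u where "u = mat n n (\<lambda>(i, j). if i = k then w (\<tau> j) else if i = j then 1 else 0)"
    have "u \<in> GLm n"
      unfolding u_def using l k by (intro GLm_update_row) (auto simp: \<tau>_def)
    then obtain v where v: "v \<in> GLm n" "u * v = 1\<^sub>m n" by (rule GLmE)
    have uc: "u \<in> carrier_mat n n" by (simp add: u_def)
    have Fu: "(F * t) $$ (i, j) = (diag_proj n (insert k K) * u) $$ (i, j)" if "i < Suc k" "j < n" for i j
    proof -
      have "(F * t) $$ (i, j) = F $$ (i, \<tau> j)" using that k F by (intro t_mult) auto
      moreover have "(diag_proj n (insert k K) * u) $$ (i, j) = (if i \<in> insert k K then u $$ (i, j) else 0)"
        using that k uc by (intro diag_proj_mult_index) auto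
      moreover have "i \<in> K \<Longrightarrow> i = \<tau> j \<longleftrightarrow> i = j" using \<tau> by metis
      ultimately show ?thesis using that k K \<tau>(2)[of j] by (auto simp: F_index u_def)
    qed
    have tv: "t * v \<in> GLm n" using tG v by (simp add: GLm_mult)
    have "(c * D * (t * v)) $$ (i, j) = (if i = j \<and> i \<in> insert k K then 1 else 0)" if ij: "i < Suc k" "j < n" for i j
    proof -
      note cc = F t v(1)[THEN GLm_carrier] uc
      have "c * D * (t * v) = (F * t) * v" using cc by (simp add: mat_assoc F_def[symmetric])
      also have "((F * t) * v) $$ (i, j) = (\<Sum>l<n. (F * t) $$ (i, l) * v $$ (l, j))"
        using cc ij k by (subst mult_mat_index) auto
      also have "\<dots> = (\<Sum>l<n. (diag_proj n (insert k K) * u) $$ (i, l) * v $$ (l, j))"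
        using Fu ij by (intro sum.cong) auto
      also have "\<dots> = ((diag_proj n (insert k K) * u) * v) $$ (i, j)"
        using cc ij k by (subst mult_mat_index) auto
      also have "(diag_proj n (insert k K) * u) * v = diag_proj n (insert k K)"
        using cc v by (simp add: mat_assoc mat_one_right)
      finally show ?thesis using ij k by (simp add: diag_proj_index)
    qed
    then have "\<forall>i<Suc k. \<forall>j<n. (c * D * (t * v)) $$ (i, j) = (if i = j \<and> i \<in> insert k K then 1 else 0)" by blast
    moreover have "insert k K \<subseteq> {..<Suc k}" using K by auto
    ultimately show ?thesis using c tv
      by (intro exI[of _ c] exI[of _ "t * v"] exI[of _ "insert k K"] conjI)
  qed
qed

text \<open>\<open>K\<close> collects the rows that are not spanned by the rows above them, which is
  what lower triangular row operations cannot change. Lower triangularity is expressed through the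
  transpose in order to reuse the group laws of \<open>Bk\<close>.\<close>

lemma echelon_lower:
  fixes C :: "'a::field mat"
  assumes C: "C \<in> carrier_mat n n"
  shows "\<exists>c x K. c \<in> carrier_mat n n \<and> transpose_mat c \<in> Bk n \<and> x \<in> GLm n \<and> K \<subseteq> {..<n} \<and>
    c * C * x = diag_proj n K"
proof -
  have low: "transpose_mat c \<in> Bk n \<longleftrightarrow> (\<forall>i<n. \<forall>j<n. i < j \<longrightarrow> c $$ (i, j) = 0) \<and> (\<forall>i<n. c $$ (i, i) \<noteq> 0)"
    if "c \<in> carrier_mat n n" for c :: "'a mat"
    using that unfolding Bk_iff by auto
  have "\<exists>c x K. c \<in> carrier_mat n n \<and> transpose_mat c \<in> Bk n \<and> x \<in> GLm n \<and> K \<subseteq> {..<k} \<and>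
    (\<forall>i<k. \<forall>j<n. (c * C * x) $$ (i, j) = (if i = j \<and> i \<in> K then 1 else 0))" if "k \<le> n" for k
    using that
  proof (induction k)
    case 0
    have "transpose_mat (1\<^sub>m n) \<in> Bk n" using Bk_one[of n] by simp
    then show ?case using GLm_one by (intro exI[of _ "1\<^sub>m n"] exI[of _ "{}"]) auto
  next
    case (Suc k)
    then obtain c x K where IH: "c \<in> carrier_mat n n" "transpose_mat c \<in> Bk n" "x \<in> GLm n" "K \<subseteq> {..<k}"
      "\<And>i j. i < k \<Longrightarrow> j < n \<Longrightarrow> (c * C * x) $$ (i, j) = (if i = j \<and> i \<in> K then 1 else 0)"
      by auto
    have D: "c * C * x \<in> carrier_mat n n" using IH C by (auto dest: GLm_carrier)
    have "k < n" using Suc.prems by simp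
    have "\<exists>c' x' K'. c' \<in> carrier_mat n n \<and> (\<forall>i<n. \<forall>j<n. i < j \<longrightarrow> c' $$ (i, j) = 0) \<and> (\<forall>i<n. c' $$ (i, i) = 1) \<and>
      x' \<in> GLm n \<and> K' \<subseteq> {..<Suc k} \<and>
      (\<forall>i<Suc k. \<forall>j<n. (c' * (c * C * x) * x') $$ (i, j) = (if i = j \<and> i \<in> K' then 1 else 0))"
      by (rule echelon_step[OF D \<open>k < n\<close> IH(4)]) (rule IH(5))
    then obtain c' x' K' where *: "c' \<in> carrier_mat n n" "\<forall>i<n. \<forall>j<n. i < j \<longrightarrow> c' $$ (i, j) = 0" "\<forall>i<n. c' $$ (i, i) = 1"
      "x' \<in> GLm n" "K' \<subseteq> {..<Suc k}"
      "\<forall>i<Suc k. \<forall>j<n. (c' * (c * C * x) * x') $$ (i, j) = (if i = j \<and> i \<in> K' then 1 else 0)"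
      by (elim exE conjE)
    have eq: "c' * (c * C * x) * x' = (c' * c) * C * (x * x')"
      using * IH C by (auto dest!: GLm_carrier simp: mat_assoc)
    have "transpose_mat c' \<in> Bk n" using * low by auto
    then have "transpose_mat (c' * c) \<in> Bk n"
      using transpose_mult[of c' n n c n] * IH by (simp add: Bk_mult)
    then show ?case using * IH GLm_mult[OF IH(3) *(4)] unfolding eq
      by (intro exI[of _ "c' * c"] exI[of _ "x * x'"] exI[of _ K']) auto
  qed
  from this[OF order_refl] obtain c x K where *: "c \<in> carrier_mat n n" "transpose_mat c \<in> Bk n" "x \<in> GLm n" "K \<subseteq> {..<n}"
    "\<forall>i<n. \<forall>j<n. (c * C * x) $$ (i, j) = (if i = j \<and> i \<in> K then 1 else 0)" by blast
  then have "c * C * x = diag_proj n K"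
    using C by (intro eq_matI) (auto simp: diag_proj_index dest: GLm_carrier)
  then show ?thesis using * by blast
qed

text \<open>Conjugation by the permutation that reverses the coordinates; it interchanges lower and
  upper triangular matrices.\<close>

definition flip :: "nat \<Rightarrow> 'a mat \<Rightarrow> 'a mat" where
  "flip n A = mat n n (\<lambda>(i, j). A $$ (n - 1 - i, n - 1 - j))"

lemma flip_carrier [simp]: "flip n A \<in> carrier_mat n n"
  by (simp add: flip_def)

lemma flip_index: "i < n \<Longrightarrow> j < n \<Longrightarrow> flip n A $$ (i, j) = A $$ (n - 1 - i, n - 1 - j)"
  by (simp add: flip_def)

lemma flip_mult:
  fixes A :: "'a::semiring_0 mat"
  assumes "A \<in> carrier_mat n n" "B \<in> carrier_mat n n"
  shows "flip n (A * B) = flip n A * flip n B"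
proof (rule eq_matI)
  fix i j assume "i < dim_row (flip n A * flip n B)" "j < dim_col (flip n A * flip n B)"
  then have ij: "i < n" "j < n" by (auto simp: flip_def)
  have "flip n (A * B) $$ (i, j) = (\<Sum>k<n. A $$ (n - 1 - i, k) * B $$ (k, n - 1 - j))"
    unfolding flip_index[OF ij] using ij assms by (subst mult_mat_index) auto
  also have "\<dots> = (\<Sum>k<n. A $$ (n - 1 - i, n - 1 - k) * B $$ (n - 1 - k, n - 1 - j))"
    by (subst sum.nat_diff_reindex[symmetric]) simp
  also have "\<dots> = (flip n A * flip n B) $$ (i, j)"
    using ij by (subst mult_mat_index) (auto simp: flip_def)
  finally show "flip n (A * B) $$ (i, j) = (flip n A * flip n B) $$ (i, j)" .
qed (auto simp: flip_def)

lemma flip_flip: "A \<in> carrier_mat n n \<Longrightarrow> flip n (flip n A) = A"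
  by (intro eq_matI) (auto simp: flip_def)

lemma flip_one: "flip n (1\<^sub>m n) = 1\<^sub>m n"
  by (intro eq_matI) (auto simp: flip_def)

lemma flip_GLm:
  assumes "A \<in> GLm n" shows "flip n A \<in> GLm n"
proof -
  obtain B where B: "B \<in> GLm n" "B * A = 1\<^sub>m n" using assms by (metis GLmE)
  then have "flip n B * flip n A = 1\<^sub>m n"
    using flip_mult[of B n A] assms by (simp add: GLm_carrier flip_one)
  then show ?thesis using GLm_leftI flip_carrier by blast
qed

text \<open>Reversing the coordinates reduces this to \<open>echelon_lower\<close>: rows are now
  cleared by the rows below them, and the pivot set is reflected.\<close>

lemma echelon_upper:
  fixes C :: "'a::field mat"
  assumes C: "C \<in> carrier_mat n n"
  shows "\<exists>c x K. c \<in> Bk n \<and> x \<in> GLm n \<and> K \<subseteq> {..<n} \<and> c * C * x = diag_proj n K"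
proof -
  obtain c x K where *: "c \<in> carrier_mat n n" "transpose_mat c \<in> Bk n" "x \<in> GLm n" "K \<subseteq> {..<n}"
    "c * flip n C * x = diag_proj n K"
    using echelon_lower[OF flip_carrier[of n C]] by blast
  have "flip n c \<in> Bk n"
    using *(1,2) unfolding Bk_iff by (auto simp: flip_def)
  moreover have "c * flip n C \<in> carrier_mat n n" using * by (auto intro: mult_carrier_mat)
  then have "flip n c * C * flip n x = flip n (c * flip n C * x)"
    using *(1,3) C by (simp add: flip_mult flip_flip GLm_carrier)
  moreover have "flip n (diag_proj n K) = (diag_proj n ((\<lambda>i. n - 1 - i) ` K) :: 'a mat)"
  proof (rule eq_matI)
    fix i j assume "i < dim_row (diag_proj n ((\<lambda>i. n - 1 - i) ` K) :: 'a mat)" "j < dim_col (diag_proj n ((\<lambda>i. n - 1 - i) ` K) :: 'a mat)"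
    then have ij: "i < n" "j < n" by auto
    have "n - 1 - i \<in> K \<longleftrightarrow> i \<in> (\<lambda>i. n - 1 - i) ` K"
    proof
      assume "n - 1 - i \<in> K"
      then show "i \<in> (\<lambda>i. n - 1 - i) ` K" using ij by (intro image_eqI[of _ _ "n - 1 - i"]) auto
    next
      assume "i \<in> (\<lambda>i. n - 1 - i) ` K"
      then obtain l where "l \<in> K" "i = n - 1 - l" by blast
      moreover have "l < n" using \<open>l \<in> K\<close> * by auto
      ultimately show "n - 1 - i \<in> K" by simp
    qed
    moreover have "flip n (diag_proj n K) $$ (i, j) = (if n - 1 - i = n - 1 - j \<and> n - 1 - i \<in> K then 1 else (0 :: 'a))"
      unfolding flip_index[OF ij] using ij by (intro diag_proj_index) auto
    moreover have "n - 1 - i = n - 1 - j \<longleftrightarrow> i = j" using ij by auto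
    ultimately show "flip n (diag_proj n K) $$ (i, j) = (diag_proj n ((\<lambda>i. n - 1 - i) ` K) :: 'a mat) $$ (i, j)"
      using diag_proj_index[OF ij] by metis
  qed (simp_all add: flip_def)
  moreover have "(\<lambda>i. n - 1 - i) ` K \<subseteq> {..<n}" using * by auto
  ultimately show ?thesis using *(3,5) flip_GLm by (metis (no_types))
qed

section \<open>The Siegel parabolic and Lagrangian subspaces\<close>

lemma four_block_mat_eqD:
  assumes "four_block_mat A B C D = four_block_mat A' B' C' D'"
    and "A \<in> carrier_mat k l" "B \<in> carrier_mat k l'" "C \<in> carrier_mat k' l" "D \<in> carrier_mat k' l'"
    and "A' \<in> carrier_mat k l" "B' \<in> carrier_mat k l'" "C' \<in> carrier_mat k' l" "D' \<in> carrier_mat k' l'"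
  shows "A = A'" "B = B'" "C = C'" "D = D'"
proof -
  have e: "four_block_mat A B C D $$ (i, j) = four_block_mat A' B' C' D' $$ (i, j)" for i j
    using assms(1) by simp
  show "A = A'"
  proof (rule eq_matI)
    fix i j assume "i < dim_row A'" "j < dim_col A'"
    then show "A $$ (i, j) = A' $$ (i, j)" using e[of i j] assms(2-) by auto
  qed (use assms(2-) in auto)
  show "B = B'"
  proof (rule eq_matI)
    fix i j assume "i < dim_row B'" "j < dim_col B'"
    then show "B $$ (i, j) = B' $$ (i, j)" using e[of i "j + l"] assms(2-) by auto
  qed (use assms(2-) in auto)
  show "C = C'"
  proof (rule eq_matI)
    fix i j assume "i < dim_row C'" "j < dim_col C'"
    then show "C $$ (i, j) = C' $$ (i, j)" using e[of "i + k" j] assms(2-) by auto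
  qed (use assms(2-) in auto)
  show "D = D'"
  proof (rule eq_matI)
    fix i j assume "i < dim_row D'" "j < dim_col D'"
    then show "D $$ (i, j) = D' $$ (i, j)" using e[of "i + k" "j + l"] assms(2-) by auto
  qed (use assms(2-) in auto)
qed

lemma four_block_matE:
  assumes "M \<in> carrier_mat (2 * n) (2 * n)"
  obtains A B C D where "M = four_block_mat A B C D" "A \<in> carrier_mat n n" "B \<in> carrier_mat n n"
    "C \<in> carrier_mat n n" "D \<in> carrier_mat n n"
proof -
  obtain A B C D where "split_block M n n = (A, B, C, D)" by (metis surj_pair)
  from split_block[OF this, of n n] show ?thesis
    using assms that by (auto simp: mult_2)
qed

lemma four_block_carrier2 [simp]:
  assumes "A \<in> carrier_mat n n" "D \<in> carrier_mat n n"
  shows "four_block_mat A B C D \<in> carrier_mat (2 * n) (2 * n)"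
  using four_block_carrier_mat[OF assms] by (simp add: mult_2)

lemma four_block_one2: "four_block_mat (1\<^sub>m n) (0\<^sub>m n n) (0\<^sub>m n n) (1\<^sub>m n) = 1\<^sub>m (2 * n)"
  by (simp add: mult_2)

lemma first_half_eq: "first_half n = (\<lambda>u. u @\<^sub>v 0\<^sub>v n) ` carrier_vec n"
proof
  show "first_half n \<subseteq> (\<lambda>u. u @\<^sub>v 0\<^sub>v n) ` carrier_vec n"
  proof
    fix v assume v: "v \<in> first_half n"
    then have "v = vec n (\<lambda>i. v $ i) @\<^sub>v 0\<^sub>v n"
      by (intro eq_vecI) (auto simp: first_half_def mult_2)
    then show "v \<in> (\<lambda>u. u @\<^sub>v 0\<^sub>v n) ` carrier_vec n"
      by (metis imageI vec_carrier)
  qed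
qed (auto simp: first_half_def mult_2 append_vec_def)

lemma four_block_mult_first_half:
  fixes A :: "'a::field mat"
  assumes "A \<in> carrier_mat n n" "B \<in> carrier_mat n n" "C \<in> carrier_mat n n" "D \<in> carrier_mat n n"
    and u: "u \<in> carrier_vec n"
  shows "four_block_mat A B C D *\<^sub>v (u @\<^sub>v 0\<^sub>v n) = (A *\<^sub>v u) @\<^sub>v (C *\<^sub>v u)"
proof -
  have "B *\<^sub>v 0\<^sub>v n = 0\<^sub>v n" "D *\<^sub>v 0\<^sub>v n = 0\<^sub>v n"
    using assms by (auto intro!: eq_vecI simp: scalar_prod_def)
  then show ?thesis
    using four_block_mat_mult_vec[OF assms(1-4) u, of "0\<^sub>v n"] assms by simp
qed

text \<open>The stabilizer is defined by equality of subspaces, not by inclusion, so it contains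
  inverses without any dimension count.\<close>

lemma siegel_parabolic_mat_group:
  fixes G :: "'a::field mat set"
  assumes G: "mat_group (2 * n) G"
  shows "mat_group (2 * n) (siegel_parabolic G n)"
proof -
  have half: "first_half n \<subseteq> carrier_vec (2 * n)" by (auto simp: first_half_def)
  have comp: "(\<lambda>v. (g * h) *\<^sub>v v) ` first_half n = (\<lambda>v. g *\<^sub>v v) ` (\<lambda>v. h *\<^sub>v v) ` first_half n"
    if "g \<in> G" "h \<in> G" for g h
  proof -
    have "(g * h) *\<^sub>v v = g *\<^sub>v (h *\<^sub>v v)" if "v \<in> first_half n" for v
      using assoc_mult_mat_vec[OF mat_groupD(1)[OF G \<open>g \<in> G\<close>] mat_groupD(1)[OF G \<open>h \<in> G\<close>]] half that by blast
    then show ?thesis unfolding image_image by (rule image_cong[OF refl])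
  qed
  have one: "(\<lambda>v. 1\<^sub>m (2 * n) *\<^sub>v v) ` first_half n = (first_half n :: 'a vec set)"
  proof -
    have "1\<^sub>m (2 * n) *\<^sub>v v = v" if "v \<in> first_half n" for v :: "'a vec"
      using one_mult_mat_vec[of v "2 * n"] half that by blast
    then have "(\<lambda>v. 1\<^sub>m (2 * n) *\<^sub>v v) ` first_half n = (\<lambda>v :: 'a vec. v) ` first_half n"
      by (rule image_cong[OF refl])
    then show ?thesis by simp
  qed
  have inv: "\<exists>h\<in>siegel_parabolic G n. g * h = 1\<^sub>m (2 * n) \<and> h * g = 1\<^sub>m (2 * n)"
    if "g \<in> siegel_parabolic G n" for g
  proof -
    have g: "g \<in> G" "(\<lambda>v. g *\<^sub>v v) ` first_half n = first_half n" using that by (auto simp: siegel_parabolic_def)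
    obtain h where h: "h \<in> G" "g * h = 1\<^sub>m (2 * n)" "h * g = 1\<^sub>m (2 * n)" using mat_groupE[OF G g(1)] by metis
    have "(\<lambda>v. h *\<^sub>v v) ` first_half n = first_half n"
      using comp[OF h(1) g(1)] g(2) h(3) one by simp
    then show ?thesis using h by (auto simp: siegel_parabolic_def)
  qed
  show ?thesis
    unfolding mat_group_def
  proof (intro conjI ballI)
    show "g * h \<in> siegel_parabolic G n" if "g \<in> siegel_parabolic G n" "h \<in> siegel_parabolic G n" for g h
      using that comp mat_groupD(3)[OF G] by (simp add: siegel_parabolic_def)
  qed (use inv one mat_groupD[OF G] in \<open>auto simp: siegel_parabolic_def\<close>)
qed

lemma siegel_parabolic_imp_block:
  fixes G :: "'a::field mat set"
  assumes G: "mat_group (2 * n) G" and p: "p \<in> siegel_parabolic G n"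
  obtains x y w where "p = four_block_mat x y (0\<^sub>m n n) w" "x \<in> carrier_mat n n" "y \<in> carrier_mat n n" "w \<in> carrier_mat n n"
proof -
  have pG: "p \<in> G" and im: "(\<lambda>v. p *\<^sub>v v) ` first_half n = first_half n" using p by (auto simp: siegel_parabolic_def)
  obtain x y z w where b: "p = four_block_mat x y z w" and c: "x \<in> carrier_mat n n" "y \<in> carrier_mat n n"
    "z \<in> carrier_mat n n" "w \<in> carrier_mat n n"
    using four_block_matE[OF mat_groupD(1)[OF G pG]] by metis
  have "z = 0\<^sub>m n n"
  proof (rule eq_matI)
    fix i j assume "i < dim_row (0\<^sub>m n n :: 'a mat)" "j < dim_col (0\<^sub>m n n :: 'a mat)"
    then have ij: "i < n" "j < n" by auto
    have "unit_vec n j @\<^sub>v 0\<^sub>v n \<in> first_half n" unfolding first_half_eq by auto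
    then have "p *\<^sub>v (unit_vec n j @\<^sub>v 0\<^sub>v n) \<in> first_half n" using im by blast
    then have "(x *\<^sub>v unit_vec n j) @\<^sub>v (z *\<^sub>v unit_vec n j) \<in> first_half n"
      unfolding b using c by (simp add: four_block_mult_first_half)
    then have "((x *\<^sub>v unit_vec n j) @\<^sub>v (z *\<^sub>v unit_vec n j)) $ (n + i) = 0"
      using ij unfolding first_half_def by auto
    then show "z $$ (i, j) = 0\<^sub>m n n $$ (i, j)" using ij c by simp
  qed (use c in auto)
  then show ?thesis using that b c by blast
qed

text \<open>The inverse of \<open>p\<close> also stabilizes the subspace and is block triangular as
  well. The upper left blocks of the two multiply to the identity, which makes \<open>x\<close>
  invertible.\<close>

lemma siegel_parabolic_iff:
  fixes G :: "'a::field mat set"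
  assumes G: "mat_group (2 * n) G"
  shows "p \<in> siegel_parabolic G n \<longleftrightarrow> p \<in> G \<and> (\<exists>x\<in>GLm n. \<exists>y\<in>carrier_mat n n. \<exists>w\<in>carrier_mat n n.
    p = four_block_mat x y (0\<^sub>m n n) w)" (is "_ \<longleftrightarrow> ?R")
proof
  assume p: "p \<in> siegel_parabolic G n"
  obtain q where q: "q \<in> siegel_parabolic G n" "p * q = 1\<^sub>m (2 * n)"
    using mat_groupE[OF siegel_parabolic_mat_group[OF G] p] by metis
  obtain x y w where b: "p = four_block_mat x y (0\<^sub>m n n) w" and c: "x \<in> carrier_mat n n" "y \<in> carrier_mat n n" "w \<in> carrier_mat n n"
    using siegel_parabolic_imp_block[OF G p] .
  obtain x' y' w' where b': "q = four_block_mat x' y' (0\<^sub>m n n) w'" and c': "x' \<in> carrier_mat n n" "y' \<in> carrier_mat n n" "w' \<in> carrier_mat n n"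
    using siegel_parabolic_imp_block[OF G q(1)] .
  have "four_block_mat (x * x') (x * y' + y * w') (0\<^sub>m n n) (w * w') = p * q"
    unfolding b b' using c c' by (subst mult_four_block_mat) auto
  also have "\<dots> = four_block_mat (1\<^sub>m n) (0\<^sub>m n n) (0\<^sub>m n n) (1\<^sub>m n)"
    using q(2) by (simp only: four_block_one2)
  finally have "x * x' = 1\<^sub>m n" by (rule four_block_mat_eqD) (use c c' in auto)
  then have "x \<in> GLm n" using GLm_leftI(1)[of x n x'] mat_mult_left_right_inverse[of x n x'] c c' by simp
  then show ?R using p b c by (auto simp: siegel_parabolic_def)
next
  assume ?R
  then obtain x y w where p: "p \<in> G" "p = four_block_mat x y (0\<^sub>m n n) w" and x: "x \<in> GLm n"
    and c: "y \<in> carrier_mat n n" "w \<in> carrier_mat n n" by blast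
  note xc = GLm_carrier[OF x]
  obtain x' where x': "x' \<in> GLm n" "x * x' = 1\<^sub>m n" using x by (rule GLmE)
  have act: "p *\<^sub>v (u @\<^sub>v 0\<^sub>v n) = (x *\<^sub>v u) @\<^sub>v 0\<^sub>v n" if "u \<in> carrier_vec n" for u
  proof -
    have "0\<^sub>m n n *\<^sub>v u = 0\<^sub>v n" using that by (intro eq_vecI) auto
    then show ?thesis using four_block_mult_first_half[OF xc c(1) _ c(2) that, of "0\<^sub>m n n"] p by simp
  qed
  have "(\<lambda>v. p *\<^sub>v v) ` first_half n = (\<lambda>u. (x *\<^sub>v u) @\<^sub>v 0\<^sub>v n) ` carrier_vec n"
    unfolding first_half_eq image_image using act by (rule image_cong[OF refl])
  also have "\<dots> = (\<lambda>u. u @\<^sub>v 0\<^sub>v n) ` (\<lambda>u. x *\<^sub>v u) ` carrier_vec n" by (simp add: image_image)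
  also have "(\<lambda>u. x *\<^sub>v u) ` carrier_vec n = carrier_vec n"
  proof
    show "carrier_vec n \<subseteq> (\<lambda>u. x *\<^sub>v u) ` carrier_vec n"
    proof
      fix v :: "'a vec" assume v: "v \<in> carrier_vec n"
      have "x *\<^sub>v (x' *\<^sub>v v) = v"
        using assoc_mult_mat_vec[OF xc GLm_carrier[OF x'(1)] v] x' v by simp
      moreover have "x' *\<^sub>v v \<in> carrier_vec n" using GLm_carrier[OF x'(1)] v by simp
      ultimately show "v \<in> (\<lambda>u. x *\<^sub>v u) ` carrier_vec n" by (metis imageI)
    qed
  qed (use xc in auto)
  finally show "p \<in> siegel_parabolic G n" using p by (simp add: siegel_parabolic_def first_half_eq)
qed

text \<open>A coset of the parabolic is determined by the span of the first \<open>n\<close>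
  columns, and \<open>x\<close> is the change of basis. Conversely, the inverse of the first matrix
  sends the columns \<open>(A * x, C * x)\<close> to \<open>(x, 0)\<close>, so the quotient of the
  two group elements is block triangular.\<close>

lemma siegel_coset_iff:
  fixes G :: "'a::field mat set"
  assumes G: "mat_group (2 * n) G"
    and g: "four_block_mat A B C D \<in> G" "four_block_mat A' B' C' D' \<in> G"
    and c: "A \<in> carrier_mat n n" "B \<in> carrier_mat n n" "C \<in> carrier_mat n n" "D \<in> carrier_mat n n"
    and c': "A' \<in> carrier_mat n n" "B' \<in> carrier_mat n n" "C' \<in> carrier_mat n n" "D' \<in> carrier_mat n n"
  shows "(\<exists>p\<in>siegel_parabolic G n. four_block_mat A' B' C' D' = four_block_mat A B C D * p) \<longleftrightarrow>
    (\<exists>x\<in>GLm n. A' = A * x \<and> C' = C * x)"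
proof
  assume "\<exists>p\<in>siegel_parabolic G n. four_block_mat A' B' C' D' = four_block_mat A B C D * p"
  then obtain p where p: "p \<in> siegel_parabolic G n" "four_block_mat A' B' C' D' = four_block_mat A B C D * p" by blast
  obtain x y w where x: "x \<in> GLm n" and yw: "y \<in> carrier_mat n n" "w \<in> carrier_mat n n"
    and pe: "p = four_block_mat x y (0\<^sub>m n n) w"
    using p(1) unfolding siegel_parabolic_iff[OF G] by blast
  note e = p(2)[unfolded pe]
  note xc = GLm_carrier[OF x]
  have e': "four_block_mat A' B' C' D' = four_block_mat (A * x) (A * y + B * w) (C * x) (C * y + D * w)"
    unfolding e using c xc yw by (subst mult_four_block_mat) auto
  have "A' = A * x" "C' = C * x"
    by (rule four_block_mat_eqD[OF e' c']; use c xc yw in simp)+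
  then show "\<exists>x\<in>GLm n. A' = A * x \<and> C' = C * x" using x by blast
next
  assume "\<exists>x\<in>GLm n. A' = A * x \<and> C' = C * x"
  then obtain x where x: "x \<in> GLm n" "A' = A * x" "C' = C * x" by blast
  note xc = GLm_carrier[OF x(1)]
  let ?g = "four_block_mat A B C D" and ?g' = "four_block_mat A' B' C' D'"
  obtain h where h: "h \<in> G" "?g * h = 1\<^sub>m (2 * n)" "h * ?g = 1\<^sub>m (2 * n)" using mat_groupE[OF G g(1)] by metis
  obtain P Q R S where hb: "h = four_block_mat P Q R S" and hc: "P \<in> carrier_mat n n" "Q \<in> carrier_mat n n"
    "R \<in> carrier_mat n n" "S \<in> carrier_mat n n"
    using four_block_matE[OF mat_groupD(1)[OF G h(1)]] by metis
  have "four_block_mat (P * A + Q * C) (P * B + Q * D) (R * A + S * C) (R * B + S * D) = h * ?g"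
    unfolding hb using c hc by (subst mult_four_block_mat) auto
  also have "\<dots> = four_block_mat (1\<^sub>m n) (0\<^sub>m n n) (0\<^sub>m n n) (1\<^sub>m n)"
    using h(3) by (simp only: four_block_one2)
  finally have e: "four_block_mat (P * A + Q * C) (P * B + Q * D) (R * A + S * C) (R * B + S * D)
    = four_block_mat (1\<^sub>m n) (0\<^sub>m n n) (0\<^sub>m n n) (1\<^sub>m n)" .
  have e1: "P * A + Q * C = 1\<^sub>m n" "R * A + S * C = 0\<^sub>m n n"
    by (rule four_block_mat_eqD[OF e, of n n n n]; use c hc in simp)+
  have "P * A' + Q * C' = (P * A + Q * C) * x" "R * A' + S * C' = (R * A + S * C) * x"
    unfolding x(2,3) using c hc xc by (simp_all add: mat_simps)
  then have e2: "P * A' + Q * C' = x" "R * A' + S * C' = 0\<^sub>m n n" using e1 xc by simp_all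
  have "h * ?g' = four_block_mat (P * A' + Q * C') (P * B' + Q * D') (R * A' + S * C') (R * B' + S * D')"
    unfolding hb using c' hc by (subst mult_four_block_mat) auto
  then have "h * ?g' = four_block_mat x (P * B' + Q * D') (0\<^sub>m n n) (R * B' + S * D')" by (simp only: e2)
  moreover have "P * B' + Q * D' \<in> carrier_mat n n" "R * B' + S * D' \<in> carrier_mat n n" using c' hc by auto
  ultimately have "h * ?g' \<in> siegel_parabolic G n"
    unfolding siegel_parabolic_iff[OF G] using mat_groupD(3)[OF G h(1) g(2)] x(1) by blast
  moreover have "?g' = ?g * (h * ?g')"
    using mat_cancel[OF h(2), of "2 * n" ?g' "2 * n"] mat_groupD(1)[OF G] g h(1) by simp
  ultimately show "\<exists>p\<in>siegel_parabolic G n. ?g' = ?g * p" by blast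
qed

section \<open>The group preserving \<open>Sigma_n\<close> and its block diagonal subgroups\<close>

lemma Sigma_n_carrier [simp]: "Sigma_n n \<in> carrier_mat (2 * n) (2 * n)"
  unfolding Sigma_n_def by simp

lemma Sigma_n_mult_block:
  fixes A :: "'a::field mat"
  assumes c: "A \<in> carrier_mat n n" "B \<in> carrier_mat n n" "C \<in> carrier_mat n n" "D \<in> carrier_mat n n"
  shows "Sigma_n n * four_block_mat A B C D = four_block_mat C D (- A) (- B)"
proof -
  have "- 1\<^sub>m n * A = - A" "- 1\<^sub>m n * B = - B"
    using c by auto
  then show ?thesis
    unfolding Sigma_n_def using c by (subst mult_four_block_mat) auto
qed

context conj_field
begin

lemma mat_group_form_group:
  assumes F: "F \<in> carrier_mat k k"
  shows "mat_group k (form_group adj F k)"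
  unfolding mat_group_def
proof (intro conjI ballI)
  show "form_group adj F k \<subseteq> carrier_mat k k" by (auto simp: form_group_def GLm_def)
  show "1\<^sub>m k \<in> form_group adj F k" using F by (simp add: form_group_def GLm_one mat_simps)
next
  fix g h assume g: "g \<in> form_group adj F k" and h: "h \<in> form_group adj F k"
  then have c: "g \<in> GLm k" "h \<in> GLm k" "adj g * F * g = F" "adj h * F * h = F"
    by (auto simp: form_group_def)
  note cc = c(1,2)[THEN GLm_carrier]
  have "adj (g * h) * F * (g * h) = adj h * (adj g * F * g) * h"
    using cc F by (simp add: adj_mult mat_assoc)
  then show "g * h \<in> form_group adj F k" using c by (simp add: form_group_def GLm_mult)
next
  fix g assume g: "g \<in> form_group adj F k"
  then have c: "g \<in> GLm k" "adj g * F * g = F" by (auto simp: form_group_def)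
  obtain h where h: "h \<in> GLm k" "g * h = 1\<^sub>m k" "h * g = 1\<^sub>m k" using c(1) by (rule GLmE)
  note cc = c(1)[THEN GLm_carrier] h(1)[THEN GLm_carrier]
  have "adj h * F * h = adj h * (adj g * F * g) * h" using c by simp
  also have "\<dots> = adj (g * h) * F * (g * h)"
    using cc F by (simp add: adj_mult mat_assoc)
  also have "\<dots> = F" using h F by (simp add: mat_simps)
  finally show "\<exists>h\<in>form_group adj F k. g * h = 1\<^sub>m k \<and> h * g = 1\<^sub>m k"
    using h by (auto simp: form_group_def)
qed

text \<open>This is \<open>Sp_2n\<close> and also \<open>U_nn\<close>, since \<open>J_n\<close> is a scalar multiple of \<open>Sigma_n\<close>.\<close>

definition UG :: "nat \<Rightarrow> 'a mat set" where
  "UG n = form_group adj (Sigma_n n) (2 * n)"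

lemma mat_group_UG: "mat_group (2 * n) (UG n)"
  unfolding UG_def by (rule mat_group_form_group) simp

lemma adj_Sigma_block:
  assumes c: "A \<in> carrier_mat n n" "B \<in> carrier_mat n n" "C \<in> carrier_mat n n" "D \<in> carrier_mat n n"
  shows "adj (four_block_mat A B C D) * Sigma_n n * four_block_mat A B C D =
    four_block_mat (adj A * C - adj C * A) (adj A * D - adj C * B) (adj B * C - adj D * A) (adj B * D - adj D * B)"
proof -
  have m: "X + Y * (- Z) = X - Y * Z"
    if "X \<in> carrier_mat n n" "Y \<in> carrier_mat n n" "Z \<in> carrier_mat n n" for X Y Z :: "'a mat"
    using that by (intro eq_matI) (auto simp: scalar_prod_def sum_negf)
  have "adj (four_block_mat A B C D) * Sigma_n n * four_block_mat A B C D =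
      adj (four_block_mat A B C D) * (Sigma_n n * four_block_mat A B C D)"
    by (rule assoc_mult_mat[of _ "2 * n" "2 * n" _ "2 * n" _ "2 * n"]) (use c in auto)
  also have "\<dots> = four_block_mat (adj A) (adj C) (adj B) (adj D) * four_block_mat C D (- A) (- B)"
    unfolding Sigma_n_mult_block[OF c] adj_four_block[OF c] ..
  also have "\<dots> = four_block_mat (adj A * C - adj C * A) (adj A * D - adj C * B) (adj B * C - adj D * A) (adj B * D - adj D * B)"
    using c by (subst mult_four_block_mat) (auto simp: m)
  finally show ?thesis .
qed

text \<open>A matrix that preserves a non-degenerate form is invertible: \<open>- Sigma_n n\<close>
  inverts \<open>Sigma_n n\<close>, so \<open>- Sigma_n n * (adj g * Sigma_n n)\<close> is a left
  inverse of \<open>g\<close>. Only the four block equations remain to be checked.\<close>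

lemma UG_blockI:
  assumes c: "A \<in> carrier_mat n n" "B \<in> carrier_mat n n" "C \<in> carrier_mat n n" "D \<in> carrier_mat n n"
    and e: "adj A * C - adj C * A = 0\<^sub>m n n" "adj A * D - adj C * B = 1\<^sub>m n"
      "adj B * C - adj D * A = - 1\<^sub>m n" "adj B * D - adj D * B = 0\<^sub>m n n"
  shows "four_block_mat A B C D \<in> UG n"
proof -
  let ?g = "four_block_mat A B C D"
  have g: "?g \<in> carrier_mat (2 * n) (2 * n)" using c by simp
  have S: "adj ?g * Sigma_n n * ?g = Sigma_n n"
    unfolding adj_Sigma_block[OF c] e by (simp add: Sigma_n_def)
  have SS: "- Sigma_n n * Sigma_n n = (1\<^sub>m (2 * n) :: 'a mat)"
  proof -
    have "- (- 1\<^sub>m n :: 'a mat) = 1\<^sub>m n" "- (0\<^sub>m n n :: 'a mat) = 0\<^sub>m n n" by (auto intro!: eq_matI)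
    then have "Sigma_n n * Sigma_n n = (four_block_mat (- 1\<^sub>m n) (0\<^sub>m n n) (0\<^sub>m n n) (- 1\<^sub>m n) :: 'a mat)"
      using Sigma_n_mult_block[of "0\<^sub>m n n" n "1\<^sub>m n :: 'a mat" "- 1\<^sub>m n" "0\<^sub>m n n"]
      unfolding Sigma_n_def[of n] by simp
    then have "- (Sigma_n n * Sigma_n n) = (1\<^sub>m (2 * n) :: 'a mat)"
      by (intro eq_matI) (auto simp: mult_2)
    moreover have "- Sigma_n n * Sigma_n n = (- (Sigma_n n * Sigma_n n) :: 'a mat)"
      by (intro uminus_mult_left_mat) (metis Sigma_n_carrier carrier_matD)
    ultimately show ?thesis by simp
  qed
  have "(- Sigma_n n * (adj ?g * Sigma_n n)) * ?g = - Sigma_n n * (adj ?g * Sigma_n n * ?g)"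
    using g Sigma_n_carrier[of n, THEN carrier_matD(1)] Sigma_n_carrier[of n, THEN carrier_matD(2)]
    by (intro mat_assoc) auto
  also have "\<dots> = 1\<^sub>m (2 * n)" unfolding S SS ..
  finally have inv: "(- Sigma_n n * (adj ?g * Sigma_n n)) * ?g = 1\<^sub>m (2 * n)" .
  have "- Sigma_n n \<in> carrier_mat (2 * n) (2 * n)" "adj ?g * Sigma_n n \<in> carrier_mat (2 * n) (2 * n)"
    by (simp, rule mult_carrier_mat[OF adj_carrier[OF g] Sigma_n_carrier])
  then have "?g \<in> GLm (2 * n)"
    using GLm_leftI(1)[OF g _ inv] by (metis mult_carrier_mat)
  then show ?thesis using S by (simp add: UG_def form_group_def)
qed

lemma UG_blockD:
  assumes "four_block_mat A B C D \<in> UG n"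
    and c: "A \<in> carrier_mat n n" "B \<in> carrier_mat n n" "C \<in> carrier_mat n n" "D \<in> carrier_mat n n"
  shows "adj A * C = adj C * A"
proof -
  have e: "four_block_mat (adj A * C - adj C * A) (adj A * D - adj C * B) (adj B * C - adj D * A) (adj B * D - adj D * B)
    = four_block_mat (0\<^sub>m n n) (1\<^sub>m n) (- 1\<^sub>m n) (0\<^sub>m n n)"
    using assms(1) unfolding adj_Sigma_block[OF c, symmetric] by (simp add: UG_def form_group_def Sigma_n_def)
  have z: "adj A * C - adj C * A = 0\<^sub>m n n"
    by (rule four_block_mat_eqD(1)[OF e, of n n n n]) (use c in auto)
  show ?thesis
  proof (rule eq_matI)
    fix i j assume ij: "i < dim_row (adj C * A)" "j < dim_col (adj C * A)"
    have "(adj A * C - adj C * A) $$ (i, j) = 0" unfolding z using ij c by simp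
    then show "(adj A * C) $$ (i, j) = (adj C * A) $$ (i, j)"
      using ij c by (subst (asm) index_minus_mat) auto
  qed (use c in auto)
qed

lemma levi_memI:
  assumes "a \<in> GLm n" "T a" "b \<in> carrier_mat n n" "b * adj a = 1\<^sub>m n"
  shows "four_block_mat a (0\<^sub>m n n) (0\<^sub>m n n) b \<in> levi adj n T"
  using assms unfolding levi_def by blast

lemma leviE:
  assumes "g \<in> levi adj n T"
  obtains a b where "g = four_block_mat a (0\<^sub>m n n) (0\<^sub>m n n) b" "a \<in> GLm n" "T a" "b \<in> carrier_mat n n"
    "b * adj a = 1\<^sub>m n" "adj a * b = 1\<^sub>m n"
proof -
  obtain a b where g: "g = four_block_mat a (0\<^sub>m n n) (0\<^sub>m n n) b" "a \<in> GLm n" "T a" "b \<in> carrier_mat n n"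
    "b * adj a = 1\<^sub>m n"
    using assms unfolding levi_def by blast
  then have "adj a * b = 1\<^sub>m n" by (intro mat_mult_left_right_inverse[of b]) (auto dest: GLm_carrier)
  then show ?thesis using that g by blast
qed

lemma levi_mult_block:
  assumes "a \<in> carrier_mat n n" "b \<in> carrier_mat n n"
    and c: "A \<in> carrier_mat n n" "B \<in> carrier_mat n n" "C \<in> carrier_mat n n" "D \<in> carrier_mat n n"
  shows "four_block_mat a (0\<^sub>m n n) (0\<^sub>m n n) b * four_block_mat A B C D = four_block_mat (a * A) (a * B) (b * C) (b * D)"
  using assms by (subst mult_four_block_mat) auto

lemma mat_group_levi:
  assumes one: "T (1\<^sub>m n)"
    and mult: "\<And>a b. a \<in> GLm n \<Longrightarrow> b \<in> GLm n \<Longrightarrow> T a \<Longrightarrow> T b \<Longrightarrow> T (a * b)"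
    and inv: "\<And>a b. a \<in> GLm n \<Longrightarrow> b \<in> GLm n \<Longrightarrow> T a \<Longrightarrow> a * b = 1\<^sub>m n \<Longrightarrow> T b"
  shows "mat_group (2 * n) (levi adj n T)"
  unfolding mat_group_def
proof (intro conjI ballI)
  show "levi adj n T \<subseteq> carrier_mat (2 * n) (2 * n)"
    by (auto elim!: leviE dest: GLm_carrier)
  show "1\<^sub>m (2 * n) \<in> levi adj n T"
    unfolding four_block_one2[symmetric] by (rule levi_memI) (auto simp: GLm_one one)
next
  fix g h assume "g \<in> levi adj n T" "h \<in> levi adj n T"
  then obtain a b a' b' where
    g: "g = four_block_mat a (0\<^sub>m n n) (0\<^sub>m n n) b" "a \<in> GLm n" "T a" "b \<in> carrier_mat n n" "b * adj a = 1\<^sub>m n" and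
    h: "h = four_block_mat a' (0\<^sub>m n n) (0\<^sub>m n n) b'" "a' \<in> GLm n" "T a'" "b' \<in> carrier_mat n n" "b' * adj a' = 1\<^sub>m n"
    by (metis leviE)
  note c = g(2)[THEN GLm_carrier] h(2)[THEN GLm_carrier] g(4) h(4)
  have e: "g * h = four_block_mat (a * a') (0\<^sub>m n n) (0\<^sub>m n n) (b * b')"
    unfolding g(1) h(1) using c by (simp add: levi_mult_block)
  have "(b * b') * adj (a * a') = b * (b' * adj a' * adj a)"
    using c by (simp add: adj_mult mat_assoc)
  also have "\<dots> = 1\<^sub>m n" using c g h by (simp add: mat_one_left)
  finally show "g * h \<in> levi adj n T"
    unfolding e using g h c by (intro levi_memI GLm_mult mult) auto
next
  fix g assume "g \<in> levi adj n T"
  then obtain a b where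
    g: "g = four_block_mat a (0\<^sub>m n n) (0\<^sub>m n n) b" "a \<in> GLm n" "T a" "b \<in> carrier_mat n n" "b * adj a = 1\<^sub>m n" "adj a * b = 1\<^sub>m n"
    by (metis leviE)
  obtain a' where a': "a' \<in> GLm n" "a * a' = 1\<^sub>m n" "a' * a = 1\<^sub>m n" using g(2) by (rule GLmE)
  note c = g(2)[THEN GLm_carrier] a'(1)[THEN GLm_carrier] g(4)
  have "adj a * adj a' = 1\<^sub>m n" using adj_mult[of a' a] a' c by simp
  then have "four_block_mat a' (0\<^sub>m n n) (0\<^sub>m n n) (adj a) \<in> levi adj n T" (is "?h \<in> _")
    by (intro levi_memI a'(1) inv[OF g(2) a'(1) g(3) a'(2)] adj_carrier[OF c(1)])
  moreover have "g * ?h = 1\<^sub>m (2 * n)" "?h * g = 1\<^sub>m (2 * n)"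
    unfolding g(1) four_block_one2[symmetric] using c a' g by (simp_all add: levi_mult_block)
  ultimately show "\<exists>h\<in>levi adj n T. g * h = 1\<^sub>m (2 * n) \<and> h * g = 1\<^sub>m (2 * n)" by blast
qed

lemma mat_group_levi_full: "mat_group (2 * n) (levi adj n (\<lambda>_. True))"
  by (rule mat_group_levi) auto

lemma mat_group_levi_upper: "mat_group (2 * n) (levi adj n upper_triangular)"
proof (rule mat_group_levi)
  show "upper_triangular (1\<^sub>m n :: 'a mat)" using Bk_one[of n] by (simp add: Bk_def)
  show "upper_triangular (a * b)"
    if "a \<in> GLm n" "b \<in> GLm n" "upper_triangular a" "upper_triangular b" for a b :: "'a mat"
    using Bk_mult[of a n b] that by (simp add: Bk_def)
  show "upper_triangular b"
    if "a \<in> GLm n" "b \<in> GLm n" "upper_triangular a" "a * b = 1\<^sub>m n" for a b :: "'a mat"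
    using Bk_inverse[of a n b] that by (simp add: Bk_def GLm_carrier)
qed

lemma levi_mono: "(\<And>a. T a \<Longrightarrow> T' a) \<Longrightarrow> levi adj n T \<subseteq> levi adj n T'"
  unfolding levi_def by blast

lemma levi_subset_UG: "levi adj n T \<subseteq> UG n"
proof
  fix g assume "g \<in> levi adj n T"
  then obtain a b where
    g: "g = four_block_mat a (0\<^sub>m n n) (0\<^sub>m n n) b" "a \<in> GLm n" "T a" "b \<in> carrier_mat n n" "b * adj a = 1\<^sub>m n" "adj a * b = 1\<^sub>m n"
    by (metis leviE)
  note c = g(2)[THEN GLm_carrier] g(4)
  have "adj b * a = 1\<^sub>m n" using adj_mult[of "adj a" b] g(6) c by simp
  moreover have "X - 0\<^sub>m n n = X" "0\<^sub>m n n - X = - X" if "X \<in> carrier_mat n n" for X :: "'a mat"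
    using that by (auto intro!: eq_matI)
  ultimately show "g \<in> UG n"
    unfolding g(1) using c g by (intro UG_blockI) auto
qed

text \<open>The blocks \<open>B\<close> and \<open>D\<close> drop out: the parabolic changes the
  basis of the first \<open>n\<close> columns by \<open>x\<close>, and the Borel subgroup acts on
  their two halves by \<open>b\<close> and by \<open>d\<close>, the inverse of
  \<open>adj b\<close>.\<close>

lemma UG_double_coset_iff:
  assumes g: "four_block_mat A B C D \<in> UG n" "four_block_mat A' B' C' D' \<in> UG n"
    and c: "A \<in> carrier_mat n n" "B \<in> carrier_mat n n" "C \<in> carrier_mat n n" "D \<in> carrier_mat n n"
    and c': "A' \<in> carrier_mat n n" "B' \<in> carrier_mat n n" "C' \<in> carrier_mat n n" "D' \<in> carrier_mat n n"
  shows "(\<exists>h\<in>levi adj n upper_triangular. \<exists>p\<in>siegel_parabolic (UG n) n.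
      four_block_mat A' B' C' D' = h * four_block_mat A B C D * p) \<longleftrightarrow>
    (\<exists>b\<in>Bk n. \<exists>d\<in>carrier_mat n n. d * adj b = 1\<^sub>m n \<and> (\<exists>x\<in>GLm n. A' = b * A * x \<and> C' = d * C * x))"
    (is "?L \<longleftrightarrow> ?R")
proof -
  have step: "(\<exists>p\<in>siegel_parabolic (UG n) n.
      four_block_mat A' B' C' D' = four_block_mat b (0\<^sub>m n n) (0\<^sub>m n n) d * four_block_mat A B C D * p) \<longleftrightarrow>
      (\<exists>x\<in>GLm n. A' = b * A * x \<and> C' = d * C * x)"
    if "b \<in> Bk n" "d \<in> carrier_mat n n" "d * adj b = 1\<^sub>m n" for b d
  proof -
    note bc = Bk_carrier[OF that(1)]
    have "four_block_mat b (0\<^sub>m n n) (0\<^sub>m n n) d \<in> UG n"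
      using levi_memI[of b n "\<lambda>_. True" d] levi_subset_UG that Bk_GLm by blast
    then have "four_block_mat b (0\<^sub>m n n) (0\<^sub>m n n) d * four_block_mat A B C D \<in> UG n"
      using mat_groupD(3)[OF mat_group_UG] g by blast
    then have "four_block_mat (b * A) (b * B) (d * C) (d * D) \<in> UG n"
      using levi_mult_block[OF bc that(2) c] by simp
    then show ?thesis
      unfolding levi_mult_block[OF bc that(2) c]
      using c c' bc that g by (intro siegel_coset_iff[OF mat_group_UG]) auto
  qed
  have "?L \<longleftrightarrow> (\<exists>b\<in>Bk n. \<exists>d\<in>carrier_mat n n. d * adj b = 1\<^sub>m n \<and> (\<exists>p\<in>siegel_parabolic (UG n) n.
      four_block_mat A' B' C' D' = four_block_mat b (0\<^sub>m n n) (0\<^sub>m n n) d * four_block_mat A B C D * p))"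
    unfolding levi_def Bk_def by blast
  also have "\<dots> \<longleftrightarrow> ?R" using step by metis
  finally show ?thesis .
qed

end

section \<open>Lagrangians as graphs of Hermitian forms\<close>

lemma mat_minus_self: "A \<in> carrier_mat k l \<Longrightarrow> A - A = (0\<^sub>m k l :: 'a::ab_group_add mat)"
  by (intro eq_matI) auto

text \<open>Turns an arbitrary triangular matrix into one that acts on the coordinates in
  \<open>I\<close> only. Compressing to a subset of coordinates keeps the order of the indices and
  hence triangularity.\<close>

lemma diag_proj_Bk:
  assumes b: "b \<in> Bk n"
  shows "diag_proj n I * b * diag_proj n I + diag_proj n (- I) \<in> Bk n" (is "?z \<in> _")
proof -
  note bc = Bk_carrier[OF b]
  have "?z $$ (i, j) = (if i \<in> I \<and> j \<in> I then b $$ (i, j) else 0) + (if i = j \<and> i \<notin> I then 1 else 0)"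
    if "i < n" "j < n" for i j
    using that bc
    by (auto simp: diag_proj_mult_index mult_diag_proj_index diag_proj_index simp del: index_mult_mat(1))
  moreover have "?z \<in> carrier_mat n n" using bc by simp
  ultimately show ?thesis using b unfolding Bk_iff by auto
qed

context conj_field
begin

text \<open>A Hermitian form on the coordinate subspace \<open>I\<close>, extended by zero. Taking
  adjoints turns the support condition on rows into the one on columns.\<close>

definition herm_on :: "nat \<Rightarrow> nat set \<Rightarrow> 'a mat \<Rightarrow> bool" where
  "herm_on n I S \<longleftrightarrow> S \<in> carrier_mat n n \<and> adj S = S \<and> diag_proj n I * S = S"

lemma herm_onD:
  assumes "herm_on n I S"
  shows "S \<in> carrier_mat n n" "adj S = S" "diag_proj n I * S = S" "S * diag_proj n I = S"
    "diag_proj n (- I) * S = 0\<^sub>m n n" "S * diag_proj n (- I) = 0\<^sub>m n n"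
proof -
  show c: "S \<in> carrier_mat n n" and a: "adj S = S" and l: "diag_proj n I * S = S"
    using assms by (auto simp: herm_on_def)
  show r: "S * diag_proj n I = S"
    using arg_cong[OF l, of adj] a c by (simp add: adj_mult)
  have "diag_proj n (- I) * (diag_proj n I * S) = (diag_proj n (- I) * diag_proj n I) * S"
    using c by (simp add: mat_assoc)
  then show "diag_proj n (- I) * S = 0\<^sub>m n n" using l c by (simp add: diag_proj_simps)
  have "(S * diag_proj n I) * diag_proj n (- I) = S * (diag_proj n I * diag_proj n (- I))"
    using c by (simp add: mat_assoc)
  then show "S * diag_proj n (- I) = 0\<^sub>m n n" using r c by (simp add: diag_proj_simps)
qed

text \<open>The Lagrangian spanned by the first \<open>n\<close> columns is the graph of the form \<open>S\<close> on the coordinate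
  subspace \<open>I\<close> of the second summand; the last \<open>n\<close> columns complete it to a symplectic basis.\<close>

definition model :: "nat \<Rightarrow> nat set \<Rightarrow> 'a mat \<Rightarrow> 'a mat" where
  "model n I S = four_block_mat (S + diag_proj n (- I)) (- diag_proj n I) (diag_proj n I) (diag_proj n (- I))"

lemma model_UG:
  assumes "herm_on n I S"
  shows "model n I S \<in> UG n"
proof -
  note S = herm_onD[OF assms]
  let ?E = "diag_proj n I :: 'a mat" and ?N = "diag_proj n (- I) :: 'a mat"
  have neg: "X * (- ?E) = - (X * ?E)" "(- ?E) * X = - (?E * X)" if "X \<in> carrier_mat n n" for X
    using that by (auto intro!: uminus_mult_left_mat uminus_mult_right_mat)
  have m: "?N - (- ?E) = 1\<^sub>m n" "(- ?E) - ?N = - 1\<^sub>m n" "- (0\<^sub>m n n) = (0\<^sub>m n n :: 'a mat)"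
    by (auto intro!: eq_matI simp: diag_proj_index)
  show ?thesis
    unfolding model_def
  proof (rule UG_blockI)
    show "adj (S + ?N) * ?E - adj ?E * (S + ?N) = 0\<^sub>m n n"
      using S by (simp add: adj_add mat_simps diag_proj_simps mat_minus_self)
    show "adj (S + ?N) * ?N - adj ?E * (- ?E) = 1\<^sub>m n"
      using S by (simp add: adj_add mat_simps diag_proj_simps neg m)
    show "adj (- ?E) * ?E - adj ?N * (S + ?N) = - 1\<^sub>m n"
      using S by (simp add: adj_uminus mat_simps diag_proj_simps neg m)
    show "adj (- ?E) * ?N - adj ?N * (- ?E) = 0\<^sub>m n n"
      by (simp add: adj_uminus diag_proj_simps neg m mat_minus_self)
  qed (use S in auto)
qed

text \<open>Equivalence of the bases \<open>(A, C)\<close> and \<open>(A', C')\<close> of two Lagrangians under the action of the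
  Borel subgroup on the left and base change on the right.\<close>

definition lagr_rel :: "nat \<Rightarrow> 'a mat \<Rightarrow> 'a mat \<Rightarrow> 'a mat \<Rightarrow> 'a mat \<Rightarrow> bool" where
  "lagr_rel n A C A' C' \<longleftrightarrow> (\<exists>b\<in>Bk n. \<exists>d\<in>carrier_mat n n. d * adj b = 1\<^sub>m n \<and>
    (\<exists>x\<in>GLm n. A' = b * A * x \<and> C' = d * C * x))"

lemma adj_Bk_diag: "b \<in> Bk n \<Longrightarrow> i < n \<Longrightarrow> adj b $$ (i, i) \<noteq> 0"
  by (auto simp: Bk_iff adj_index)

text \<open>The lower halves give \<open>adj b * diag_proj n I' = diag_proj n I * x\<close> and
  \<open>d * diag_proj n I = diag_proj n I' * x'\<close>. The diagonals of \<open>adj b\<close> and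
  \<open>d\<close> have no zeros, so each index set contains the other. After that, \<open>x\<close>
  acts on the subspace as \<open>adj b\<close>, and the form changes by the part of \<open>b\<close>
  on \<open>I\<close>.\<close>

lemma model_rel_imp_congruent:
  assumes I: "I \<subseteq> {..<n}" "I' \<subseteq> {..<n}" and S: "herm_on n I S" and S': "herm_on n I' S'"
    and rel: "lagr_rel n (S + diag_proj n (- I)) (diag_proj n I) (S' + diag_proj n (- I')) (diag_proj n I')"
  shows "I' = I \<and> (\<exists>z\<in>Bk n. S' = z * S * adj z)"
proof -
  obtain b d x where b: "b \<in> Bk n" and d: "d \<in> carrier_mat n n" "d * adj b = 1\<^sub>m n" and x: "x \<in> GLm n"
    and eA: "S' + diag_proj n (- I') = b * (S + diag_proj n (- I)) * x"
    and eC: "diag_proj n I' = d * diag_proj n I * x"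
    using rel unfolding lagr_rel_def by blast
  note bc = Bk_carrier[OF b] and xc = GLm_carrier[OF x]
  have d': "adj b * d = 1\<^sub>m n" using mat_mult_left_right_inverse[of d n "adj b"] d bc by simp
  obtain x' where x': "x' \<in> GLm n" "x * x' = 1\<^sub>m n" using x by (rule GLmE)
  note xc' = GLm_carrier[OF x'(1)]
  have b_dadj: "b * adj d = 1\<^sub>m n" using arg_cong[OF d(2), of adj] d(1) bc by (simp add: adj_mult)
  then have dB: "adj d \<in> Bk n" using Bk_inverse[OF b, of "adj d"] d by simp
  have "adj b * diag_proj n I' = (adj b * d) * (diag_proj n I * x)"
    unfolding eC using bc d xc by (simp add: mat_assoc)
  then have EIx: "adj b * diag_proj n I' = diag_proj n I * x" using d' xc by (simp add: mat_one_left)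
  have "I' \<subseteq> I"
    by (rule diag_proj_triangular_subset[OF EIx]) (use bc xc I adj_Bk_diag[OF b] in auto)
  moreover have "d * diag_proj n I = diag_proj n I' * x'"
  proof -
    have "diag_proj n I' * x' = d * diag_proj n I * (x * x')"
      unfolding eC using d xc xc' by (simp add: mat_assoc)
    then show ?thesis using x' d by (simp add: mat_one_right)
  qed
  then have "I \<subseteq> I'"
    by (rule diag_proj_triangular_subset) (use d xc' I adj_Bk_diag[OF dB] in auto)
  ultimately have eq: "I' = I" by blast
  define E :: "'a mat" where "E = diag_proj n I"
  define N :: "'a mat" where "N = diag_proj n (- I)"
  have Ec: "E \<in> carrier_mat n n" "N \<in> carrier_mat n n" "adj E = E" "adj N = N" "E * E = E" "E * N = 0\<^sub>m n n"
    by (auto simp: E_def N_def diag_proj_simps)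
  note HS = herm_onD[OF S, folded E_def N_def] and HS' = herm_onD[OF S'[unfolded eq], folded E_def N_def]
  have ES: "E * (S + N) = S" "E * (S' + N) = S'" using HS HS' Ec by (simp_all add: mat_simps)
  have Ex: "E * x = adj b * E" using EIx unfolding eq E_def by simp
  have ddb: "adj d * b = 1\<^sub>m n" using arg_cong[OF d', of adj] d bc by (simp add: adj_mult)
  have "adj (d * E * x) = adj x * (E * adj d)" using Ec(1-3) d(1) xc by (simp add: adj_mult mat_assoc)
  moreover have "E = d * E * x" using eC unfolding eq E_def .
  ultimately have E_adj: "E = adj x * (E * adj d)" using Ec(3) by metis
  \<comment> \<open>Replacing the leading \<open>E\<close> by means of \<open>E_adj\<close> brings
    \<open>adj d\<close> next to \<open>b\<close>, where they cancel. What is left is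
    \<open>adj x * S * x\<close>, and \<open>Ex\<close> then trades \<open>x\<close> for
    \<open>adj b\<close>.\<close>
  have "S' = E * (S' + N)" using ES by simp
  also have "\<dots> = (adj x * (E * adj d)) * (b * (S + N) * x)"
    using eA E_adj unfolding eq N_def by simp
  also have "\<dots> = adj x * (E * ((adj d * b) * ((S + N) * x)))"
    using Ec HS d bc xc by (simp add: mat_assoc)
  also have "\<dots> = adj x * ((E * (S + N)) * x)"
    unfolding ddb using Ec HS xc by (simp add: mat_assoc mat_one_left)
  also have "\<dots> = adj x * (S * x)" unfolding ES ..
  also have "S * x = E * S * E * x" using HS by simp
  also have "adj x * (E * S * E * x) = adj (E * x) * (S * (E * x))"
    using Ec(1-3) HS(1) xc by (simp add: adj_mult mat_assoc)
  also have "\<dots> = (E * b) * (S * (adj b * E))"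
    unfolding Ex using Ec bc by (simp add: adj_mult)
  finally have S'_eq: "S' = (E * b) * (S * (adj b * E))" .
  \<comment> \<open>\<open>S\<close> vanishes outside \<open>I\<close>, so only the block of
    \<open>b\<close> on \<open>I\<close> matters and the rest may be replaced by the
    identity.\<close>
  define z where "z = E * b * E + N"
  have zc: "z \<in> carrier_mat n n" using Ec bc by (simp add: z_def)
  have zS: "z * S = E * b * S"
    unfolding z_def using Ec HS bc by (simp add: mat_simps)
  have Sz: "S * adj z = S * (adj b * E)"
    using arg_cong[OF zS, of adj] zc Ec HS bc by (simp add: adj_mult mat_assoc)
  have "z * S * adj z = (E * b * S) * adj z" unfolding zS ..
  also have "\<dots> = (E * b) * (S * adj z)" using Ec HS bc zc by (simp add: mat_assoc)
  also have "\<dots> = S'" unfolding Sz S'_eq ..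
  finally have "S' = z * S * adj z" by simp
  moreover have "z \<in> Bk n" unfolding z_def E_def N_def by (rule diag_proj_Bk[OF b])
  ultimately show ?thesis using eq by blast
qed

text \<open>The two conditions on \<open>\<beta>\<close> make it commute with the projection onto
  \<open>I\<close>. Then \<open>adj \<beta>\<close> serves as base change: it compensates the action
  of the Borel element on the lower half, and on the upper half it completes
  \<open>\<beta> * S\<close> to a congruence.\<close>

lemma model_rel_congruent:
  assumes S: "herm_on n I S" and \<beta>: "\<beta> \<in> Bk n"
    "\<beta> * diag_proj n (- I) = diag_proj n (- I)" "diag_proj n (- I) * \<beta> = diag_proj n (- I)"
  shows "lagr_rel n (S + diag_proj n (- I)) (diag_proj n I)
    (\<beta> * S * adj \<beta> + diag_proj n (- I)) (diag_proj n I)"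
proof -
  define E :: "'a mat" where "E = diag_proj n I"
  define N :: "'a mat" where "N = diag_proj n (- I)"
  have Ec: "E \<in> carrier_mat n n" "N \<in> carrier_mat n n" "adj E = E" "adj N = N" "E + N = 1\<^sub>m n"
    "E * N = 0\<^sub>m n n" "N * E = 0\<^sub>m n n"
    by (auto simp: E_def N_def diag_proj_simps diag_proj_compl)
  have bN: "\<beta> * N = N" "N * \<beta> = N" using \<beta> by (simp_all add: N_def)
  note bc = Bk_carrier[OF \<beta>(1)] and HS = herm_onD[OF S]
  obtain \<beta>' where b': "\<beta>' \<in> Bk n" "\<beta> * \<beta>' = 1\<^sub>m n" using \<beta>(1) by (rule BkE)
  note bc' = Bk_carrier[OF b'(1)]
  have d: "adj \<beta>' * adj \<beta> = 1\<^sub>m n" using arg_cong[OF b'(2), of adj] bc bc' by (simp add: adj_mult)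
  have "\<beta> * E = (E + N) * (\<beta> * E)" using bc Ec by (simp add: mat_one_left)
  also have "\<dots> = E * \<beta> * E + (N * \<beta>) * E" using bc Ec(1,2) by (simp add: mat_simps)
  also have "\<dots> = E * \<beta> * E" using bc Ec bN by simp
  finally have l: "\<beta> * E = E * \<beta> * E" .
  have "E * \<beta> = (E * \<beta>) * (E + N)" using bc Ec by (simp add: mat_one_right)
  also have "\<dots> = E * \<beta> * E + E * (\<beta> * N)" using bc Ec(1,2) by (simp add: mat_simps)
  also have "\<dots> = E * \<beta> * E" using bc Ec bN by simp
  finally have comm0: "E * \<beta> = \<beta> * E" unfolding l .
  have comm: "E * adj \<beta> = adj \<beta> * E"
    using arg_cong[OF comm0, of adj] bc Ec(1-4) by (simp add: adj_mult)
  have "adj \<beta>' * E * adj \<beta> = (adj \<beta>' * adj \<beta>) * E"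
    using bc bc' Ec comm by (simp add: mat_assoc)
  then have C: "E = adj \<beta>' * E * adj \<beta>" using d Ec by (simp add: mat_one_left)
  have "N * adj \<beta> = N" using arg_cong[OF bN(1), of adj] bc Ec by (simp add: adj_mult)
  then have "\<beta> * (S + N) * adj \<beta> = \<beta> * S * adj \<beta> + N"
    using bc HS Ec bN by (simp add: mat_distr_left mat_distr_right)
  then show ?thesis
    unfolding lagr_rel_def E_def[symmetric] N_def[symmetric]
    using \<beta>(1) d C bc bc' adj_GLm[OF Bk_GLm[OF \<beta>(1)]]
    by (intro bexI[of _ \<beta>] bexI[of _ "adj \<beta>'"] conjI bexI[of _ "adj \<beta>"]) auto
qed

text \<open>The base change must satisfy \<open>E * x = E\<close> and \<open>N * A * x = N\<close>,
  where \<open>E\<close> and \<open>N\<close> project onto \<open>I\<close> and its complement; so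
  it is the inverse of \<open>y = E + N * A\<close>. A vector killed by \<open>y\<close> is killed
  by \<open>E\<close> and \<open>N * A\<close>, then by \<open>E * A = E * A * E\<close>, which uses
  \<open>iso\<close>, hence by \<open>A\<close>, and so it is zero by \<open>inj\<close>.\<close>

lemma lagrangian_graph:
  assumes A: "A \<in> carrier_mat n n" and PQ: "P \<in> carrier_mat n n" "Q \<in> carrier_mat n n"
    and iso: "adj A * diag_proj n I = diag_proj n I * A"
    and inj: "P * A + Q * diag_proj n I = 1\<^sub>m n"
  shows "\<exists>x\<in>GLm n. diag_proj n I * x = diag_proj n I \<and> herm_on n I (diag_proj n I * A) \<and>
    A * x = diag_proj n I * A + diag_proj n (- I)"
proof -
  define E :: "'a mat" where "E = diag_proj n I"
  define N :: "'a mat" where "N = diag_proj n (- I)"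
  have Ec: "E \<in> carrier_mat n n" "N \<in> carrier_mat n n" "adj E = E" "adj N = N" "E + N = 1\<^sub>m n"
    "E * N = 0\<^sub>m n n" "N * E = 0\<^sub>m n n" "E * E = E" "N * N = N"
    by (auto simp: E_def N_def diag_proj_simps diag_proj_compl)
  have iso: "adj A * E = E * A" and inj: "P * A + Q * E = 1\<^sub>m n" using assms by (simp_all add: E_def)
  have EAE: "E * A * E = E * A"
    unfolding iso[symmetric] using A Ec by (simp add: mat_assoc)
  have EEA: "E * (E * A) = E * A" "N * (E * A) = 0\<^sub>m n n" "E * (N * A) = 0\<^sub>m n n" "N * (N * A) = N * A"
  proof -
    have "E * E * A = E * A" "N * E * A = 0\<^sub>m n n" "E * N * A = 0\<^sub>m n n" "N * N * A = N * A"
      using A Ec by simp_all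
    then show "E * (E * A) = E * A" "N * (E * A) = 0\<^sub>m n n" "E * (N * A) = 0\<^sub>m n n" "N * (N * A) = N * A"
      using A Ec(1,2) by (simp_all add: mat_assoc)
  qed
  have sum: "E * X + N * X = X" if "X \<in> carrier_mat n n" for X
    using mat_distr_left[of E N X] that Ec by (simp add: mat_one_left)
  have H: "herm_on n I (E * A)"
    using A Ec EEA iso unfolding herm_on_def E_def[symmetric] by (simp add: adj_mult)
  define y where "y = E + N * A"
  have yc: "y \<in> carrier_mat n n" using A Ec by (simp add: y_def)
  have Ey: "E * y = E" "N * y = N * A"
    unfolding y_def using A Ec EEA by (simp_all add: mat_distr_right)
  \<comment> \<open>The injectivity argument as an explicit left inverse of \<open>y\<close>:
    \<open>P * A + Q * E\<close> with \<open>A\<close> split into \<open>N * A\<close> and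
    \<open>E * A * E\<close>.\<close>
  define L where "L = P * N + (P * (E * A) + Q) * E"
  have Lc: "L \<in> carrier_mat n n" using A PQ Ec(1,2) by (intro carrier_matI) (simp_all add: L_def)
  have "L * y = P * (N * y) + (P * (E * A) + Q) * (E * y)"
    unfolding L_def using A PQ Ec yc by (simp add: mat_distr_left mat_assoc)
  also have "\<dots> = P * (N * A) + (P * (E * A * E) + Q * E)"
    unfolding Ey using A PQ Ec by (simp add: mat_distr_left mat_assoc)
  also have "\<dots> = P * (E * A + N * A) + Q * E"
    unfolding EAE using A PQ Ec by (intro eq_matI) (auto simp: mat_distr_right)
  also have "\<dots> = 1\<^sub>m n" using sum[OF A] inj by simp
  finally have "L * y = 1\<^sub>m n" .
  then have "L \<in> GLm n" "y * L = 1\<^sub>m n"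
    using GLm_leftI[of y n L] GLm_leftI(1)[of L n y] yc Lc by auto
  then have x: "L \<in> GLm n" "y * L = 1\<^sub>m n" by auto
  have EL: "E * L = E" using mat_assoc[of E y L] Ey x Ec yc Lc by (simp add: mat_one_right)
  have "N * A * L = N * (y * L)" using mat_assoc[of N y L] Ey Ec yc Lc by simp
  then have NAL: "N * (A * L) = N" using x A Lc Ec by (simp add: mat_assoc mat_one_right)
  have "E * (A * L) = E * A * E * L" unfolding EAE using A Lc Ec by (simp add: mat_assoc)
  also have "\<dots> = E * A * E" using EL A Lc Ec by (simp add: mat_assoc)
  also have "\<dots> = E * A" by (rule EAE)
  finally have "A * L = E * A + N" using sum[of "A * L"] NAL A Lc by simp
  then show ?thesis using H x(1) EL unfolding E_def N_def by blast
qed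

text \<open>\<open>iso\<close> says that the columns of \<open>(A, C)\<close> span an isotropic
  subspace, and \<open>inj\<close> that they are independent, with left inverse
  \<open>(P, Q)\<close>. Eliminating \<open>C\<close> determines \<open>d\<close>; then
  \<open>b\<close> has to be the inverse of \<open>adj d\<close>, and both conditions are carried
  along to the new pair.\<close>

lemma lagr_rel_model:
  assumes A: "A \<in> carrier_mat n n" and C: "C \<in> carrier_mat n n"
    and PQ: "P \<in> carrier_mat n n" "Q \<in> carrier_mat n n"
    and iso: "adj A * C = adj C * A" and inj: "P * A + Q * C = 1\<^sub>m n"
  shows "\<exists>I S. I \<subseteq> {..<n} \<and> herm_on n I S \<and> lagr_rel n A C (S + diag_proj n (- I)) (diag_proj n I)"
proof -
  obtain d x I where d: "d \<in> carrier_mat n n" "transpose_mat d \<in> Bk n" and x: "x \<in> GLm n" and I: "I \<subseteq> {..<n}"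
    and e: "d * C * x = diag_proj n I"
    using echelon_lower[OF C] by blast
  have adjd: "adj d \<in> Bk n" using d unfolding Bk_iff by (auto simp: adj_index)
  then obtain b where b: "b \<in> Bk n" "adj d * b = 1\<^sub>m n" "b * adj d = 1\<^sub>m n" by (rule BkE)
  note bc = Bk_carrier[OF b(1)] and xc = GLm_carrier[OF x]
  have db: "d * adj b = 1\<^sub>m n" using arg_cong[OF b(3), of adj] bc d by (simp add: adj_mult)
  have bd: "adj b * d = 1\<^sub>m n" using arg_cong[OF b(2), of adj] bc d by (simp add: adj_mult)
  obtain x' where x': "x' \<in> GLm n" "x' * x = 1\<^sub>m n" using x by (metis GLmE)
  note xc' = GLm_carrier[OF x'(1)]
  define A1 where "A1 = b * A * x"
  have A1: "A1 \<in> carrier_mat n n" using bc A xc by (simp add: A1_def)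
  have cancel: "adj b * (d * X) = X" "adj d * (b * X) = X" if "dim_row X = n" for X
  proof -
    have X: "X \<in> carrier_mat n (dim_col X)" using that by auto
    show "adj b * (d * X) = X" by (rule mat_cancel[OF bd adj_carrier[OF bc] d(1) X])
    show "adj d * (b * X) = X" by (rule mat_cancel[OF b(2) adj_carrier[OF d(1)] bc X])
  qed
  have "adj A1 * diag_proj n I = adj x * ((adj A * C) * x)"
    unfolding e[symmetric] A1_def using bc d xc A C by (simp add: adj_mult mat_assoc cancel)
  also have "\<dots> = adj (diag_proj n I) * A1"
    unfolding e[symmetric] A1_def iso using bc d xc A C by (simp add: adj_mult mat_assoc cancel)
  finally have iso1: "adj A1 * diag_proj n I = diag_proj n I * A1" by simp
  have "(x' * P * adj d) * A1 + (x' * Q * adj b) * diag_proj n I = x' * ((P * A + Q * C) * x)"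
    unfolding e[symmetric] A1_def using bc d xc xc' A C PQ by (simp add: mat_assoc cancel mat_distr_left mat_distr_right)
  also have "\<dots> = 1\<^sub>m n" using inj xc x' by (simp add: mat_one_left)
  finally have inj1: "(x' * P * adj d) * A1 + (x' * Q * adj b) * diag_proj n I = 1\<^sub>m n" .
  have c1: "x' * P * adj d \<in> carrier_mat n n" "x' * Q * adj b \<in> carrier_mat n n"
    using PQ bc d(1) xc' by (auto intro!: carrier_matI)
  obtain y where y: "y \<in> GLm n" "diag_proj n I * y = diag_proj n I" "herm_on n I (diag_proj n I * A1)"
    "A1 * y = diag_proj n I * A1 + diag_proj n (- I)"
    using lagrangian_graph[OF A1 c1 iso1 inj1] by blast
  note yc = GLm_carrier[OF y(1)]
  have "b * A * (x * y) = A1 * y" unfolding A1_def using bc A xc yc by (simp add: mat_assoc)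
  then have "b * A * (x * y) = diag_proj n I * A1 + diag_proj n (- I)" using y(4) by simp
  moreover have "d * C * (x * y) = d * C * x * y" using d C xc yc by (simp add: mat_assoc)
  then have "d * C * (x * y) = diag_proj n I" using y(2) e by simp
  ultimately have "lagr_rel n A C (diag_proj n I * A1 + diag_proj n (- I)) (diag_proj n I)"
    unfolding lagr_rel_def using b d db GLm_mult[OF x y(1)] by metis
  then show ?thesis using I y(3) by blast
qed

end

section \<open>Signature of Hermitian forms\<close>

definition diag_fn :: "nat \<Rightarrow> (nat \<Rightarrow> 'a) \<Rightarrow> 'a::field mat" where
  "diag_fn r d = mat r r (\<lambda>(i, j). if i = j then d i else 0)"

lemma diag_fn_carrier [simp]: "diag_fn r d \<in> carrier_mat r r"
  by (simp add: diag_fn_def)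

lemma I_pq_eq_diag_fn: "I_pq p q = diag_fn (p + q) (\<lambda>i. if i < p then 1 else - 1)"
  by (rule eq_matI) (auto simp: I_pq_def diag_fn_def)

lemma I_pq_carrier [simp]: "I_pq p q \<in> carrier_mat (p + q) (p + q)"
  by (simp add: I_pq_eq_diag_fn)

lemma diag_fn_mult_diag_fn: "diag_fn r c * diag_fn r d = diag_fn r (\<lambda>i. c i * d i)"
proof (rule eq_matI)
  fix i j assume "i < dim_row (diag_fn r (\<lambda>i. c i * d i))" "j < dim_col (diag_fn r (\<lambda>i. c i * d i))"
  then have ij: "i < r" "j < r" by (auto simp: diag_fn_def)
  have "(diag_fn r c * diag_fn r d) $$ (i, j) = (\<Sum>k<r. diag_fn r c $$ (i, k) * diag_fn r d $$ (k, j))"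
    using ij by (subst mult_mat_index) (auto simp: diag_fn_def)
  also have "\<dots> = (\<Sum>k<r. if k = i then c i * diag_fn r d $$ (i, j) else 0)"
    using ij by (intro sum.cong refl) (auto simp: diag_fn_def)
  also have "\<dots> = diag_fn r (\<lambda>i. c i * d i) $$ (i, j)" using ij by (simp add: diag_fn_def)
  finally show "(diag_fn r c * diag_fn r d) $$ (i, j) = diag_fn r (\<lambda>i. c i * d i) $$ (i, j)" .
qed (auto simp: diag_fn_def)

lemma I_pq_mult_self: "I_pq p q * I_pq p q = 1\<^sub>m (p + q)"
  unfolding I_pq_eq_diag_fn diag_fn_mult_diag_fn by (rule eq_matI) (auto simp: diag_fn_def)

lemma I_pq_GLm: "I_pq p q \<in> GLm (p + q)"
  using GLm_leftI(1)[OF _ _ I_pq_mult_self] by simp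

context conj_field
begin

lemma adj_I_pq [simp]: "adj (I_pq p q) = I_pq p q"
  by (rule eq_matI) (auto simp: adj_index I_pq_eq_diag_fn diag_fn_def cj_uminus)

lemma diag_fn_form_index:
  assumes "X \<in> carrier_mat k r" "Y \<in> carrier_mat l r" "i < k" "j < l"
  shows "(X * diag_fn r d * adj Y) $$ (i, j) = (\<Sum>m<r. X $$ (i, m) * d m * cj (Y $$ (j, m)))"
proof -
  have "(X * diag_fn r d) $$ (i, m) = X $$ (i, m) * d m" if "m < r" for m
  proof -
    have "(X * diag_fn r d) $$ (i, m) = (\<Sum>a<r. X $$ (i, a) * diag_fn r d $$ (a, m))"
      using assms that by (subst mult_mat_index) (auto simp: diag_fn_def)
    also have "\<dots> = (\<Sum>a<r. if a = m then X $$ (i, m) * d m else 0)"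
      using that by (intro sum.cong refl) (auto simp: diag_fn_def)
    finally show ?thesis using that by simp
  qed
  moreover have "(X * diag_fn r d * adj Y) $$ (i, j) = (\<Sum>m<r. (X * diag_fn r d) $$ (i, m) * adj Y $$ (m, j))"
    using assms by (subst mult_mat_index) (auto simp: diag_fn_def)
  ultimately show ?thesis using assms by (auto simp: adj_index intro!: sum.cong)
qed

text \<open>The element \<open>x * cj x\<close> is known only to lie in the embedded reals, so its
  real value is chosen; it is unique because \<open>of_real\<close> is injective.\<close>

definition norm_sq :: "'a \<Rightarrow> real" where "norm_sq x = (SOME r. x * cj x = of_real r)"

lemma norm_sq: "x * cj x = of_real (norm_sq x)"
proof -
  have "\<exists>r. x * cj x = of_real r"
    using cj_pos[of x] by (cases "x = 0") (auto intro: exI[of _ 0])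
  then show ?thesis unfolding norm_sq_def by (rule someI_ex)
qed

lemma norm_sq_pos: "x \<noteq> 0 \<Longrightarrow> norm_sq x > 0"
  using cj_pos[of x] norm_sq[of x] by auto

lemma norm_sq_0 [simp]: "norm_sq 0 = 0"
  using norm_sq[of 0] by simp

lemma norm_sq_nonneg: "norm_sq x \<ge> 0"
  using norm_sq_pos[of x] by (cases "x = 0") auto

text \<open>If \<open>p > p'\<close>, some non-zero row vector \<open>v\<close> vanishes on the first \<open>p'\<close> coordinates while
  \<open>v * M\<close> vanishes on the last \<open>q\<close> ones; the form would be negative at \<open>v\<close> and non-negative there.\<close>

lemma signature_le:
  assumes M: "M \<in> carrier_mat r r" and pq: "p + q = r" "p' + q' = r"
    and e: "M * I_pq p q * adj M = I_pq p' q'"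
  shows "p \<le> p'"
proof (rule ccontr)
  assume "\<not> p \<le> p'"
  then have p: "p' < p" by simp
  \<comment> \<open>A vector killed by the transpose of \<open>Z\<close> vanishes on the first
    \<open>p'\<close> coordinates and is annihilated by the columns of \<open>M\<close> from
    \<open>p\<close> on. These are only \<open>p' + q < r\<close> conditions; the columns from
    \<open>p'\<close> up to \<open>p\<close> are filled with zeros, which makes \<open>Z\<close>
    singular.\<close>
  define Z where "Z = mat r r (\<lambda>(i, j). if j < p' then if i = j then 1 else 0 else if j < p then 0 else M $$ (i, j))"
  have Zc: "Z \<in> carrier_mat r r" by (simp add: Z_def)
  have "p' < r" using p pq by simp
  have "Z *\<^sub>v unit_vec r p' = 0\<^sub>v r"
    using \<open>p' < r\<close> p Zc by (intro eq_vecI) (auto simp: Z_def)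
  moreover have "unit_vec r p' \<noteq> (0\<^sub>v r :: 'a vec)" using \<open>p' < r\<close> by simp
  ultimately have "det Z = 0"
    using det_0_iff_vec_prod_zero[OF Zc] unit_vec_carrier by blast
  then have "det (transpose_mat Z) = 0" using det_transpose[OF Zc] by simp
  then obtain v where v: "v \<in> carrier_vec r" "v \<noteq> 0\<^sub>v r" "transpose_mat Z *\<^sub>v v = 0\<^sub>v r"
    using det_0_iff_vec_prod_zero[of "transpose_mat Z" r] Zc by auto
  have col: "(\<Sum>i<r. v $ i * Z $$ (i, j)) = 0" if "j < r" for j
  proof -
    have "(transpose_mat Z *\<^sub>v v) $ j = 0" using v(3) that by simp
    then have "(\<Sum>i<r. Z $$ (i, j) * v $ i) = 0"
      using that Zc v(1) by (simp add: scalar_prod_def lessThan_atLeast0)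
    then show ?thesis by (simp add: mult.commute)
  qed
  define V where "V = mat 1 r (\<lambda>(_, j). v $ j)"
  have Vc: "V \<in> carrier_mat 1 r" by (simp add: V_def)
  have V0: "V $$ (0, j) = 0" if "j < p'" for j
  proof -
    have "(\<Sum>i<r. v $ i * Z $$ (i, j)) = (\<Sum>i<r. if i = j then v $ i else 0)"
      using that \<open>p' < r\<close> by (intro sum.cong refl) (auto simp: Z_def)
    then show ?thesis using col[of j] that \<open>p' < r\<close> by (simp add: V_def)
  qed
  have VM0: "(V * M) $$ (0, j) = 0" if "p \<le> j" "j < r" for j
  proof -
    have "(V * M) $$ (0, j) = (\<Sum>i<r. v $ i * Z $$ (i, j))"
      using that p Vc M by (subst mult_mat_index) (auto simp: V_def Z_def)
    then show ?thesis using col that by simp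
  qed
  have VMc: "V * M \<in> carrier_mat 1 r" using Vc M by simp
  have "V * I_pq p' q' * adj V = (V * M) * I_pq p q * adj (V * M)"
    unfolding e[symmetric] using Vc M pq I_pq_carrier[of p q, where 'a='a] by (simp add: adj_mult mat_assoc)
  then have "(V * I_pq p' q' * adj V) $$ (0, 0) = ((V * M) * I_pq p q * adj (V * M)) $$ (0, 0)" by simp
  moreover have "(V * I_pq p' q' * adj V) $$ (0, 0) = of_real (- (\<Sum>m<r. norm_sq (V $$ (0, m))))"
  proof -
    have "(V * I_pq p' q' * adj V) $$ (0, 0)
        = (\<Sum>m<r. V $$ (0, m) * (if m < p' then 1 else - 1) * cj (V $$ (0, m)))"
      unfolding I_pq_eq_diag_fn pq using Vc by (intro diag_fn_form_index) auto
    also have "\<dots> = (\<Sum>m<r. - of_real (norm_sq (V $$ (0, m))))"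
      using V0 by (intro sum.cong refl) (auto simp: norm_sq)
    finally show ?thesis by (simp add: sum_negf)
  qed
  moreover have "((V * M) * I_pq p q * adj (V * M)) $$ (0, 0) = of_real (\<Sum>m<r. norm_sq ((V * M) $$ (0, m)))"
  proof -
    have "((V * M) * I_pq p q * adj (V * M)) $$ (0, 0)
        = (\<Sum>m<r. (V * M) $$ (0, m) * (if m < p then 1 else - 1) * cj ((V * M) $$ (0, m)))"
      unfolding I_pq_eq_diag_fn pq using VMc by (intro diag_fn_form_index) auto
    also have "\<dots> = (\<Sum>m<r. of_real (norm_sq ((V * M) $$ (0, m))))"
    proof (intro sum.cong refl)
      fix m assume "m \<in> {..<r}"
      then show "(V * M) $$ (0, m) * (if m < p then 1 else - 1) * cj ((V * M) $$ (0, m)) = of_real (norm_sq ((V * M) $$ (0, m)))"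
        using VM0[of m] norm_sq[of "(V * M) $$ (0, m)"] by (cases "m < p") auto
    qed
    finally show ?thesis by simp
  qed
  ultimately have "- (\<Sum>m<r. norm_sq (V $$ (0, m))) = (\<Sum>m<r. norm_sq ((V * M) $$ (0, m)))"
    by (metis of_real_eq_iff)
  moreover have "(\<Sum>m<r. norm_sq (V $$ (0, m))) \<ge> 0" "(\<Sum>m<r. norm_sq ((V * M) $$ (0, m))) \<ge> 0"
    by (simp_all add: sum_nonneg norm_sq_nonneg)
  ultimately have "(\<Sum>m<r. norm_sq (V $$ (0, m))) = 0" by linarith
  then have "norm_sq (V $$ (0, m)) = 0" if "m < r" for m
    using that by (subst (asm) sum_nonneg_eq_0_iff) (auto simp: norm_sq_nonneg)
  then have "V $$ (0, m) = 0" if "m < r" for m using norm_sq_pos that by force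
  then have "v = 0\<^sub>v r" using v(1) by (intro eq_vecI) (auto simp: V_def)
  then show False using v by simp
qed

lemma signature_unique:
  assumes M: "M \<in> GLm r" and pq: "p + q = r" "p' + q' = r"
    and e: "M * I_pq p q * adj M = I_pq p' q'"
  shows "p = p' \<and> q = q'"
proof -
  obtain N where N: "N \<in> GLm r" "N * M = 1\<^sub>m r" using M by (metis GLmE)
  note c = GLm_carrier[OF M] GLm_carrier[OF N(1)]
  have Ic: "(I_pq p q :: 'a mat) \<in> carrier_mat r r" using pq by auto
  have "adj M * adj N = 1\<^sub>m r" using arg_cong[OF N(2), of adj] c by (simp add: adj_mult)
  moreover have "N * (M * F * adj M) * adj N = (N * M) * (F * (adj M * adj N))" if "F \<in> carrier_mat r r" for F
    using c that by (simp add: mat_assoc)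
  from this[OF Ic] have "N * I_pq p' q' * adj N = (N * M) * (I_pq p q * (adj M * adj N))"
    unfolding e .
  ultimately have "N * I_pq p' q' * adj N = I_pq p q"
    using N(2) left_mult_one_mat[OF Ic] right_mult_one_mat[OF Ic] by simp
  then have "p' \<le> p" using signature_le[OF c(2) pq(2,1)] by simp
  moreover have "p \<le> p'" using signature_le[OF c(1) pq e] .
  ultimately show ?thesis using pq by simp
qed

section \<open>Diagonalisation of Hermitian forms by congruence\<close>

lemma adj_form: "adj X = X \<Longrightarrow> h \<in> carrier_mat r r \<Longrightarrow> X \<in> carrier_mat r r \<Longrightarrow> adj (h * X * adj h) = h * X * adj h"
  by (simp add: adj_mult mat_assoc)

lemma form_GLm: "h \<in> GLm r \<Longrightarrow> X \<in> GLm r \<Longrightarrow> h * X * adj h \<in> GLm r"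
  by (intro GLm_mult adj_GLm)

lemma adj_symD:
  assumes "adj D = D" "D \<in> carrier_mat r r" "i < r" "j < r"
  shows "cj (D $$ (i, j)) = D $$ (j, i)"
  using assms adj_index[of j D i] by auto

lemma cj_divide: "cj (x / y) = cj x / cj y"
proof (cases "y = 0")
  case False
  then have "cj (x / y) * cj y = cj x" by (simp add: cj_mult[symmetric])
  then show ?thesis using False by (simp add: eq_divide_eq)
qed simp

text \<open>The row operation \<open>h\<close> leaves row \<open>i\<close> alone, so only the column
  operation \<open>adj h\<close> is visible there.\<close>

lemma form_index_unit_row:
  assumes D: "D \<in> carrier_mat r r" and h: "h \<in> carrier_mat r r" and ij: "i < r" "j < r"
    and row: "\<And>l. l < r \<Longrightarrow> h $$ (i, l) = (if i = l then 1 else 0)"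
  shows "(h * D * adj h) $$ (i, j) = (\<Sum>l<r. D $$ (i, l) * cj (h $$ (j, l)))"
proof -
  have "(h * D) $$ (i, l) = D $$ (i, l)" if "l < r" for l
  proof -
    have "(h * D) $$ (i, l) = (\<Sum>a<r. h $$ (i, a) * D $$ (a, l))"
      using D h ij that by (subst mult_mat_index) auto
    also have "\<dots> = (\<Sum>a<r. if a = i then D $$ (i, l) else 0)"
      using row by (intro sum.cong refl) auto
    finally show ?thesis using ij by simp
  qed
  moreover have "(h * D * adj h) $$ (i, j) = (\<Sum>l<r. (h * D) $$ (i, l) * adj h $$ (l, j))"
    using D h ij by (subst mult_mat_index) auto
  ultimately show ?thesis using h ij by (auto simp: adj_index intro!: sum.cong)
qed

text \<open>Only rows are mentioned; for a Hermitian matrix the first \<open>k\<close> columns are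
  then finished as well.\<close>

definition diag_upto :: "nat \<Rightarrow> nat \<Rightarrow> 'a mat \<Rightarrow> bool" where
  "diag_upto r k D \<longleftrightarrow> (\<forall>i<k. \<forall>j<r. i \<noteq> j \<longrightarrow> D $$ (i, j) = 0)"

text \<open>Symmetric Gauss elimination: \<open>h\<close> subtracts multiples of row
  \<open>k\<close> from the rows below, and \<open>adj h\<close> does the same with the columns.
  Earlier rows are zero off the diagonal and are not affected.\<close>

lemma diag_step_pivot:
  assumes D: "D \<in> carrier_mat r r" "adj D = D" and k: "k < r" "diag_upto r k D" and piv: "D $$ (k, k) \<noteq> 0"
  shows "\<exists>h\<in>GLm r. diag_upto r (Suc k) (h * D * adj h)"
proof -
  define h where "h = mat r r (\<lambda>(i, j). if i = j then 1 else if j = k \<and> k < i then - D $$ (i, k) / D $$ (k, k) else 0)"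
  have hc: "h \<in> carrier_mat r r" by (simp add: h_def)
  have "adj h \<in> Bk r" unfolding Bk_iff by (auto simp: h_def adj_index)
  then have "h \<in> GLm r" using adj_GLm[of "adj h" r] Bk_GLm by auto
  moreover have "diag_upto r (Suc k) (h * D * adj h)"
    unfolding diag_upto_def
  proof (intro allI impI)
    fix i j assume ij: "i < Suc k" "j < r" "i \<noteq> j"
    have "(h * D * adj h) $$ (i, j) = (\<Sum>l<r. D $$ (i, l) * cj (h $$ (j, l)))"
      using ij k by (intro form_index_unit_row D hc) (auto simp: h_def)
    also have "\<dots> = (\<Sum>l<r. (if l = j then D $$ (i, j) else 0) +
        (if l = k then if k < j then D $$ (i, k) * cj (- D $$ (j, k) / D $$ (k, k)) else 0 else 0))"
      using ij k by (intro sum.cong refl) (auto simp: h_def)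
    also have "\<dots> = D $$ (i, j) + (if k < j then D $$ (i, k) * cj (- D $$ (j, k) / D $$ (k, k)) else 0)"
      using ij k by (simp add: sum.distrib)
    also have "cj (- D $$ (j, k) / D $$ (k, k)) = - D $$ (k, j) / D $$ (k, k)"
      using adj_symD[OF D(2,1)] ij k by (simp add: cj_divide cj_uminus)
    also have "D $$ (i, j) + (if k < j then D $$ (i, k) * (- D $$ (k, j) / D $$ (k, k)) else 0) = 0"
    proof (cases "i < k")
      case True
      then show ?thesis using k ij unfolding diag_upto_def by auto
    next
      case False
      then have i: "i = k" using ij by simp
      have "D $$ (k, j) = 0" if "j < k"
      proof -
        have "D $$ (j, k) = 0" using k that unfolding diag_upto_def by auto
        then show ?thesis using adj_symD[OF D(2,1), of j k] k ij by simp
      qed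
      then show ?thesis using i piv ij by (cases "k < j") auto
    qed
    finally show "(h * D * adj h) $$ (i, j) = 0" .
  qed
  ultimately show ?thesis by blast
qed

text \<open>If the pivot is zero, invertibility provides some \<open>d = D $$ (k, j)\<close> that is
  non-zero, with \<open>k < j\<close>. Adding \<open>t\<close> times row \<open>j\<close> to row
  \<open>k\<close>, and likewise for columns, with \<open>t\<close> a real multiple \<open>s\<close>
  of \<open>d\<close>, produces the pivot
  \<open>s * (d * cj d) * (2 + s * D $$ (j, j))\<close>.\<close>

lemma diag_step_make_pivot:
  assumes D: "D \<in> GLm r" "adj D = D" and k: "k < r" "diag_upto r k D"
  shows "\<exists>h\<in>GLm r. diag_upto r k (h * D * adj h) \<and> (h * D * adj h) $$ (k, k) \<noteq> 0"
proof (cases "D $$ (k, k) = 0")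
  case False
  then show ?thesis using k GLm_carrier[OF D(1)] by (intro bexI[of _ "1\<^sub>m r"]) (auto simp: GLm_one)
next
  case True
  note Dc = GLm_carrier[OF D(1)]
  obtain D' where D': "D' \<in> GLm r" "D * D' = 1\<^sub>m r" using D(1) by (rule GLmE)
  have "\<exists>j<r. D $$ (k, j) \<noteq> 0"
  proof (rule ccontr)
    assume "\<not> (\<exists>j<r. D $$ (k, j) \<noteq> 0)"
    then have "(D * D') $$ (k, k) = 0"
      using Dc GLm_carrier[OF D'(1)] k by (subst mult_mat_index) auto
    then show False using D' k by simp
  qed
  then obtain j where j: "j < r" "D $$ (k, j) \<noteq> 0" by blast
  have "k < j"
  proof (rule ccontr)
    assume "\<not> k < j"
    then have "j < k" using True j by (cases "j = k") auto
    then have "D $$ (j, k) = 0" using k unfolding diag_upto_def by auto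
    then show False using adj_symD[OF D(2) Dc, of j k] j k by simp
  qed
  define d where "d = D $$ (k, j)"
  have dj: "D $$ (j, k) = cj d" using adj_symD[OF D(2) Dc, of k j] j k by (simp add: d_def)
  \<comment> \<open>The value 1 works unless \<open>D $$ (j, j)\<close> is -2, and in that case -1
    makes the factor equal to 4.\<close>
  obtain s :: real where s: "s \<noteq> 0" "2 + of_real s * D $$ (j, j) \<noteq> 0"
  proof (cases "2 + D $$ (j, j) = 0")
    case True
    then have "D $$ (j, j) = - 2" by (simp add: eq_neg_iff_add_eq_0 add.commute)
    then show ?thesis using that[of "- 1"] by simp
  next
    case False
    then show ?thesis using that[of 1] by simp
  qed
  define t where "t = of_real s * d"
  define h where "h = mat r r (\<lambda>(a, b). if a = b then 1 else if a = k \<and> b = j then t else 0)"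
  have hc: "h \<in> carrier_mat r r" by (simp add: h_def)
  have "h \<in> Bk r" unfolding Bk_iff using \<open>k < j\<close> by (auto simp: h_def)
  then have hG: "h \<in> GLm r" by (rule Bk_GLm)
  have "diag_upto r k (h * D * adj h)"
    unfolding diag_upto_def
  proof (intro allI impI)
    fix i l assume il: "i < k" "l < r" "i \<noteq> l"
    have z: "D $$ (i, m) = 0" if "m < r" "m \<noteq> i" for m using k il that unfolding diag_upto_def by auto
    have "(h * D * adj h) $$ (i, l) = (\<Sum>m<r. D $$ (i, m) * cj (h $$ (l, m)))"
      using il k by (intro form_index_unit_row Dc hc) (auto simp: h_def)
    also have "\<dots> = 0"
    proof (rule sum.neutral, rule ballI)
      fix m assume "m \<in> {..<r}"
      then show "D $$ (i, m) * cj (h $$ (l, m)) = 0"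
        using z[of m] il \<open>k < j\<close> by (cases "m = i") (auto simp: h_def)
    qed
    finally show "(h * D * adj h) $$ (i, l) = 0" .
  qed
  moreover have "(h * D * adj h) $$ (k, k) \<noteq> 0"
  proof -
    have hD: "(h * D) $$ (k, l) = D $$ (k, l) + t * D $$ (j, l)" if "l < r" for l
    proof -
      have "(h * D) $$ (k, l) = (\<Sum>a<r. h $$ (k, a) * D $$ (a, l))"
        using hc Dc k that by (subst mult_mat_index) auto
      also have "\<dots> = (\<Sum>a<r. (if a = k then D $$ (k, l) else 0) + (if a = j then t * D $$ (j, l) else 0))"
        using k j \<open>k < j\<close> by (intro sum.cong refl) (auto simp: h_def)
      finally show ?thesis using k j by (simp add: sum.distrib)
    qed
    have "(h * D * adj h) $$ (k, k) = (\<Sum>l<r. (h * D) $$ (k, l) * adj h $$ (l, k))"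
      using hc Dc k by (subst mult_mat_index) auto
    also have "\<dots> = (\<Sum>l<r. (if l = k then D $$ (k, k) + t * D $$ (j, k) else 0) +
        (if l = j then (D $$ (k, j) + t * D $$ (j, j)) * cj t else 0))"
      using k j \<open>k < j\<close> hc by (intro sum.cong refl) (auto simp: h_def adj_index hD[unfolded h_def])
    also have "\<dots> = t * cj d + (d + t * D $$ (j, j)) * cj t"
      using k j True dj by (simp add: sum.distrib d_def)
    also have "\<dots> = of_real s * (d * cj d) * (2 + of_real s * D $$ (j, j))"
      unfolding t_def by (simp add: cj_mult algebra_simps)
    finally show ?thesis using s j by (simp add: d_def)
  qed
  ultimately show ?thesis using hG by blast
qed

lemma form_comp:
  assumes "h \<in> carrier_mat r r" "h' \<in> carrier_mat r r" "X \<in> carrier_mat r r"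
  shows "h' * (h * X * adj h) * adj h' = (h' * h) * X * adj (h' * h)"
  using assms by (simp add: adj_mult mat_assoc)

text \<open>Each round first creates a non-zero pivot, which invertibility permits, and then clears
  its row and column.\<close>

lemma diagonalize:
  assumes T: "T \<in> GLm r" "adj T = T"
  shows "k \<le> r \<Longrightarrow> \<exists>h\<in>GLm r. diag_upto r k (h * T * adj h)"
proof (induction k)
  case 0
  then show ?case using GLm_one by (auto simp: diag_upto_def)
next
  case (Suc k)
  then obtain h where h: "h \<in> GLm r" "diag_upto r k (h * T * adj h)" by auto
  note Tc = GLm_carrier[OF T(1)] and hc = GLm_carrier[OF h(1)]
  have 1: "h * T * adj h \<in> GLm r" "adj (h * T * adj h) = h * T * adj h"
    by (rule form_GLm[OF h(1) T(1)], rule adj_form[OF T(2) hc Tc])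
  obtain u where u: "u \<in> GLm r" "diag_upto r k (u * (h * T * adj h) * adj u)" "(u * (h * T * adj h) * adj u) $$ (k, k) \<noteq> 0"
    using diag_step_make_pivot[OF 1 _ h(2)] Suc.prems by auto
  note uc = GLm_carrier[OF u(1)]
  have 2: "u * (h * T * adj h) * adj u \<in> carrier_mat r r" "adj (u * (h * T * adj h) * adj u) = u * (h * T * adj h) * adj u"
    using uc GLm_carrier[OF 1(1)] adj_form[OF 1(2) uc] by auto
  obtain w where w: "w \<in> GLm r" "diag_upto r (Suc k) (w * (u * (h * T * adj h) * adj u) * adj w)"
    using diag_step_pivot[OF 2 _ u(2,3)] Suc.prems by auto
  note wc = GLm_carrier[OF w(1)]
  have "w * (u * (h * T * adj h) * adj u) * adj w = (w * u * h) * T * adj (w * u * h)"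
    using wc uc hc Tc by (simp add: adj_mult mat_assoc)
  then show ?case using w u h GLm_mult by metis
qed

lemma hermitian_normal_form:
  assumes T: "T \<in> GLm r" "adj T = T"
  shows "\<exists>p q. p + q = r \<and> (\<exists>h\<in>GLm r. T = h * I_pq p q * adj h)"
proof -
  note Tc = GLm_carrier[OF T(1)]
  obtain h where h: "h \<in> GLm r" "diag_upto r r (h * T * adj h)" using diagonalize[OF T, of r] by auto
  note hc = GLm_carrier[OF h(1)]
  define D where "D = h * T * adj h"
  have D: "D \<in> GLm r" "adj D = D" unfolding D_def
    by (rule form_GLm[OF h(1) T(1)], rule adj_form[OF T(2) hc Tc])
  note Dc = GLm_carrier[OF D(1)]
  have "\<exists>c. D $$ (i, i) = of_real c" if "i < r" for i
    using cj_fixed[of "D $$ (i, i)"] adj_symD[OF D(2) Dc that that] by (auto elim: Reals_cases)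
  then obtain c where c: "\<And>i. i < r \<Longrightarrow> D $$ (i, i) = of_real (c i)" by metis
  have Ddg: "D = diag_fn r (\<lambda>i. of_real (c i))"
    using h(2) Dc c unfolding D_def[symmetric] diag_upto_def by (intro eq_matI) (auto simp: diag_fn_def)
  \<comment> \<open>A diagonal invertible matrix is in particular triangular, so
    \<open>Bk_iff\<close> shows that no diagonal entry vanishes.\<close>
  have "D \<in> Bk r"
    unfolding Bk_def using D(1) Dc by (auto simp: upper_triangular_def Ddg diag_fn_def)
  then have c0: "c i \<noteq> 0" if "i < r" for i using that c[OF that] unfolding Bk_iff by auto
  define A where "A = {i. i < r \<and> c i > 0}"
  define B where "B = {i. i < r \<and> \<not> c i > 0}"
  have fin: "finite A" "finite B" by (auto simp: A_def B_def)
  define p where "p = card A"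
  define q where "q = card B"
  have "card (A \<union> B) = p + q" unfolding p_def q_def by (rule card_Un_disjoint) (use fin in \<open>auto simp: A_def B_def\<close>)
  moreover have "A \<union> B = {..<r}" by (auto simp: A_def B_def)
  ultimately have pq: "p + q = r" by simp
  obtain f where f: "bij_betw f {0..<p} A" using ex_bij_betw_nat_finite[OF fin(1)] by (auto simp: p_def)
  obtain g where g: "bij_betw g {0..<q} B" using ex_bij_betw_nat_finite[OF fin(2)] by (auto simp: q_def)
  \<comment> \<open>\<open>\<sigma>\<close> lists the indices of the positive entries before those
    of the negative ones. \<open>M\<close> below permutes the basis accordingly and rescales by
    \<open>1 / sqrt \<bar>c j\<bar>\<close>, so that only signs remain.\<close>
  define \<sigma> where "\<sigma> i = (if i < p then f i else g (i - p))" for i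
  have \<sigma>A: "\<sigma> i \<in> A" if "i < p" for i using that f by (auto simp: \<sigma>_def bij_betw_def)
  have \<sigma>B: "\<sigma> i \<in> B" if "\<not> i < p" "i < r" for i
  proof -
    have "i - p \<in> {0..<q}" using that pq by auto
    then show ?thesis using that(1) g by (auto simp: \<sigma>_def bij_betw_def)
  qed
  have \<sigma>r: "\<sigma> i < r" if "i < r" for i using \<sigma>A[of i] \<sigma>B[of i] that by (cases "i < p") (auto simp: A_def B_def)
  have \<sigma>inj: "i = j" if "\<sigma> i = \<sigma> j" "i < r" "j < r" for i j
  proof (cases "i < p")
    case True
    then have "j < p" using \<sigma>A[of i] \<sigma>B[of j] that by (auto simp: A_def B_def)
    then show ?thesis using True that f by (auto simp: \<sigma>_def bij_betw_def inj_on_def)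
  next
    case False
    then have jp: "\<not> j < p" using \<sigma>A[of j] \<sigma>B[of i] that by (auto simp: A_def B_def)
    then have "i - p = j - p" using False that g pq by (auto simp: \<sigma>_def bij_betw_def inj_on_def)
    then show ?thesis using False jp by simp
  qed
  define M where "M = mat r r (\<lambda>(i, j). if j = \<sigma> i then of_real (1 / sqrt \<bar>c j\<bar>) else (0 :: 'a))"
  have Mc: "M \<in> carrier_mat r r" by (simp add: M_def)
  have MDM: "M * D * adj M = I_pq p q"
  proof (rule eq_matI)
    fix i j assume "i < dim_row (I_pq p q :: 'a mat)" "j < dim_col (I_pq p q :: 'a mat)"
    then have ij: "i < r" "j < r" using pq by (auto simp: I_pq_eq_diag_fn diag_fn_def)
    have "(M * D * adj M) $$ (i, j) = (\<Sum>m<r. M $$ (i, m) * of_real (c m) * cj (M $$ (j, m)))"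
      unfolding Ddg using Mc ij by (intro diag_fn_form_index) auto
    also have "\<dots> = (\<Sum>m<r. if m = \<sigma> i then if i = j then of_real (c m / \<bar>c m\<bar>) else 0 else 0)"
    proof (intro sum.cong refl)
      fix m assume m: "m \<in> {..<r}"
      have "1 / sqrt \<bar>c m\<bar> * c m * (1 / sqrt \<bar>c m\<bar>) = c m / \<bar>c m\<bar>"
        using c0[of m] m by (simp add: field_simps)
      then have "of_real (1 / sqrt \<bar>c m\<bar>) * of_real (c m) * of_real (1 / sqrt \<bar>c m\<bar>) = (of_real (c m / \<bar>c m\<bar>) :: 'a)"
        by (metis of_real_mult)
      then show "M $$ (i, m) * of_real (c m) * cj (M $$ (j, m)) = (if m = \<sigma> i then if i = j then of_real (c m / \<bar>c m\<bar>) else 0 else 0)"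
        using m ij \<sigma>inj[of i j] by (auto simp: M_def simp del: of_real_divide)
    qed
    also have "\<dots> = (if i = j then of_real (c (\<sigma> i) / \<bar>c (\<sigma> i)\<bar>) else 0)" using \<sigma>r[OF ij(1)] by simp
    also have "\<dots> = I_pq p q $$ (i, j)"
    proof -
      have "c (\<sigma> i) / \<bar>c (\<sigma> i)\<bar> = (if i < p then 1 else - 1)"
        using \<sigma>A[of i] \<sigma>B[of i] ij c0[OF \<sigma>r[OF ij(1)]] by (auto simp: A_def B_def)
      then have "(of_real (c (\<sigma> i) / \<bar>c (\<sigma> i)\<bar>) :: 'a) = (if i < p then 1 else - 1)"
        by (simp only: of_real_1 of_real_minus split: if_split) simp
      moreover have "I_pq p q $$ (i, j) = (if i = j then if i < p then 1 else - 1 else (0 :: 'a))"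
        using ij pq by (simp add: I_pq_eq_diag_fn diag_fn_def)
      ultimately show ?thesis by (simp only:)
    qed
    finally show "(M * D * adj M) $$ (i, j) = I_pq p q $$ (i, j)" .
  qed (use Mc pq in \<open>auto simp: I_pq_eq_diag_fn diag_fn_def\<close>)
  have Ic: "(I_pq p q :: 'a mat) \<in> carrier_mat r r" "I_pq p q * I_pq p q = (1\<^sub>m r :: 'a mat)" using pq I_pq_mult_self by auto
  \<comment> \<open>As \<open>I_pq p q\<close> is its own inverse, the identity \<open>MDM\<close>
    already exhibits a right inverse of \<open>M\<close>.\<close>
  have "M * (D * adj M * I_pq p q) = 1\<^sub>m r"
    using arg_cong[OF MDM, of "\<lambda>X. X * I_pq p q"] Ic Mc Dc by (simp add: mat_assoc)
  then have "(D * adj M * I_pq p q) * M = 1\<^sub>m r"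
    by (intro mat_mult_left_right_inverse[OF Mc]) (use Ic Mc Dc in auto)
  then have MG: "M \<in> GLm r" using Mc Dc Ic by (intro GLm_leftI(1)[of M r "D * adj M * I_pq p q"]) auto
  then have "M * h \<in> GLm r" using h GLm_mult by blast
  then obtain u where u: "u \<in> GLm r" "u * (M * h) = 1\<^sub>m r" by (metis GLmE)
  note uc = GLm_carrier[OF u(1)]
  have "I_pq p q = (M * h) * T * adj (M * h)" using MDM form_comp[OF hc Mc Tc] unfolding D_def by simp
  then have "u * I_pq p q * adj u = (u * (M * h)) * T * adj (u * (M * h))"
    using form_comp[of "M * h" r u T] uc Mc hc Tc by simp
  also have "\<dots> = T" using u Tc by (simp add: mat_one_left mat_one_right)
  finally have "T = u * I_pq p q * adj u" by simp
  then show ?thesis using pq u by blast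
qed

end

section \<open>Forms supported on a set of coordinates\<close>

text \<open>The isometric inclusion of the coordinates in \<open>K\<close>. The columns follow the
  increasing enumeration of \<open>K\<close>; this is what lets triangular matrices be restricted to
  \<open>K\<close> and extended from it.\<close>

definition emb :: "nat \<Rightarrow> nat set \<Rightarrow> 'a::field mat" where
  "emb n K = mat n (card K) (\<lambda>(i, a). if i = enumerate K a then 1 else 0)"

lemma emb_carrier [simp]: "emb n K \<in> carrier_mat n (card K)"
  by (simp add: emb_def)

lemma emb_dim [simp]: "dim_row (emb n K) = n" "dim_col (emb n K) = card K"
  by (simp_all add: emb_def)

lemma enumerate_lt:
  fixes n :: nat
  assumes "K \<subseteq> {..<n}" "a < card K"
  shows "enumerate K a < n"
proof -
  have "finite K" using assms(1) finite_subset by blast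
  then show ?thesis using finite_enumerate_in_set[of K a] assms by auto
qed

lemma mult_emb_index:
  assumes M: "M \<in> carrier_mat k n" and K: "K \<subseteq> {..<n}" and ia: "i < k" "a < card K"
  shows "(M * emb n K) $$ (i, a) = M $$ (i, enumerate K a)"
proof -
  have fin: "finite K" using K finite_subset by blast
  have "enumerate K a < n" using finite_enumerate_in_set[OF fin ia(2)] K by auto
  have "(M * emb n K) $$ (i, a) = (\<Sum>j<n. M $$ (i, j) * emb n K $$ (j, a))"
    using M ia by (subst mult_mat_index) (auto simp: emb_def)
  also have "\<dots> = (\<Sum>j<n. if j = enumerate K a then M $$ (i, j) else 0)"
    using ia by (intro sum.cong refl) (auto simp: emb_def)
  finally show ?thesis using \<open>enumerate K a < n\<close> by simp
qed

context conj_field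
begin

lemma adj_emb_mult_index:
  assumes M: "M \<in> carrier_mat n k" and K: "K \<subseteq> {..<n}" and ai: "i < k" "a < card K"
  shows "(adj (emb n K) * M) $$ (a, i) = M $$ (enumerate K a, i)"
proof -
  have fin: "finite K" using K finite_subset by blast
  have "enumerate K a < n" using finite_enumerate_in_set[OF fin ai(2)] K by auto
  have "(adj (emb n K) * M) $$ (a, i) = (\<Sum>j<n. adj (emb n K) $$ (a, j) * M $$ (j, i))"
    using M ai by (subst mult_mat_index) (auto simp: emb_def)
  also have "\<dots> = (\<Sum>j<n. if j = enumerate K a then M $$ (j, i) else 0)"
    using ai by (intro sum.cong refl) (auto simp: emb_def adj_index)
  finally show ?thesis using \<open>enumerate K a < n\<close> by simp
qed

lemma adj_emb_mult_emb:
  assumes K: "K \<subseteq> {..<n}"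
  shows "adj (emb n K) * emb n K = 1\<^sub>m (card K)"
proof (rule eq_matI)
  fix a b assume "a < dim_row (1\<^sub>m (card K) :: 'a mat)" "b < dim_col (1\<^sub>m (card K) :: 'a mat)"
  then have ab: "a < card K" "b < card K" by auto
  have fin: "finite K" using K finite_subset by blast
  have "(adj (emb n K) * emb n K) $$ (a, b) = (emb n K :: 'a mat) $$ (enumerate K a, b)"
    using adj_emb_mult_index[OF emb_carrier K] ab by simp
  also have "\<dots> = (if enumerate K a = enumerate K b then 1 else 0)"
    using ab enumerate_lt[OF K] by (simp add: emb_def)
  also have "enumerate K a = enumerate K b \<longleftrightarrow> a = b"
    using finite_enum_ext[OF _ _ fin] finite_bij_enumerate[OF fin] ab by (auto simp: bij_betw_def inj_on_def)
  finally show "(adj (emb n K) * emb n K) $$ (a, b) = 1\<^sub>m (card K) $$ (a, b)" using ab by simp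
qed (auto simp: emb_def)

lemma emb_mult_adj_emb:
  assumes K: "K \<subseteq> {..<n}"
  shows "emb n K * adj (emb n K) = diag_proj n K"
proof (rule eq_matI)
  fix i j assume "i < dim_row (diag_proj n K :: 'a mat)" "j < dim_col (diag_proj n K :: 'a mat)"
  then have ij: "i < n" "j < n" by auto
  have fin: "finite K" using K finite_subset by blast
  note bij = finite_bij_enumerate[OF fin]
  have "(emb n K * adj (emb n K)) $$ (i, j) = (\<Sum>a<card K. (emb n K :: 'a mat) $$ (i, a) * adj (emb n K) $$ (a, j))"
    using ij by (subst mult_mat_index) (auto simp: emb_def)
  also have "\<dots> = (\<Sum>a<card K. if enumerate K a = i \<and> i = j then 1 else 0)"
    using ij by (intro sum.cong refl) (auto simp: emb_def adj_index)
  also have "\<dots> = (\<Sum>l\<in>K. if l = i \<and> i = j then 1 else 0)"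
    using bij by (intro sum.reindex_bij_betw[of "enumerate K"])
  also have "\<dots> = (if i = j \<and> i \<in> K then 1 else 0)"
    using fin by (cases "i = j") auto
  finally show "(emb n K * adj (emb n K)) $$ (i, j) = diag_proj n K $$ (i, j)"
    using ij by (simp add: diag_proj_index)
qed (auto simp: emb_def)

lemma diag_proj_mult_emb:
  assumes K: "K \<subseteq> {..<n}" and KI: "K \<subseteq> I"
  shows "diag_proj n I * emb n K = (emb n K :: 'a mat)"
proof -
  have "diag_proj n I * emb n K = (diag_proj n I * diag_proj n K) * (emb n K :: 'a mat)"
    unfolding emb_mult_adj_emb[OF K, symmetric] using adj_emb_mult_emb[OF K] emb_carrier[of n K, where 'a='a]
    by (simp add: mat_assoc mat_one_right)
  also have "\<dots> = diag_proj n K * emb n K"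
    using KI by (simp add: diag_proj_mult_diag_proj Int_absorb1)
  also have "\<dots> = emb n K"
    unfolding emb_mult_adj_emb[OF K, symmetric] using adj_emb_mult_emb[OF K] emb_carrier[of n K, where 'a='a]
    by (simp add: mat_assoc mat_one_right)
  finally show ?thesis .
qed

definition form_at :: "nat \<Rightarrow> nat set \<Rightarrow> 'a mat \<Rightarrow> 'a mat" where
  "form_at n K T = emb n K * T * adj (emb n K)"

lemma form_at_dim [simp]: "dim_row (form_at n K T) = n" "dim_col (form_at n K T) = n"
  by (simp_all add: form_at_def)

lemma form_at_carrier [simp]: "form_at n K T \<in> carrier_mat n n"
  by (rule carrier_matI) simp_all

context
  fixes n :: nat and K :: "nat set"
  assumes K: "K \<subseteq> {..<n}"
begin

private definition P :: "'a mat" where "P = emb n K"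

private lemma P: "P \<in> carrier_mat n (card K)" "adj P \<in> carrier_mat (card K) n" "adj P * P = 1\<^sub>m (card K)"
  "P * adj P = diag_proj n K"
  using adj_emb_mult_emb[OF K] emb_mult_adj_emb[OF K] by (auto simp: P_def)

private lemma P_cancel: "dim_row X = card K \<Longrightarrow> adj P * (P * X) = X"
  by (rule mat_cancel[OF P(3,2,1) carrier_matI[OF _ refl]])

private lemma proj_P: "diag_proj n K * P = P"
  unfolding P_def by (rule diag_proj_mult_emb[OF K order_refl])

private lemma form_at_P: "form_at n K T = P * T * adj P"
  by (simp add: form_at_def P_def)

lemma herm_on_form_at:
  assumes KI: "K \<subseteq> I" and T: "T \<in> carrier_mat (card K) (card K)" "adj T = T"
  shows "herm_on n I (form_at n K T)"
  unfolding herm_on_def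
proof (intro conjI)
  show "adj (form_at n K T) = form_at n K T"
    unfolding form_at_P using P(1) T by (simp add: adj_mult mat_assoc)
  have "diag_proj n I * (P * T * adj P) = (diag_proj n I * P) * T * adj P"
    using P(1) T(1) by (simp add: mat_assoc)
  also have "diag_proj n I * P = P" unfolding P_def by (rule diag_proj_mult_emb[OF K KI])
  finally show "diag_proj n I * form_at n K T = form_at n K T" unfolding form_at_P .
qed simp

lemma form_at_restrict:
  assumes "T \<in> carrier_mat (card K) (card K)"
  shows "adj (emb n K) * form_at n K T * emb n K = T"
proof -
  have "adj P * (P * T * adj P) * P = (adj P * P) * T * (adj P * P)"
    using P(1) assms by (simp add: mat_assoc)
  then show ?thesis using assms unfolding form_at_P P_def[symmetric] by (simp add: P(3))
qed

text \<open>Non-degeneracy of \<open>T\<close> in terms of matrices of size \<open>n\<close>, from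
  which \<open>K\<close> can be recovered. The witness is the inverse of \<open>T\<close>, extended
  by zero.\<close>

lemma form_at_pseudo_inverse:
  assumes "T \<in> GLm (card K)"
  obtains U where "U \<in> carrier_mat n n" "form_at n K T * U = diag_proj n K"
    "diag_proj n K * form_at n K T = form_at n K T"
proof -
  obtain T' where T': "T' \<in> GLm (card K)" "T * T' = 1\<^sub>m (card K)" using assms by (rule GLmE)
  note c = assms[THEN GLm_carrier] T'(1)[THEN GLm_carrier]
  have "form_at n K T * (P * T' * adj P) = P * (T * (adj P * (P * (T' * adj P))))"
    unfolding form_at_P using P(1) c by (simp add: mat_assoc)
  also have "\<dots> = P * (T * (T' * adj P))" using c by (simp add: P_cancel)
  also have "\<dots> = P * ((T * T') * adj P)" using P(1) c by (simp add: mat_assoc)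
  also have "\<dots> = diag_proj n K" unfolding T'(2) using P(1,4) by (simp add: mat_one_left)
  finally have "form_at n K T * (P * T' * adj P) = diag_proj n K" .
  moreover have "P * T' * adj P \<in> carrier_mat n n" using P(1) by (intro carrier_matI) auto
  moreover have "diag_proj n K * form_at n K T = (diag_proj n K * P) * T * adj P"
    unfolding form_at_P using P(1) c by (simp add: mat_assoc)
  then have "diag_proj n K * form_at n K T = form_at n K T"
    unfolding proj_P form_at_P .
  ultimately show ?thesis using that by blast
qed

text \<open>The restriction is the submatrix on rows and columns in \<open>K\<close>, and the
  increasing enumeration sends entries below the diagonal to entries below the diagonal.\<close>

lemma restrict_Bk:
  assumes z: "z \<in> Bk n"
  shows "adj (emb n K) * z * emb n K \<in> Bk (card K)"
proof -
  note zc = Bk_carrier[OF z]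
  have fin: "finite K" using K finite_subset by blast
  have ix: "(adj (emb n K) * z * emb n K) $$ (a, b) = z $$ (enumerate K a, enumerate K b)"
    if "a < card K" "b < card K" for a b
  proof -
    have "adj (emb n K) * z \<in> carrier_mat (card K) n" using zc by (intro carrier_matI) (auto simp: emb_def)
    then have "(adj (emb n K) * z * emb n K) $$ (a, b) = (adj (emb n K) * z) $$ (a, enumerate K b)"
      using mult_emb_index[OF _ K] that by blast
    also have "\<dots> = z $$ (enumerate K a, enumerate K b)"
      using adj_emb_mult_index[OF zc K] enumerate_lt[OF K] that by blast
    finally show ?thesis .
  qed
  show ?thesis
    unfolding Bk_iff
    using ix z enumerate_lt[OF K] finite_enumerate_mono[OF _ fin] unfolding Bk_iff
    by (auto simp: emb_def)
qed

lemma extend_Bk: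
  assumes b: "b \<in> Bk (card K)"
  shows "emb n K * b * adj (emb n K) + diag_proj n (- K) \<in> Bk n"
proof -
  note bc = Bk_carrier[OF b]
  let ?X = "P * b * adj P"
  have fin: "finite K" using K finite_subset by blast
  have Xc: "?X \<in> carrier_mat n n" using P(1) by (intro carrier_matI) auto
  \<comment> \<open>\<open>?X\<close> is \<open>form_at n K b\<close>, and
    \<open>form_at_restrict\<close> applies to it although \<open>b\<close> is not
    Hermitian.\<close>
  have Xr: "adj P * ?X * P = b" using form_at_restrict[OF bc] unfolding form_at_P P_def .
  have X_in: "?X $$ (enumerate K a, enumerate K c) = b $$ (a, c)" if "a < card K" "c < card K" for a c
  proof -
    have "adj P * ?X \<in> carrier_mat (card K) n" using P(1) by (intro carrier_matI) auto
    then have "(adj P * ?X * P) $$ (a, c) = (adj P * ?X) $$ (a, enumerate K c)"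
      unfolding P_def using mult_emb_index[OF _ K] that by blast
    also have "\<dots> = ?X $$ (enumerate K a, enumerate K c)"
      using adj_emb_mult_index[OF Xc K] enumerate_lt[OF K] that unfolding P_def by blast
    finally show ?thesis using Xr by simp
  qed
  have EX: "diag_proj n K * ?X = ?X"
  proof -
    have "diag_proj n K * ?X = (diag_proj n K * P) * b * adj P" using P(1) bc by (simp add: mat_assoc)
    then show ?thesis unfolding proj_P .
  qed
  have XE: "?X * diag_proj n K = ?X"
  proof -
    have "adj P * diag_proj n K = adj P"
      using arg_cong[OF proj_P, of adj] P(1) by (simp add: adj_mult)
    then show ?thesis using P(1) bc by (simp add: mat_assoc)
  qed
  have X_out: "?X $$ (i, j) = 0" if "i < n" "j < n" "i \<notin> K \<or> j \<notin> K" for i j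
    using that diag_proj_mult_index[of ?X n i j K] mult_diag_proj_index[of ?X n j i K] Xc EX XE
    by (auto simp del: index_mult_mat(1))
  have surj: "\<exists>a<card K. i = enumerate K a" if "i \<in> K" for i
    using finite_bij_enumerate[OF fin] that by (auto simp: bij_betw_def)
  have Z: "(?X + diag_proj n (- K)) $$ (i, j) = ?X $$ (i, j) + (if i = j \<and> i \<notin> K then 1 else 0)"
    if "i < n" "j < n" for i j
    using that by (simp add: diag_proj_index del: index_mult_mat(1))
  have "(?X + diag_proj n (- K)) $$ (i, j) = 0" if ij: "i < n" "j < i" for i j
  proof (cases "i \<in> K \<and> j \<in> K")
    case True
    then obtain a c where a: "a < card K" "i = enumerate K a" "c < card K" "j = enumerate K c" using surj by metis
    have "c < a"
    proof (rule ccontr)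
      assume "\<not> c < a"
      then have "enumerate K a \<le> enumerate K c"
        using finite_enumerate_mono[OF _ fin a(3), of a] by (cases "a = c") auto
      then show False using a ij by simp
    qed
    then have "?X $$ (i, j) = 0" using X_in a b unfolding Bk_iff by auto
    then show ?thesis using Z[of i j] ij by simp
  next
    case False
    then show ?thesis using Z[of i j] X_out[of i j] ij by auto
  qed
  moreover have "(?X + diag_proj n (- K)) $$ (i, i) \<noteq> 0" if i: "i < n" for i
  proof (cases "i \<in> K")
    case True
    then obtain a where a: "a < card K" "i = enumerate K a" using surj by metis
    then have "?X $$ (i, i) \<noteq> 0" using X_in[of a a] b unfolding Bk_iff by auto
    then show ?thesis using Z[of i i] i True by simp
  next
    case False
    then show ?thesis using Z[of i i] X_out[of i i] i by auto
  qed
  moreover have "?X + diag_proj n (- K) \<in> carrier_mat n n" using Xc by simp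
  ultimately show ?thesis unfolding Bk_iff P_def by blast
qed

text \<open>A triangular congruence of the small forms lifts to \<open>b\<close> on \<open>K\<close>
  completed by the identity. Since \<open>K\<close> lies in \<open>I\<close>, the lift is the
  identity outside \<open>I\<close>, as \<open>model_rel_congruent\<close> demands.\<close>

lemma form_at_congruent:
  assumes KI: "K \<subseteq> I" and b: "b \<in> Bk (card K)" and T: "T \<in> carrier_mat (card K) (card K)"
  shows "\<exists>\<beta>\<in>Bk n. \<beta> * diag_proj n (- I) = diag_proj n (- I) \<and> diag_proj n (- I) * \<beta> = diag_proj n (- I) \<and>
    form_at n K (b * T * adj b) = \<beta> * form_at n K T * adj \<beta>"
proof -
  note bc = Bk_carrier[OF b]
  define N where "N = (diag_proj n (- K) :: 'a mat)"
  define \<beta> where "\<beta> = P * b * adj P + N"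
  have Nc: "N \<in> carrier_mat n n" "adj N = N" by (auto simp: N_def)
  have \<beta>: "\<beta> \<in> Bk n" unfolding \<beta>_def N_def using extend_Bk[OF b] unfolding P_def .
  note \<beta>c = Bk_carrier[OF \<beta>]
  have "N * P = N * (diag_proj n K * P)" unfolding proj_P ..
  also have "\<dots> = (N * diag_proj n K) * P" using Nc P(1) by (simp add: mat_assoc)
  also have "\<dots> = 0\<^sub>m n (card K)" using P(1) by (simp add: N_def diag_proj_simps)
  finally have NP: "N * P = 0\<^sub>m n (card K)" .
  have PN: "adj P * N = 0\<^sub>m (card K) n"
    using arg_cong[OF NP, of adj] Nc P(1) by (simp add: adj_mult)
  have IN: "N * diag_proj n (- I) = diag_proj n (- I)" "diag_proj n (- I) * N = diag_proj n (- I)"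
    using KI by (simp_all add: N_def diag_proj_mult_diag_proj Int_absorb1 Int_absorb2)
  have PI: "adj P * diag_proj n (- I) = 0\<^sub>m (card K) n"
  proof -
    have "adj P * diag_proj n (- I) = (adj P * N) * diag_proj n (- I)"
      using IN Nc P(1) by (simp add: mat_assoc)
    then show ?thesis unfolding PN by simp
  qed
  have IP: "diag_proj n (- I) * P = 0\<^sub>m n (card K)"
    using arg_cong[OF PI, of adj] P(1) by (simp add: adj_mult)
  have "\<beta> * diag_proj n (- I) = P * b * (adj P * diag_proj n (- I)) + N * diag_proj n (- I)"
    unfolding \<beta>_def using P(1) bc Nc(1) by (simp add: mat_assoc mat_distr_left)
  then have 1: "\<beta> * diag_proj n (- I) = diag_proj n (- I)"
    unfolding PI IN using P(1) bc by simp
  have "diag_proj n (- I) * \<beta> = (diag_proj n (- I) * P) * b * adj P + diag_proj n (- I) * N"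
    unfolding \<beta>_def using P(1) bc Nc(1) by (simp add: mat_assoc mat_distr_right)
  then have 2: "diag_proj n (- I) * \<beta> = diag_proj n (- I)"
    unfolding IP IN using P(1) bc by simp
  have "\<beta> * P = P * b * (adj P * P) + N * P"
    unfolding \<beta>_def using P(1) bc Nc(1) by (simp add: mat_assoc mat_distr_left)
  then have \<beta>P: "\<beta> * P = P * b" unfolding NP P(3) using P(1) bc by (simp add: mat_one_right)
  have P\<beta>: "adj P * adj \<beta> = adj b * adj P"
    using arg_cong[OF \<beta>P, of adj] P(1) bc \<beta>c by (simp add: adj_mult)
  have "\<beta> * form_at n K T * adj \<beta> = (\<beta> * P) * T * (adj P * adj \<beta>)"
    unfolding form_at_P using P(1) T \<beta>c by (simp add: mat_assoc)
  also have "\<dots> = form_at n K (b * T * adj b)"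
    unfolding \<beta>P P\<beta> form_at_P using P(1) T bc by (simp add: mat_assoc)
  finally show ?thesis using \<beta> 1 2 by metis
qed

end

text \<open>Multiplying by the pseudo-inverse \<open>U\<close> turns the equation into one between
  coordinate projections, to which \<open>diag_proj_triangular_subset\<close> applies.\<close>

lemma form_at_congruent_subset:
  assumes K: "K \<subseteq> {..<n}" "K' \<subseteq> {..<n}" and T: "T \<in> GLm (card K)" "T' \<in> GLm (card K')"
    and z: "z \<in> Bk n" and e: "z * form_at n K T = form_at n K' T' * w" and w: "w \<in> carrier_mat n n"
  shows "K \<subseteq> K'"
proof -
  obtain U where U: "U \<in> carrier_mat n n" "form_at n K T * U = diag_proj n K"
    using form_at_pseudo_inverse[OF K(1) T(1)] by metis
  have E: "diag_proj n K' * form_at n K' T' = form_at n K' T'"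
    using form_at_pseudo_inverse[OF K(2) T(2)] by metis
  note c = Bk_carrier[OF z]
  have "z * diag_proj n K = (z * form_at n K T) * U" unfolding U(2)[symmetric] using c U(1) by (simp add: mat_assoc)
  also have "\<dots> = (diag_proj n K' * form_at n K' T') * w * U" unfolding e E ..
  also have "\<dots> = diag_proj n K' * (form_at n K' T' * w * U)" using c U(1) w by (simp add: mat_assoc)
  finally have "z * diag_proj n K = diag_proj n K' * (form_at n K' T' * w * U)" .
  then show ?thesis
    by (rule diag_proj_triangular_subset) (use c U(1) w z K in \<open>auto simp: Bk_iff intro!: carrier_matI\<close>)
qed

text \<open>The two inclusions come from \<open>z\<close> and from its inverse. Once the sets agree,
  compressing the equation by \<open>emb n K\<close> sees only the block of \<open>z\<close> on
  \<open>K\<close>, because the forms themselves factor through \<open>emb n K\<close>.\<close>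

lemma form_at_congruentD:
  assumes K: "K \<subseteq> {..<n}" "K' \<subseteq> {..<n}" and T: "T \<in> GLm (card K)" "T' \<in> GLm (card K')"
    and z: "z \<in> Bk n" and e: "form_at n K' T' = z * form_at n K T * adj z"
  shows "K' = K \<and> (\<exists>b\<in>Bk (card K). T' = b * T * adj b)"
proof -
  obtain y where y: "y \<in> Bk n" "z * y = 1\<^sub>m n" "y * z = 1\<^sub>m n" using z by (rule BkE)
  note c = Bk_carrier[OF z] Bk_carrier[OF y(1)]
  have yz: "adj z * adj y = 1\<^sub>m n" using arg_cong[OF y(3), of adj] c by (simp add: adj_mult)
  have "y * form_at n K' T' = (y * z) * (form_at n K T * adj z)" unfolding e using c by (simp add: mat_assoc)
  then have "y * form_at n K' T' = form_at n K T * adj z" using y c by (simp add: mat_one_left)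
  then have 1: "K' \<subseteq> K" by (rule form_at_congruent_subset[OF K(2,1) T(2,1) y(1)]) (use c in simp)
  have "form_at n K' T' * adj y = z * form_at n K T * (adj z * adj y)" unfolding e using c by (simp add: mat_assoc)
  then have "z * form_at n K T = form_at n K' T' * adj y" unfolding yz using c by (simp add: mat_one_right)
  then have 2: "K \<subseteq> K'" by (rule form_at_congruent_subset[OF K T z]) (use c in simp)
  have eq: "K' = K" using 1 2 by blast
  let ?P = "emb n K :: 'a mat"
  note Tc = T[THEN GLm_carrier, unfolded eq]
  have Pc: "?P \<in> carrier_mat n (card K)" by simp
  have "T' = adj ?P * form_at n K T' * ?P" using form_at_restrict[OF K(1) Tc(2)] by simp
  also have "\<dots> = (adj ?P * z * ?P) * T * (adj ?P * adj z * ?P)"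
    using c Pc Tc e unfolding eq by (simp add: form_at_def mat_assoc)
  also have "adj ?P * adj z * ?P = adj (adj ?P * z * ?P)"
    using c Pc by (simp add: adj_mult mat_assoc)
  finally show ?thesis using eq restrict_Bk[OF K(1) z] by blast
qed

text \<open>Compressing the elimination matrix \<open>c\<close> to \<open>I\<close> cuts the pivot
  set down to \<open>I \<inter> K0\<close>. Then \<open>\<beta> * S\<close> has no rows outside
  \<open>K\<close>, nor has \<open>\<beta> * S * adj \<beta>\<close>, which is Hermitian and so
  lives on \<open>K\<close> on both sides.\<close>

lemma herm_on_reduce:
  assumes S: "herm_on n I S" and I: "I \<subseteq> {..<n}"
  shows "\<exists>K T \<beta>. K \<subseteq> I \<and> T \<in> GLm (card K) \<and> adj T = T \<and> \<beta> \<in> Bk n \<and>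
    \<beta> * diag_proj n (- I) = diag_proj n (- I) \<and> diag_proj n (- I) * \<beta> = diag_proj n (- I) \<and>
    \<beta> * S * adj \<beta> = form_at n K T"
proof -
  define E :: "'a mat" where "E = diag_proj n I"
  define N :: "'a mat" where "N = diag_proj n (- I)"
  have Ec: "E \<in> carrier_mat n n" "N \<in> carrier_mat n n" "E * N = 0\<^sub>m n n" "N * E = 0\<^sub>m n n" "N * N = N"
    by (auto simp: E_def N_def diag_proj_simps)
  note HS = herm_onD[OF S, folded E_def N_def]
  obtain c x K0 where c: "c \<in> Bk n" and x: "x \<in> GLm n" and e: "c * S * x = diag_proj n K0"
    using echelon_upper[OF HS(1)] by blast
  note cc = Bk_carrier[OF c] and xc = GLm_carrier[OF x]
  define \<beta> where "\<beta> = E * c * E + N"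
  have \<beta>: "\<beta> \<in> Bk n" unfolding \<beta>_def E_def N_def by (rule diag_proj_Bk[OF c])
  note \<beta>c = Bk_carrier[OF \<beta>]
  define K where "K = I \<inter> K0"
  have K: "K \<subseteq> I" "K \<subseteq> {..<n}" using I by (auto simp: K_def)
  have "\<beta> * N = E * c * (E * N) + N * N" "N * \<beta> = (N * E) * c * E + N * N"
    unfolding \<beta>_def using Ec(1,2) cc by (simp_all add: mat_simps)
  then have \<beta>N: "\<beta> * N = N" "N * \<beta> = N" using Ec cc by simp_all
  have "\<beta> * S = E * c * (E * S) + N * S" unfolding \<beta>_def using Ec(1,2) cc HS(1) by (simp add: mat_simps)
  then have "\<beta> * S = E * (c * S)" using HS Ec cc by (simp add: mat_assoc)
  then have "\<beta> * S * x = E * (c * S * x)" using HS(1) Ec(1) cc xc by (simp add: mat_assoc)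
  then have \<beta>Sx: "\<beta> * S * x = diag_proj n K" unfolding e E_def K_def by (simp add: diag_proj_mult_diag_proj)
  obtain x' where x': "x' \<in> GLm n" "x * x' = 1\<^sub>m n" using x by (rule GLmE)
  note xc' = GLm_carrier[OF x'(1)]
  obtain y where y: "y \<in> Bk n" "y * \<beta> = 1\<^sub>m n" using \<beta> by (metis BkE)
  note yc = Bk_carrier[OF y(1)]
  define S1 where "S1 = \<beta> * S * adj \<beta>"
  have S1c: "S1 \<in> carrier_mat n n" using \<beta>c HS(1) by (intro carrier_matI) (simp_all add: S1_def)
  have S1h: "adj S1 = S1" unfolding S1_def by (rule adj_form[OF HS(2) \<beta>c HS(1)])
  have "\<beta> * S = \<beta> * S * (x * x')" using x' \<beta>c HS(1) by (simp add: mat_one_right)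
  also have "\<dots> = diag_proj n K * x'" unfolding \<beta>Sx[symmetric] using \<beta>c HS(1) xc xc' by (simp add: mat_assoc)
  finally have "\<beta> * S = diag_proj n K * x'" .
  then have "S1 = diag_proj n K * (x' * adj \<beta>)" unfolding S1_def using xc' \<beta>c by (simp add: mat_assoc)
  then have "diag_proj n K * S1 = diag_proj n K * diag_proj n K * (x' * adj \<beta>)"
    using xc' \<beta>c by (simp add: mat_assoc)
  then have l: "diag_proj n K * S1 = S1"
    using \<open>S1 = diag_proj n K * (x' * adj \<beta>)\<close> by (simp add: diag_proj_simps)
  have r: "S1 * diag_proj n K = S1" using arg_cong[OF l, of adj] S1h S1c by (simp add: adj_mult)
  \<comment> \<open>\<open>M\<close> undoes the factor \<open>adj \<beta>\<close> and then applies
    the column operations, so that \<open>S1 * M\<close> is the projection onto \<open>K\<close>.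
    Its restriction to \<open>K\<close> is an inverse of \<open>T\<close>.\<close>
  define M where "M = adj y * x"
  have Mc: "M \<in> carrier_mat n n" unfolding M_def by (rule mult_carrier_mat[OF adj_carrier[OF yc] xc])
  have "adj \<beta> * adj y = 1\<^sub>m n" using arg_cong[OF y(2), of adj] yc \<beta>c by (simp add: adj_mult)
  moreover have "S1 * M = \<beta> * S * ((adj \<beta> * adj y) * x)"
    unfolding S1_def M_def using \<beta>c yc xc HS(1) by (simp add: mat_assoc)
  ultimately have SM: "S1 * M = diag_proj n K" using \<beta>Sx xc by (simp add: mat_one_left)
  let ?P = "emb n K :: 'a mat"
  have Pc: "?P \<in> carrier_mat n (card K)" by simp
  have PP: "adj ?P * ?P = 1\<^sub>m (card K)" "?P * adj ?P = diag_proj n K"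
    using adj_emb_mult_emb[OF K(2)] emb_mult_adj_emb[OF K(2)] by auto
  define T where "T = adj ?P * S1 * ?P"
  have Tc: "T \<in> carrier_mat (card K) (card K)" using Pc by (intro carrier_matI) (auto simp: T_def)
  have "form_at n K T = (?P * adj ?P) * S1 * (?P * adj ?P)"
    unfolding form_at_def T_def using Pc S1c by (simp add: mat_assoc)
  then have fT: "form_at n K T = S1" unfolding PP using l r by simp
  have Th: "adj T = T" unfolding T_def using Pc S1c S1h by (simp add: adj_mult mat_assoc)
  have "T * (adj ?P * M * ?P) = adj ?P * ((S1 * (?P * adj ?P)) * M) * ?P"
    unfolding T_def using Pc S1c Mc by (simp add: mat_assoc)
  also have "\<dots> = adj ?P * (?P * adj ?P) * ?P" unfolding PP r SM ..
  also have "\<dots> = (adj ?P * ?P) * (adj ?P * ?P)" using Pc by (simp add: mat_assoc)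
  also have "\<dots> = 1\<^sub>m (card K)" unfolding PP by simp
  finally have TM: "T * (adj ?P * M * ?P) = 1\<^sub>m (card K)" .
  have Rc: "adj ?P * M * ?P \<in> carrier_mat (card K) (card K)" using Pc by (intro carrier_matI) auto
  have "T \<in> GLm (card K)"
    using GLm_leftI(1)[OF Tc Rc] mat_mult_left_right_inverse[OF Tc Rc TM] by blast
  then show ?thesis using K(1) Th \<beta> \<beta>N fT unfolding N_def S1_def by metis
qed

end

section \<open>The orbit bijections\<close>

text \<open>Matrix indices start at 0, whereas \<open>coprod_index\<close> uses subsets of \<open>{1..n}\<close>.\<close>

definition shift_down :: "nat set \<Rightarrow> nat set" where
  "shift_down I = {i. Suc i \<in> I}"

lemma shift_down:
  assumes "I \<subseteq> {1..n}"
  shows "I = Suc ` shift_down I" "shift_down I \<subseteq> {..<n}" "card (shift_down I) = card I"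
proof -
  show eq: "I = Suc ` shift_down I"
  proof
    show "I \<subseteq> Suc ` shift_down I"
    proof
      fix i assume "i \<in> I"
      moreover from this obtain j where "i = Suc j" using assms by (cases i) auto
      ultimately show "i \<in> Suc ` shift_down I" by (auto simp: shift_down_def)
    qed
  qed (auto simp: shift_down_def)
  show "shift_down I \<subseteq> {..<n}" using assms by (auto simp: shift_down_def)
  have "card (Suc ` shift_down I) = card (shift_down I)" by (rule card_image) simp
  then show "card (shift_down I) = card I" using eq by simp
qed

text \<open>Any bijection will do: \<open>J\<close> only counts the possible subsets of
  \<open>I\<close>, and no order is carried over.\<close>

definition slot :: "nat set \<Rightarrow> nat \<Rightarrow> nat" where
  "slot A = (SOME f. bij_betw f {1..card A} A)"

lemma slot: "finite A \<Longrightarrow> bij_betw (slot A) {1..card A} A"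
  unfolding slot_def by (rule someI_ex[OF ex_bij_betw_nat_finite_1])

text \<open>The coordinates in \<open>I\<close> that carry the non-degenerate part of the form; they
  span a complement of its kernel.\<close>

definition kernel_compl :: "nat set \<Rightarrow> nat set \<Rightarrow> nat set" where
  "kernel_compl I J = slot (shift_down I) ` J"

lemma kernel_compl:
  assumes I: "I \<subseteq> {1..n}" and J: "J \<subseteq> {1..card I}"
  shows "kernel_compl I J \<subseteq> shift_down I" "card (kernel_compl I J) = card J"
proof -
  have "finite (shift_down I)" using shift_down(2)[OF I] finite_subset by blast
  then have bij: "bij_betw (slot (shift_down I)) {1..card I} (shift_down I)"
    using slot shift_down(3)[OF I] by metis
  then show "kernel_compl I J \<subseteq> shift_down I" using J by (auto simp: kernel_compl_def bij_betw_def)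
  show "card (kernel_compl I J) = card J"
    unfolding kernel_compl_def using bij J by (intro card_image) (auto simp: bij_betw_def intro: inj_on_subset)
qed

lemma kernel_compl_inj:
  assumes I: "I \<subseteq> {1..n}" and J: "J \<subseteq> {1..card I}" "J' \<subseteq> {1..card I}"
    and "kernel_compl I J = kernel_compl I J'"
  shows "J = J'"
proof -
  have "finite (shift_down I)" using shift_down(2)[OF I] finite_subset by blast
  then have "inj_on (slot (shift_down I)) {1..card I}"
    using slot[of "shift_down I"] shift_down(3)[OF I] by (auto simp: bij_betw_def)
  then show ?thesis using assms inj_on_image_eq_iff unfolding kernel_compl_def by blast
qed

lemma kernel_compl_surj:
  assumes I: "I \<subseteq> {1..n}" and K: "K \<subseteq> shift_down I"
  shows "\<exists>J\<subseteq>{1..card I}. K = kernel_compl I J"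
proof -
  have "finite (shift_down I)" using shift_down(2)[OF I] finite_subset by blast
  then have "slot (shift_down I) ` {1..card I} = shift_down I"
    using slot[of "shift_down I"] shift_down(3)[OF I] by (auto simp: bij_betw_def)
  then show ?thesis using K unfolding kernel_compl_def by (metis subset_image_iff)
qed

context conj_field
begin

text \<open>The group is defined by \<open>adj u * F * u = F\<close>, whereas congruence of the
  forms \<open>h * F * adj h\<close> involves \<open>u * F * adj u\<close>. The two conditions agree
  because \<open>F * (adj u * F)\<close> inverts \<open>u\<close> and \<open>F * F\<close> is the
  identity.\<close>

lemma form_group_adj:
  assumes u: "u \<in> carrier_mat (p + q) (p + q)" and e: "adj u * I_pq p q * u = I_pq p q"
  shows "u * I_pq p q * adj u = I_pq p q"
proof -
  define F where "F = (I_pq p q :: 'a mat)"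
  have Fc: "F \<in> carrier_mat (p + q) (p + q)" and FF: "F * F = 1\<^sub>m (p + q)"
    unfolding F_def by (rule I_pq_carrier, rule I_pq_mult_self)
  have e: "adj u * F * u = F" using e by (simp add: F_def)
  have Lc: "F * (adj u * F) \<in> carrier_mat (p + q) (p + q)" using Fc u by (intro carrier_matI) auto
  have "(F * (adj u * F)) * u = F * (adj u * F * u)" using Fc u by (simp add: mat_assoc)
  also have "\<dots> = 1\<^sub>m (p + q)" unfolding e FF ..
  finally have "u * (F * (adj u * F)) = 1\<^sub>m (p + q)"
    by (rule mat_mult_left_right_inverse[OF Lc u])
  then have "u * (F * (adj u * F)) * F = F" using Fc by (simp add: mat_one_left)
  moreover have "u * (F * (adj u * F)) * F = u * F * adj u * (F * F)" using Fc u by (simp add: mat_assoc)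
  ultimately have "u * F * adj u * (F * F) = F" by simp
  then have "u * F * adj u = F" unfolding FF using u by (simp add: mat_one_right)
  then show ?thesis by (simp add: F_def)
qed

text \<open>The unitary or orthogonal group is the stabilizer of \<open>I_pq p q\<close> under
  congruence, so the coset of \<open>h\<close> is the form \<open>h * I_pq p q * adj h\<close>.
  Conversely, a congruence \<open>b\<close> of forms forces \<open>u\<close> to be the inverse of
  \<open>b * h\<close> times \<open>h'\<close>.\<close>

lemma form_group_double_coset_iff:
  assumes h: "h \<in> GLm (p + q)" "h' \<in> GLm (p + q)"
  shows "{b * h * u | b u. b \<in> Bk (p + q) \<and> u \<in> form_group adj (I_pq p q) (p + q)} =
      {b * h' * u | b u. b \<in> Bk (p + q) \<and> u \<in> form_group adj (I_pq p q) (p + q)} \<longleftrightarrow>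
    (\<exists>b\<in>Bk (p + q). h' * I_pq p q * adj h' = b * (h * I_pq p q * adj h) * adj b)"
proof -
  define r where "r = p + q"
  define F where "F = (I_pq p q :: 'a mat)"
  have Fc: "F \<in> carrier_mat r r" unfolding F_def r_def by (rule I_pq_carrier)
  have h: "h \<in> GLm r" "h' \<in> GLm r" using h by (auto simp: r_def)
  note hc = h[THEN GLm_carrier]
  have "{b * h * u | b u. b \<in> Bk r \<and> u \<in> form_group adj F r} = {b * h' * u | b u. b \<in> Bk r \<and> u \<in> form_group adj F r} \<longleftrightarrow>
      (\<exists>b\<in>Bk r. \<exists>u\<in>form_group adj F r. h' = b * h * u)"
    by (rule double_coset_eq_iff[OF mat_group_Bk mat_group_form_group[OF Fc] hc])
  also have "\<dots> \<longleftrightarrow> (\<exists>b\<in>Bk r. h' * F * adj h' = b * (h * F * adj h) * adj b)"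
  proof
    assume "\<exists>b\<in>Bk r. \<exists>u\<in>form_group adj F r. h' = b * h * u"
    then obtain b u where b: "b \<in> Bk r" and u: "u \<in> GLm r" "adj u * F * u = F" and e: "h' = b * h * u"
      by (auto simp: form_group_def)
    note c = Bk_carrier[OF b] GLm_carrier[OF u(1)]
    have uF: "u * F * adj u = F"
      using form_group_adj[of u p q] c(2) u(2) by (simp add: F_def r_def)
    have "h' * F * adj h' = b * h * (u * F * adj u) * adj h * adj b"
      unfolding e using c hc Fc by (simp add: adj_mult mat_assoc)
    also have "\<dots> = b * (h * F * adj h) * adj b" unfolding uF using c hc Fc by (simp add: mat_assoc)
    finally show "\<exists>b\<in>Bk r. h' * F * adj h' = b * (h * F * adj h) * adj b" using b by blast
  next
    assume "\<exists>b\<in>Bk r. h' * F * adj h' = b * (h * F * adj h) * adj b"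
    then obtain b where b: "b \<in> Bk r" and e: "h' * F * adj h' = b * (h * F * adj h) * adj b" by blast
    note bc = Bk_carrier[OF b]
    have "b * h \<in> GLm r" by (rule GLm_mult[OF Bk_GLm[OF b] h(1)])
    then obtain k where k: "k \<in> GLm r" "(b * h) * k = 1\<^sub>m r" "k * (b * h) = 1\<^sub>m r" by (rule GLmE)
    note kc = GLm_carrier[OF k(1)]
    have ka: "adj (b * h) * adj k = 1\<^sub>m r" using arg_cong[OF k(3), of adj] kc bc hc by (simp add: adj_mult)
    define u where "u = k * h'"
    have uG: "u \<in> GLm r" unfolding u_def by (rule GLm_mult[OF k(1) h(2)])
    note uc = GLm_carrier[OF uG]
    have "u * F * adj u = k * (h' * F * adj h') * adj k"
      unfolding u_def using kc hc Fc by (simp add: adj_mult mat_assoc)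
    also have "\<dots> = (k * (b * h)) * F * (adj (b * h) * adj k)"
      unfolding e using kc bc hc Fc by (simp add: adj_mult mat_assoc)
    also have "\<dots> = F" unfolding k(3) ka using Fc by simp
    finally have uF: "u * F * adj u = F" .
    have "adj u * F * u = F"
      using form_group_adj[of "adj u" p q] adj_carrier[OF uc] uF by (simp add: F_def r_def)
    then have "u \<in> form_group adj F r" using uG by (simp add: form_group_def)
    moreover have "b * h * u = h'"
    proof -
      have "b * h * u = (b * h) * k * h'" unfolding u_def using bc hc kc by (simp add: mat_assoc)
      then show ?thesis unfolding k(2) using hc by simp
    qed
    ultimately show "\<exists>b\<in>Bk r. \<exists>u\<in>form_group adj F r. h' = b * h * u" using b by metis
  qed
  finally show ?thesis unfolding r_def F_def .
qed

section \<open>Double cosets and their representatives\<close>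

abbreviation UG_class :: "nat \<Rightarrow> 'a mat \<Rightarrow> 'a mat set" where
  "UG_class n g \<equiv> {b * g * p | b p. b \<in> levi adj n upper_triangular \<and> p \<in> siegel_parabolic (UG n) n}"

lemma UG_class_block_iff:
  assumes g: "four_block_mat A B C D \<in> UG n" "four_block_mat A' B' C' D' \<in> UG n"
    and c: "A \<in> carrier_mat n n" "B \<in> carrier_mat n n" "C \<in> carrier_mat n n" "D \<in> carrier_mat n n"
    and c': "A' \<in> carrier_mat n n" "B' \<in> carrier_mat n n" "C' \<in> carrier_mat n n" "D' \<in> carrier_mat n n"
  shows "UG_class n (four_block_mat A B C D) = UG_class n (four_block_mat A' B' C' D') \<longleftrightarrow> lagr_rel n A C A' C'"
  unfolding double_coset_eq_iff[OF mat_group_levi_upper siegel_parabolic_mat_group[OF mat_group_UG]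
      mat_groupD(1)[OF mat_group_UG g(1)] mat_groupD(1)[OF mat_group_UG g(2)]] lagr_rel_def
  by (rule UG_double_coset_iff[OF g c c'])

lemma UG_class_model_iff:
  assumes S: "herm_on n I S" "herm_on n I' S'"
  shows "UG_class n (model n I S) = UG_class n (model n I' S') \<longleftrightarrow>
    lagr_rel n (S + diag_proj n (- I)) (diag_proj n I) (S' + diag_proj n (- I')) (diag_proj n I')"
  using model_UG[OF S(1)] model_UG[OF S(2)] herm_onD(1)[OF S(1)] herm_onD(1)[OF S(2)] unfolding model_def
  by (intro UG_class_block_iff) auto

lemma UG_class_eq_model:
  assumes g: "g \<in> UG n"
  shows "\<exists>I S. I \<subseteq> {..<n} \<and> herm_on n I S \<and> UG_class n g = UG_class n (model n I S)"
proof -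
  obtain h where h: "h \<in> UG n" "h * g = 1\<^sub>m (2 * n)" using mat_groupE[OF mat_group_UG g] by metis
  obtain A B C D where gb: "g = four_block_mat A B C D" and c: "A \<in> carrier_mat n n" "B \<in> carrier_mat n n"
    "C \<in> carrier_mat n n" "D \<in> carrier_mat n n"
    using four_block_matE[OF mat_groupD(1)[OF mat_group_UG g]] .
  obtain P Q R W where hb: "h = four_block_mat P Q R W" and hc: "P \<in> carrier_mat n n" "Q \<in> carrier_mat n n"
    "R \<in> carrier_mat n n" "W \<in> carrier_mat n n"
    using four_block_matE[OF mat_groupD(1)[OF mat_group_UG h(1)]] .
  \<comment> \<open>The upper left block of this product is the independence condition required by
    \<open>lagr_rel_model\<close>.\<close>
  have "four_block_mat (P * A + Q * C) (P * B + Q * D) (R * A + W * C) (R * B + W * D) = h * g"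
    unfolding hb gb using c hc by (subst mult_four_block_mat) auto
  also have "\<dots> = four_block_mat (1\<^sub>m n) (0\<^sub>m n n) (0\<^sub>m n n) (1\<^sub>m n)"
    using h(2) by (simp only: four_block_one2)
  finally have inj: "P * A + Q * C = 1\<^sub>m n" by (rule four_block_mat_eqD[where k=n and l=n and l'=n and k'=n]) (use c hc in auto)
  obtain I S where IS: "I \<subseteq> {..<n}" "herm_on n I S" "lagr_rel n A C (S + diag_proj n (- I)) (diag_proj n I)"
    using lagr_rel_model[OF c(1,3) hc(1,2) UG_blockD[OF g[unfolded gb] c] inj] by blast
  have "UG_class n g = UG_class n (model n I S) \<longleftrightarrow> lagr_rel n A C (S + diag_proj n (- I)) (diag_proj n I)"
    using g model_UG[OF IS(2)] herm_onD(1)[OF IS(2)] c unfolding model_def gb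
    by (intro UG_class_block_iff) auto
  then show ?thesis using IS by blast
qed

lemma coprod_indexD:
  assumes "(m, p, q, I, J) \<in> coprod_index n"
  shows "I \<subseteq> {1..n}" "m = card I" "J \<subseteq> {1..card I}" "p + q = card (kernel_compl I J)"
    "kernel_compl I J \<subseteq> shift_down I" "shift_down I \<subseteq> {..<n}" "kernel_compl I J \<subseteq> {..<n}"
proof -
  show I: "I \<subseteq> {1..n}" and m: "m = card I" and J: "J \<subseteq> {1..card I}"
    using assms by (auto simp: coprod_index_def)
  have "p + q = card J" using assms by (auto simp: coprod_index_def)
  then show "p + q = card (kernel_compl I J)" using kernel_compl(2)[OF I J] by simp
  show k: "kernel_compl I J \<subseteq> shift_down I" and s: "shift_down I \<subseteq> {..<n}"
    using kernel_compl(1)[OF I J] shift_down(2)[OF I] by auto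
  then show "kernel_compl I J \<subseteq> {..<n}" by blast
qed

text \<open>The bijection is built from the coproduct to the double cosets, where representatives
  are explicit: an index and \<open>h\<close> give the model of the form
  \<open>h * I_pq p q * adj h\<close> placed on \<open>K\<close> inside \<open>I\<close>. It is
  inverted at the end.\<close>

theorem double_cosets_bij:
  "\<exists>g. bij_betw g (double_cosets (levi adj n upper_triangular) (UG n) (siegel_parabolic (UG n) n))
    (SIGMA (m, p, q, I, J) : coprod_index n.
      double_cosets (Bk (p + q)) (GLm (p + q)) (form_group adj (I_pq p q) (p + q)))"
proof -
  define cls :: "nat \<Rightarrow> nat \<Rightarrow> 'a mat \<Rightarrow> 'a mat set" where
    "cls p q h = {b * h * u | b u. b \<in> Bk (p + q) \<and> u \<in> form_group adj (I_pq p q) (p + q)}" for p q h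
  define X :: "((nat \<times> nat \<times> nat \<times> nat set \<times> nat set) \<times> 'a mat) set"
    where "X = (SIGMA (m, p, q, I, J) : coprod_index n. GLm (p + q))"
  \<comment> \<open>The index is kept as a tag, so that equal sets of matrices belonging to
    different summands remain distinct.\<close>
  define f where "f = (\<lambda>((m, p, q, I, J), h). ((m :: nat, p, q, I :: nat set, J :: nat set), cls p q h))"
  define frm where "frm p q h = h * I_pq p q * adj h" for p q h
  define \<phi> where "\<phi> = (\<lambda>((m :: nat, p, q, I, J), h). model n (shift_down I) (form_at n (kernel_compl I J) (frm p q h)))"
  have frm: "frm p q h \<in> GLm (p + q)" "adj (frm p q h) = frm p q h" if "h \<in> GLm (p + q)" for p q h
    unfolding frm_def
    by (rule form_GLm[OF that I_pq_GLm], rule adj_form[OF adj_I_pq GLm_carrier[OF that] I_pq_carrier])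
  have herm: "herm_on n (shift_down I) (form_at n (kernel_compl I J) (frm p q h))"
    if "(m, p, q, I, J) \<in> coprod_index n" "h \<in> GLm (p + q)" for m p q I J h
    using coprod_indexD[OF that(1)] frm[OF that(2)] by (intro herm_on_form_at) (auto dest: GLm_carrier)
  have "\<exists>F. bij_betw F (f ` X) (UG_class n ` UG n)"
  proof (rule bij_betw_imagesI[where \<phi> = \<phi>])
    fix x assume "x \<in> X"
    then show "\<phi> x \<in> UG n"
      using herm by (auto simp: X_def \<phi>_def intro!: model_UG)
  next
    fix x x' assume "x \<in> X" "x' \<in> X"
    then obtain m p q I J h m' p' q' I' J' h' where
      x: "x = ((m, p, q, I, J), h)" "(m, p, q, I, J) \<in> coprod_index n" "h \<in> GLm (p + q)" and
      x': "x' = ((m', p', q', I', J'), h')" "(m', p', q', I', J') \<in> coprod_index n" "h' \<in> GLm (p' + q')"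
      by (auto simp: X_def)
    note i = coprod_indexD[OF x(2)] and i' = coprod_indexD[OF x'(2)]
    let ?I = "shift_down I" and ?I' = "shift_down I'" and ?K = "kernel_compl I J" and ?K' = "kernel_compl I' J'"
    let ?T = "frm p q h" and ?T' = "frm p' q' h'"
    have T: "?T \<in> GLm (card ?K)" "?T' \<in> GLm (card ?K')" using frm(1)[OF x(3)] frm(1)[OF x'(3)] i(4) i'(4) by simp_all
    have iff: "UG_class n (\<phi> x) = UG_class n (\<phi> x') \<longleftrightarrow> lagr_rel n (form_at n ?K ?T + diag_proj n (- ?I)) (diag_proj n ?I)
        (form_at n ?K' ?T' + diag_proj n (- ?I')) (diag_proj n ?I')"
      unfolding x(1) x'(1) \<phi>_def prod.case by (rule UG_class_model_iff[OF herm[OF x(2,3)] herm[OF x'(2,3)]])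
    show "f x = f x' \<longleftrightarrow> UG_class n (\<phi> x) = UG_class n (\<phi> x')"
      unfolding iff
    proof
      assume "f x = f x'"
      then have eq: "m' = m" "p' = p" "q' = q" "I' = I" "J' = J" and "cls p q h = cls p q h'"
        by (auto simp: f_def x(1) x'(1))
      then obtain b where b: "b \<in> Bk (p + q)" "?T' = b * ?T * adj b"
        using form_group_double_coset_iff[of h p q h'] x(3) x'(3) unfolding cls_def frm_def by auto
      obtain \<beta> where \<beta>: "\<beta> \<in> Bk n" "\<beta> * diag_proj n (- ?I) = diag_proj n (- ?I)" "diag_proj n (- ?I) * \<beta> = diag_proj n (- ?I)"
        "form_at n ?K (b * ?T * adj b) = \<beta> * form_at n ?K ?T * adj \<beta>"
        using form_at_congruent[OF i(7,5), of b ?T] b(1) GLm_carrier[OF T(1)] i(4) by auto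
      show "lagr_rel n (form_at n ?K ?T + diag_proj n (- ?I)) (diag_proj n ?I)
        (form_at n ?K' ?T' + diag_proj n (- ?I')) (diag_proj n ?I')"
        unfolding b(2) eq(4,5) \<beta>(4) by (rule model_rel_congruent[OF herm[OF x(2,3)] \<beta>(1-3)])
    next
      assume "lagr_rel n (form_at n ?K ?T + diag_proj n (- ?I)) (diag_proj n ?I)
        (form_at n ?K' ?T' + diag_proj n (- ?I')) (diag_proj n ?I')"
      then obtain z where z: "?I' = ?I" "z \<in> Bk n" "form_at n ?K' ?T' = z * form_at n ?K ?T * adj z"
        using model_rel_imp_congruent[OF i(6) i'(6) herm[OF x(2,3)] herm[OF x'(2,3)]] by blast
      have I: "I' = I" using shift_down(1)[OF i(1)] shift_down(1)[OF i'(1)] z(1) by simp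
      obtain b where b: "?K' = ?K" "b \<in> Bk (card ?K)" "?T' = b * ?T * adj b"
        using form_at_congruentD[OF i(7) i'(7) T z(2,3)] by blast
      have J: "J' = J" using kernel_compl_inj[OF i(1) _ i(3), of J'] i'(3) b(1) unfolding I by simp
      define r where "r = card ?K"
      have r: "p + q = r" "p' + q' = r" using i(4) i'(4) b(1) by (simp_all add: r_def)
      have hr: "h \<in> GLm r" "h' \<in> GLm r" "b \<in> Bk r" using x(3) x'(3) r b(2) by (simp_all add: r_def)
      \<comment> \<open>With \<open>k\<close> the inverse of \<open>h'\<close>, the matrix
        \<open>k * b * h\<close> carries \<open>I_pq p q\<close> to \<open>I_pq p' q'\<close>, so
        the law of inertia identifies the signatures.\<close>
      obtain k where k: "k \<in> GLm r" "k * h' = 1\<^sub>m r" using hr(2) by (metis GLmE)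
      note c = hr(1,2)[THEN GLm_carrier] k(1)[THEN GLm_carrier] Bk_carrier[OF hr(3)]
      have Ic: "(I_pq p q :: 'a mat) \<in> carrier_mat r r" "(I_pq p' q' :: 'a mat) \<in> carrier_mat r r"
        using r I_pq_carrier[of p q] I_pq_carrier[of p' q'] by simp_all
      have "k * b * h \<in> GLm r" by (rule GLm_mult[OF GLm_mult[OF k(1) Bk_GLm[OF hr(3)]] hr(1)])
      moreover have "(k * b * h) * I_pq p q * adj (k * b * h) = I_pq p' q'"
      proof -
        have gen: "(k * b * h) * F * adj (k * b * h) = k * (b * (h * F * adj h) * adj b) * adj k"
          if "F \<in> carrier_mat r r" for F using c that by (simp add: adj_mult mat_assoc)
        have gen': "k * (h' * F * adj h') * adj k = (k * h') * F * adj (k * h')"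
          if "F \<in> carrier_mat r r" for F using c that by (simp add: adj_mult mat_assoc)
        have "(k * b * h) * I_pq p q * adj (k * b * h) = k * ?T' * adj k"
          unfolding gen[OF Ic(1)] b(3) by (simp add: frm_def)
        also have "\<dots> = (k * h') * I_pq p' q' * adj (k * h')"
          unfolding frm_def gen'[OF Ic(2)] ..
        also have "\<dots> = I_pq p' q'" unfolding k(2) adj_one
          using left_mult_one_mat[OF Ic(2)] right_mult_one_mat[OF Ic(2)] by simp
        finally show ?thesis .
      qed
      ultimately have pq: "p' = p" "q' = q" using signature_unique[OF _ r] by blast+
      have "cls p q h = cls p q h'"
        unfolding cls_def using form_group_double_coset_iff[of h p q h'] x(3) x'(3) b(2,3) i(4) pq
        unfolding frm_def by auto
      then show "f x = f x'" using I J pq i(2) i'(2) by (simp add: f_def x(1) x'(1))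
    qed
  next
    fix g assume "g \<in> UG n"
    from UG_class_eq_model[OF this] obtain I0 S
      where I0: "I0 \<subseteq> {..<n}" and S: "herm_on n I0 S" and g: "UG_class n g = UG_class n (model n I0 S)"
      by (elim exE conjE)
    obtain K T \<beta> where K: "K \<subseteq> I0" and T: "T \<in> GLm (card K)" "adj T = T" and \<beta>: "\<beta> \<in> Bk n"
      "\<beta> * diag_proj n (- I0) = diag_proj n (- I0)" "diag_proj n (- I0) * \<beta> = diag_proj n (- I0)"
      "\<beta> * S * adj \<beta> = form_at n K T"
      using herm_on_reduce[OF S I0] by blast
    obtain p q h where pq: "p + q = card K" and h: "h \<in> GLm (card K)" "T = h * I_pq p q * adj h"
      using hermitian_normal_form[OF T] by blast
    define I where "I = Suc ` I0"
    have I: "I \<subseteq> {1..n}" using I0 by (auto simp: I_def)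
    have sI: "shift_down I = I0" by (auto simp: I_def shift_down_def)
    obtain J where J: "J \<subseteq> {1..card I}" "K = kernel_compl I J" using kernel_compl_surj[OF I] K sI by blast
    have cardI: "card I \<le> n" using card_mono[OF _ I] by simp
    have "p + q = card J" using kernel_compl(2)[OF I J(1)] J(2) pq by simp
    moreover have "card J \<le> card I" using card_mono[OF _ J(1)] by simp
    ultimately have idx: "(card I, p, q, I, J) \<in> coprod_index n"
      using I J(1) cardI by (auto simp: coprod_index_def)
    have hG: "h \<in> GLm (p + q)" using h(1) pq by simp
    have "\<phi> ((card I, p, q, I, J), h) = model n I0 (form_at n K T)"
      by (simp add: \<phi>_def sI J(2) h(2) frm_def)
    moreover have "herm_on n I0 (form_at n K T)" using herm[OF idx hG] by (simp add: sI J(2) h(2) frm_def)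
    from UG_class_model_iff[OF S this] have "UG_class n (model n I0 S) = UG_class n (model n I0 (form_at n K T))"
      using model_rel_congruent[OF S \<beta>(1-3)] unfolding \<beta>(4) by (rule iffD2)
    moreover have "((card I, p, q, I, J), h) \<in> X" using idx hG by (simp add: X_def)
    ultimately show "\<exists>x\<in>X. UG_class n g = UG_class n (\<phi> x)"
      using g by (intro bexI[of _ "((card I, p, q, I, J), h)"]) simp_all
  qed
  then obtain F where F: "bij_betw F (f ` X) (UG_class n ` UG n)" by blast
  have X: "f ` X = (SIGMA (m, p, q, I, J) : coprod_index n.
      double_cosets (Bk (p + q)) (GLm (p + q)) (form_group adj (I_pq p q) (p + q)))"
    unfolding X_def f_def double_cosets_def cls_def by (force simp: image_iff)
  have Y: "UG_class n ` UG n = double_cosets (levi adj n upper_triangular) (UG n) (siegel_parabolic (UG n) n)"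
    unfolding double_cosets_def ..
  show ?thesis by (rule exI, rule bij_betw_inv_into[OF F, unfolded X Y])
qed

lemma orbits_bij:
  "\<exists>f. bij_betw f (diag_orbits (levi adj n (\<lambda>_. True)) (left_cosets (levi adj n (\<lambda>_. True)) (levi adj n upper_triangular))
      (left_cosets (UG n) (siegel_parabolic (UG n) n)))
    (double_cosets (levi adj n upper_triangular) (UG n) (siegel_parabolic (UG n) n))"
proof (rule diag_orbits_bij[OF mat_group_UG mat_group_levi_full mat_group_levi_upper
      siegel_parabolic_mat_group[OF mat_group_UG] levi_subset_UG])
  show "levi adj n upper_triangular \<subseteq> levi adj n (\<lambda>_. True)" by (rule levi_mono) simp
  show "siegel_parabolic (UG n) n \<subseteq> UG n" unfolding siegel_parabolic_def by (rule Collect_restrict)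
qed

end

section \<open>The complex and the real case\<close>

interpretation cx: conj_field cnj
proof
  show "x \<in> \<real>" if "cnj x = x" for x using that Reals_cnj_iff by blast
  show "\<exists>r>0. x * cnj x = of_real r" if "x \<noteq> 0" for x
    using that by (intro exI[of _ "(cmod x)\<^sup>2"]) (simp add: complex_norm_square del: of_real_power)
qed auto

interpretation re: conj_field "\<lambda>x :: real. x"
proof
  show "x \<in> \<real>" if "x = x" for x :: real by (metis Reals_of_real of_real_eq_id id_apply)
  show "\<exists>r>0. x * x = of_real r" if "x \<noteq> 0" for x :: real
    using that by (intro exI[of _ "x * x"]) (auto simp: zero_less_mult_iff linorder_neq_iff)
qed auto

lemma cx_adj: "cx.adj = adj_c"
  by (rule ext) (simp add: cx.adj_def adj_c_def)

lemma re_adj: "re.adj = transpose_mat"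
  by (rule ext) (simp add: re.adj_def transpose_mat_def)

lemma U_nn_eq: "U_nn n = cx.UG n"
proof -
  have "adj_c g * J_n n * g = J_n n \<longleftrightarrow> adj_c g * Sigma_n n * g = Sigma_n n" if "g \<in> carrier_mat (2 * n) (2 * n)" for g
  proof -
    have g': "adj_c g \<in> carrier_mat (2 * n) (2 * n)" using that by (simp add: adj_c_def)
    have m: "adj_c g * Sigma_n n * g \<in> carrier_mat (2 * n) (2 * n)"
      by (rule mult_carrier_mat[OF mult_carrier_mat[OF g' Sigma_n_carrier] that])
    have "adj_c g * J_n n * g = \<i> \<cdot>\<^sub>m (adj_c g * Sigma_n n * g)"
      unfolding J_n_def mult_smult_distrib[OF g' Sigma_n_carrier]
      by (rule mult_smult_assoc_mat[OF mult_carrier_mat[OF g' Sigma_n_carrier] that])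
    moreover have "A = B" if "\<i> \<cdot>\<^sub>m A = \<i> \<cdot>\<^sub>m B" "A \<in> carrier_mat (2 * n) (2 * n)" "B \<in> carrier_mat (2 * n) (2 * n)" for A B :: "complex mat"
    proof (rule eq_matI)
      fix i j assume "i < dim_row B" "j < dim_col B"
      then have "\<i> * A $$ (i, j) = \<i> * B $$ (i, j)"
        using arg_cong[OF that(1), of "\<lambda>M. M $$ (i, j)"] that(2,3) by simp
      then show "A $$ (i, j) = B $$ (i, j)" by simp
    qed (use that in auto)
    ultimately show ?thesis using m Sigma_n_carrier[of n] unfolding J_n_def by metis
  qed
  then show ?thesis unfolding U_nn_def cx.UG_def cx_adj form_group_def using GLm_carrier by blast
qed

lemma Sp_2n_eq: "Sp_2n n = re.UG n"
  by (simp add: Sp_2n_def re.UG_def re_adj)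

theorem theorem1p7:
  fixes n :: nat
  shows
   "(\<exists>f. bij_betw f (diag_orbits (HA n) (left_cosets (HA n) (BHA n)) (left_cosets (U_nn n) (PGA n)))
                    (double_cosets (BHA n) (U_nn n) (PGA n)))
    \<and> (\<exists>g. bij_betw g (double_cosets (BHA n) (U_nn n) (PGA n))
             (SIGMA (m, p, q, I, J) : coprod_index n.
                 double_cosets (Bk (p + q)) (GLm (p + q)) (U_pq p q)))
    \<and> (\<exists>f. bij_betw f (diag_orbits (HB n) (left_cosets (HB n) (BHB n)) (left_cosets (Sp_2n n) (PGB n)))
                    (double_cosets (BHB n) (Sp_2n n) (PGB n)))
    \<and> (\<exists>g. bij_betw g (double_cosets (BHB n) (Sp_2n n) (PGB n))
             (SIGMA (m, p, q, I, J) : coprod_index n.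
                 double_cosets (Bk (p + q)) (GLm (p + q)) (O_pq p q)))"
  unfolding HA_def BHA_def PGA_def HB_def BHB_def PGB_def U_nn_eq Sp_2n_eq U_pq_def O_pq_def
    cx_adj[symmetric] re_adj[symmetric]
  by (intro conjI cx.orbits_bij cx.double_cosets_bij re.orbits_bij re.double_cosets_bij)

end
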